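(* Let $(W,S)$ be a finite Coxeter group with braid group $B$, let $q\in\mathbb{C}$, and let $H_q$ be the Hecke algebra of $(W,S)$ over $\mathbb{C}$ with parameter $q$, i.e. the quotient of the group algebra $\mathbb{C}[B]$ by the relations $(s-q)(s+1)=0$ for every $s\in S$. Assume that $q$ is not a root of unity. Then every representation of $H_q$ is good (as a representation of $B$).
   Context: Let $\tau:W\to B$ be the canonical section given by reduced decompositions ($\tau(s)=s$ for $s\in S$, $\tau(ww')=\tau(w)\tau(w')$ when $\ell(ww')=\ell(w)+\ell(w')$). For a representation $V$ of $B$ put $V_s=(s^2-1)V$ for $s\in S$, and $$K_W(V)=\{(x_w)_{w\in W}\in V^W:\ x_{sw}-s\,x_w\in V_s\ \text{for all } s\in S,\ w\in W\}$$ (in the index, $s$ denotes the element of $W$; in $s\,x_w$ it denotes the generator of $B$). For $y\in W$ there is an embedding $i_y:V\to K_W(V)$, $i_y(v)=(\tau(wy^{-1})v)_{w\in W}$. The representation $V$ is called good if $K_W(V)$ is generated (spanned) by the subspaces $i_y(V)$, $y\in W$. *)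

theory Defs
  imports Complex_Main "HOL-Library.Function_Algebras" "HOL-Algebra.Multiplicative_Group" "HOL-Algebra.QuotRing"
begin

section \<open>Groups given by generators and relations\<close>

text \<open>A letter \<open>(a, True)\<close> stands for the generator \<open>a\<close> and \<open>(a, False)\<close> for its inverse.\<close>

type_synonym 'a word = "('a \<times> bool) list"

definition signed_words :: "'a set \<Rightarrow> 'a word set" where
  "signed_words S = lists (S \<times> UNIV)"

definition positive_word :: "'a list \<Rightarrow> 'a word" where
  "positive_word u = map (\<lambda>a. (a, True)) u"

inductive word_eq :: "'a set \<Rightarrow> ('a word \<times> 'a word) set \<Rightarrow> 'a word \<Rightarrow> 'a word \<Rightarrow> bool"
  for S :: "'a set" and R :: "('a word \<times> 'a word) set" where
  word_refl: "u \<in> signed_words S \<Longrightarrow> word_eq S R u u"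
| word_sym: "word_eq S R u v \<Longrightarrow> word_eq S R v u"
| word_trans: "word_eq S R u v \<Longrightarrow> word_eq S R v w \<Longrightarrow> word_eq S R u w"
| cancel: "a \<in> S \<Longrightarrow> u \<in> signed_words S \<Longrightarrow> v \<in> signed_words S \<Longrightarrow>
    word_eq S R (u @ [(a, e), (a, \<not> e)] @ v) (u @ v)"
| relation: "(r, r') \<in> R \<Longrightarrow> r \<in> signed_words S \<Longrightarrow> r' \<in> signed_words S \<Longrightarrow>
    u \<in> signed_words S \<Longrightarrow> v \<in> signed_words S \<Longrightarrow>
    word_eq S R (u @ r @ v) (u @ r' @ v)"

definition word_rel :: "'a set \<Rightarrow> ('a word \<times> 'a word) set \<Rightarrow> ('a word \<times> 'a word) set" where
  "word_rel S R = {(u, v). word_eq S R u v}"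

definition presented_group :: "'a set \<Rightarrow> ('a word \<times> 'a word) set \<Rightarrow> 'a word set monoid" where
  "presented_group S R =
    \<lparr>carrier = signed_words S // word_rel S R,
     monoid.mult = (\<lambda>P Q. \<Union>u\<in>P. \<Union>v\<in>Q. word_rel S R `` {u @ v}),
     one = word_rel S R `` {[]}\<rparr>"

definition word_prod :: "('g, 'm) monoid_scheme \<Rightarrow> 'g list \<Rightarrow> 'g" where
  "word_prod G u = foldr (monoid.mult G) u (one G)"

definition signed_prod :: "('g, 'm) monoid_scheme \<Rightarrow> 'g word \<Rightarrow> 'g" where
  "signed_prod G u = word_prod G (map (\<lambda>(a, e). if e then a else inv\<^bsub>G\<^esub> a) u)"

definition has_presentation ::
    "('g, 'm) monoid_scheme \<Rightarrow> 'g set \<Rightarrow> ('g word \<times> 'g word) set \<Rightarrow> bool" where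
  "has_presentation G S R \<longleftrightarrow>
    S \<subseteq> carrier G \<and>
    signed_prod G ` signed_words S = carrier G \<and>
    (\<forall>u\<in>signed_words S. \<forall>v\<in>signed_words S.
      signed_prod G u = signed_prod G v \<longleftrightarrow> word_eq S R u v)"


section \<open>Coxeter groups and braid groups\<close>

text \<open>An order \<open>group.ord W (s \<otimes> t) = 0\<close> encodes \<open>m(s,t) = \<infinity>\<close>, which imposes no relation.
  The case \<open>s = t\<close>, where \<open>m(s,s) = 1\<close>, gives the relation \<open>s s = 1\<close>.\<close>

definition coxeter_relations :: "('w, 'm) monoid_scheme \<Rightarrow> 'w set \<Rightarrow> ('w word \<times> 'w word) set" where
  "coxeter_relations W S =
    {(positive_word (concat (replicate (group.ord W (s \<otimes>\<^bsub>W\<^esub> t)) [s, t])), []) | s t.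
      s \<in> S \<and> t \<in> S \<and> group.ord W (s \<otimes>\<^bsub>W\<^esub> t) > 0}"

definition coxeter_system :: "('w, 'm) monoid_scheme \<Rightarrow> 'w set \<Rightarrow> bool" where
  "coxeter_system W S \<longleftrightarrow>
    group W \<and> S \<subseteq> carrier W \<and>
    (\<forall>s\<in>S. s \<noteq> \<one>\<^bsub>W\<^esub> \<and> s \<otimes>\<^bsub>W\<^esub> s = \<one>\<^bsub>W\<^esub>) \<and>
    has_presentation W S (coxeter_relations W S)"

fun alternating :: "nat \<Rightarrow> 'a \<Rightarrow> 'a \<Rightarrow> 'a list" where
  "alternating 0 s t = []"
| "alternating (Suc n) s t = s # alternating n t s"

definition braid_relations :: "('w, 'm) monoid_scheme \<Rightarrow> 'w set \<Rightarrow> ('w word \<times> 'w word) set" where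
  "braid_relations W S =
    {(positive_word (alternating (group.ord W (s \<otimes>\<^bsub>W\<^esub> t)) s t),
      positive_word (alternating (group.ord W (s \<otimes>\<^bsub>W\<^esub> t)) t s)) | s t.
      s \<in> S \<and> t \<in> S \<and> s \<noteq> t \<and> group.ord W (s \<otimes>\<^bsub>W\<^esub> t) > 0}"

definition braid_group :: "('w, 'm) monoid_scheme \<Rightarrow> 'w set \<Rightarrow> 'w word set monoid" where
  "braid_group W S = presented_group S (braid_relations W S)"

definition braid_generator :: "('w, 'm) monoid_scheme \<Rightarrow> 'w set \<Rightarrow> 'w \<Rightarrow> 'w word set" where
  "braid_generator W S s = word_rel S (braid_relations W S) `` {[(s, True)]}"

definition reduced_decomposition ::
    "('w, 'm) monoid_scheme \<Rightarrow> 'w set \<Rightarrow> 'w \<Rightarrow> 'w list \<Rightarrow> bool" where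
  "reduced_decomposition W S w u \<longleftrightarrow>
    u \<in> lists S \<and> word_prod W u = w \<and>
    (\<forall>u'\<in>lists S. word_prod W u' = w \<longrightarrow> length u \<le> length u')"

text \<open>By Matsumoto's theorem the value does not depend on the chosen reduced decomposition.\<close>

definition canonical_section :: "('w, 'm) monoid_scheme \<Rightarrow> 'w set \<Rightarrow> 'w \<Rightarrow> 'w word set" where
  "canonical_section W S w =
    word_prod (braid_group W S)
      (map (braid_generator W S) (SOME u. reduced_decomposition W S w u))"


section \<open>Good representations\<close>

definition linear_endomorphisms ::
    "(complex \<Rightarrow> 'v \<Rightarrow> 'v) \<Rightarrow> ('v :: ab_group_add \<Rightarrow> 'v) ring" where
  "linear_endomorphisms scale =
    \<lparr>carrier = {f. Vector_Spaces.linear scale scale f},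
     monoid.mult = (\<lambda>f g. f \<circ> g), one = id, zero = (\<lambda>v. 0), add = (\<lambda>f g v. f v + g v)\<rparr>"

definition general_linear_group ::
    "(complex \<Rightarrow> 'v \<Rightarrow> 'v) \<Rightarrow> ('v :: ab_group_add \<Rightarrow> 'v) monoid" where
  "general_linear_group scale =
    \<lparr>carrier = {f. Vector_Spaces.linear scale scale f \<and> bij f},
     monoid.mult = (\<lambda>f g. f \<circ> g), one = id\<rparr>"

definition group_representation ::
    "('g, 'm) monoid_scheme \<Rightarrow> (complex \<Rightarrow> 'v \<Rightarrow> 'v) \<Rightarrow> ('g \<Rightarrow> 'v :: ab_group_add \<Rightarrow> 'v) \<Rightarrow> bool" where
  "group_representation G scale \<rho> \<longleftrightarrow>
    vector_space scale \<and> \<rho> \<in> hom G (general_linear_group scale)"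

definition V_sub ::
    "('w, 'm) monoid_scheme \<Rightarrow> 'w set \<Rightarrow> ('w word set \<Rightarrow> 'v \<Rightarrow> 'v) \<Rightarrow> 'w \<Rightarrow> 'v :: ab_group_add set" where
  "V_sub W S \<rho> s =
    range (\<lambda>v. \<rho> (braid_generator W S s \<otimes>\<^bsub>braid_group W S\<^esub> braid_generator W S s) v - v)"

text \<open>Families indexed by \<open>W\<close> are functions that vanish outside \<open>carrier W\<close>.\<close>

definition K_space ::
    "('w, 'm) monoid_scheme \<Rightarrow> 'w set \<Rightarrow> ('w word set \<Rightarrow> 'v \<Rightarrow> 'v) \<Rightarrow> ('w \<Rightarrow> 'v :: ab_group_add) set" where
  "K_space W S \<rho> =
    {x. (\<forall>w. w \<notin> carrier W \<longrightarrow> x w = 0) \<and>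
        (\<forall>s\<in>S. \<forall>w\<in>carrier W.
          x (s \<otimes>\<^bsub>W\<^esub> w) - \<rho> (braid_generator W S s) (x w) \<in> V_sub W S \<rho> s)}"

definition K_embedding ::
    "('w, 'm) monoid_scheme \<Rightarrow> 'w set \<Rightarrow> ('w word set \<Rightarrow> 'v \<Rightarrow> 'v) \<Rightarrow> 'w \<Rightarrow>
      'v :: ab_group_add \<Rightarrow> ('w \<Rightarrow> 'v)" where
  "K_embedding W S \<rho> y v =
    (\<lambda>w. if w \<in> carrier W
         then \<rho> (canonical_section W S (w \<otimes>\<^bsub>W\<^esub> inv\<^bsub>W\<^esub> y)) v else 0)"

definition good_representation ::
    "('w, 'm) monoid_scheme \<Rightarrow> 'w set \<Rightarrow> (complex \<Rightarrow> 'v \<Rightarrow> 'v) \<Rightarrow>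
      ('w word set \<Rightarrow> 'v :: ab_group_add \<Rightarrow> 'v) \<Rightarrow> bool" where
  "good_representation W S scale \<rho> \<longleftrightarrow>
    module.span (\<lambda>c x w. scale c (x w)) (\<Union>y\<in>carrier W. range (K_embedding W S \<rho> y))
      = K_space W S \<rho>"


section \<open>Group algebras and Hecke algebras\<close>

text \<open>Elements of the group algebra are the finitely supported functions on the group, under
  convolution; \<open>algebra_single g c\<close> is \<open>c\<close> times the basis element \<open>g\<close>.\<close>

definition algebra_single :: "'g \<Rightarrow> complex \<Rightarrow> 'g \<Rightarrow> complex" where
  "algebra_single g c = (\<lambda>x. if x = g then c else 0)"

definition group_algebra :: "('g, 'm) monoid_scheme \<Rightarrow> ('g \<Rightarrow> complex) ring" where
  "group_algebra G =
    \<lparr>carrier = {f. finite {g. f g \<noteq> 0} \<and> {g. f g \<noteq> 0} \<subseteq> carrier G},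
     monoid.mult = (\<lambda>f h x. \<Sum>a\<in>{a. f a \<noteq> 0}. \<Sum>b\<in>{b. h b \<noteq> 0}.
               if a \<otimes>\<^bsub>G\<^esub> b = x then f a * h b else 0),
     one = algebra_single \<one>\<^bsub>G\<^esub> 1,
     zero = (\<lambda>x. 0),
     add = (\<lambda>f h x. f x + h x)\<rparr>"

definition hecke_ideal ::
    "('w, 'm) monoid_scheme \<Rightarrow> 'w set \<Rightarrow> complex \<Rightarrow> ('w word set \<Rightarrow> complex) set" where
  "hecke_ideal W S q =
    (let B = braid_group W S; A = group_algebra B in
      Idl\<^bsub>A\<^esub> {(algebra_single (braid_generator W S s) 1 \<ominus>\<^bsub>A\<^esub> algebra_single \<one>\<^bsub>B\<^esub> q) \<otimes>\<^bsub>A\<^esub>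
             (algebra_single (braid_generator W S s) 1 \<oplus>\<^bsub>A\<^esub> \<one>\<^bsub>A\<^esub>) | s. s \<in> S})"

definition hecke_algebra ::
    "('w, 'm) monoid_scheme \<Rightarrow> 'w set \<Rightarrow> complex \<Rightarrow> ('w word set \<Rightarrow> complex) set ring" where
  "hecke_algebra W S q = group_algebra (braid_group W S) Quot hecke_ideal W S q"

definition hecke_class ::
    "('w, 'm) monoid_scheme \<Rightarrow> 'w set \<Rightarrow> complex \<Rightarrow>
      ('w word set \<Rightarrow> complex) \<Rightarrow> ('w word set \<Rightarrow> complex) set" where
  "hecke_class W S q f = hecke_ideal W S q +>\<^bsub>group_algebra (braid_group W S)\<^esub> f"

text \<open>A representation is a homomorphism of unital complex algebras to the endomorphisms of a
  complex vector space of arbitrary dimension; the last condition is compatibility with scalars.\<close>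

definition hecke_representation ::
    "('w, 'm) monoid_scheme \<Rightarrow> 'w set \<Rightarrow> complex \<Rightarrow> (complex \<Rightarrow> 'v \<Rightarrow> 'v) \<Rightarrow>
      (('w word set \<Rightarrow> complex) set \<Rightarrow> 'v :: ab_group_add \<Rightarrow> 'v) \<Rightarrow> bool" where
  "hecke_representation W S q scale \<pi> \<longleftrightarrow>
    vector_space scale \<and>
    \<pi> \<in> ring_hom (hecke_algebra W S q) (linear_endomorphisms scale) \<and>
    (\<forall>c. \<forall>f\<in>carrier (group_algebra (braid_group W S)). \<forall>v.
      \<pi> (hecke_class W S q (\<lambda>b. c * f b)) v = scale c (\<pi> (hecke_class W S q f) v))"

definition braid_action ::
    "('w, 'm) monoid_scheme \<Rightarrow> 'w set \<Rightarrow> complex \<Rightarrow>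
      (('w word set \<Rightarrow> complex) set \<Rightarrow> 'v \<Rightarrow> 'v) \<Rightarrow> 'w word set \<Rightarrow> 'v \<Rightarrow> 'v" where
  "braid_action W S q \<pi> b = \<pi> (hecke_class W S q (algebra_single b 1))"

section \<open>Basic well-definedness facts\<close>

lemma signed_words_simps [simp]:
  "[] \<in> signed_words S"
  "u @ v \<in> signed_words S \<longleftrightarrow> u \<in> signed_words S \<and> v \<in> signed_words S"
  "(a, e) # u \<in> signed_words S \<longleftrightarrow> a \<in> S \<and> u \<in> signed_words S"
  by (auto simp: signed_words_def)

lemma word_eq_words: "word_eq S R u v \<Longrightarrow> u \<in> signed_words S \<and> v \<in> signed_words S"
  by (induction rule: word_eq.induct) auto

lemma equiv_word_rel: "equiv (signed_words S) (word_rel S R)"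
  by (rule equivI)
    (auto simp: word_rel_def refl_on_def sym_on_def trans_on_def
      intro: word_eq.word_refl word_eq.word_sym word_eq.word_trans dest: word_eq_words)

lemma word_eq_append_right:
  "word_eq S R u v \<Longrightarrow> w \<in> signed_words S \<Longrightarrow> word_eq S R (u @ w) (v @ w)"
proof (induction rule: word_eq.induct)
  case (cancel a u v e)
  then show ?case using word_eq.cancel[of a S u "v @ w" R e] by simp
next
  case (relation r r' u v)
  then show ?case using word_eq.relation[of r r' R S u "v @ w"] by simp
qed (auto intro: word_eq.word_refl word_eq.word_sym word_eq.word_trans)

lemma word_eq_append_left:
  "word_eq S R u v \<Longrightarrow> w \<in> signed_words S \<Longrightarrow> word_eq S R (w @ u) (w @ v)"
proof (induction rule: word_eq.induct)
  case (cancel a u v e)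
  then show ?case using word_eq.cancel[of a S "w @ u" v R e] by simp
next
  case (relation r r' u v)
  then show ?case using word_eq.relation[of r r' R S "w @ u" v] by simp
qed (auto intro: word_eq.word_refl word_eq.word_sym word_eq.word_trans)

lemma word_eq_append:
  assumes "word_eq S R u u'" and "word_eq S R v v'"
  shows "word_eq S R (u @ v) (u' @ v')"
  using word_eq_append_right[OF assms(1), of v] word_eq_append_left[OF assms(2), of u']
    word_eq_words[OF assms(1)] word_eq_words[OF assms(2)] word_eq.word_trans by blast

lemma word_rel_class_eq:
  "word_eq S R u v \<Longrightarrow> word_rel S R `` {u} = word_rel S R `` {v}"
  by (rule equiv_class_eq[OF equiv_word_rel]) (simp add: word_rel_def)

lemma presented_group_mult:
  assumes "u \<in> signed_words S" and "v \<in> signed_words S"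
  shows "(word_rel S R `` {u}) \<otimes>\<^bsub>presented_group S R\<^esub> (word_rel S R `` {v}) = word_rel S R `` {u @ v}"
proof -
  have "word_rel S R `` {u' @ v'} = word_rel S R `` {u @ v}"
    if "u' \<in> word_rel S R `` {u}" "v' \<in> word_rel S R `` {v}" for u' v'
    using that by (intro word_rel_class_eq[symmetric] word_eq_append) (auto simp: word_rel_def)
  moreover have "u \<in> word_rel S R `` {u}" "v \<in> word_rel S R `` {v}"
    using assms by (auto simp: word_rel_def intro: word_eq.word_refl)
  ultimately have "(\<Union>u'\<in>word_rel S R `` {u}. \<Union>v'\<in>word_rel S R `` {v}.
      word_rel S R `` {u' @ v'}) = word_rel S R `` {u @ v}"
    by blast
  then show ?thesis
    by (simp add: presented_group_def)
qed

lemma presented_group_carrierE: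
  assumes "P \<in> carrier (presented_group S R)"
  obtains u where "u \<in> signed_words S" and "P = word_rel S R `` {u}"
  using assms by (auto simp: presented_group_def elim: quotientE)

lemma presented_group_carrierI:
  "u \<in> signed_words S \<Longrightarrow> word_rel S R `` {u} \<in> carrier (presented_group S R)"
  by (auto simp: presented_group_def intro: quotientI)

lemma presented_group_one: "\<one>\<^bsub>presented_group S R\<^esub> = word_rel S R `` {[]}"
  by (simp add: presented_group_def)

lemma word_left_inverse:
  "u \<in> signed_words S \<Longrightarrow>
    word_eq S R (rev (map (\<lambda>(a, e). (a, \<not> e)) u) @ u) [] \<and>
    rev (map (\<lambda>(a, e). (a, \<not> e)) u) \<in> signed_words S"
proof (induction u)
  case Nil
  then show ?case by (simp add: word_eq.word_refl)
next
  case (Cons x u)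
  obtain a e where x: "x = (a, e)" by (cases x)
  let ?v = "rev (map (\<lambda>(a, e). (a, \<not> e)) u)"
  have "word_eq S R (?v @ [(a, \<not> e), (a, \<not> \<not> e)] @ u) (?v @ u)"
    using Cons by (intro word_eq.cancel) (auto simp: x)
  then show ?case
    using Cons by (auto simp: x intro: word_eq.word_trans)
qed

lemma group_presented_group: "group (presented_group S R)"
proof (rule groupI)
  fix P assume "P \<in> carrier (presented_group S R)"
  then obtain u where u: "u \<in> signed_words S" "P = word_rel S R `` {u}"
    by (rule presented_group_carrierE)
  show "\<one>\<^bsub>presented_group S R\<^esub> \<otimes>\<^bsub>presented_group S R\<^esub> P = P"
    using u by (simp add: presented_group_one presented_group_mult)
  let ?v = "rev (map (\<lambda>(a, e). (a, \<not> e)) u)"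
  show "\<exists>Q\<in>carrier (presented_group S R).
      Q \<otimes>\<^bsub>presented_group S R\<^esub> P = \<one>\<^bsub>presented_group S R\<^esub>"
  proof (rule bexI[of _ "word_rel S R `` {?v}"])
    have v: "word_eq S R (?v @ u) []" "?v \<in> signed_words S"
      using word_left_inverse[OF u(1), of R] by auto
    show "(word_rel S R `` {?v}) \<otimes>\<^bsub>presented_group S R\<^esub> P = \<one>\<^bsub>presented_group S R\<^esub>"
      using word_rel_class_eq[OF v(1)] u v(2)
      by (simp add: presented_group_one presented_group_mult)
    show "word_rel S R `` {?v} \<in> carrier (presented_group S R)"
      using v(2) by (rule presented_group_carrierI)
  qed
qed (auto simp: presented_group_one presented_group_mult
    intro!: presented_group_carrierI elim!: presented_group_carrierE)

lemma group_braid_group: "group (braid_group W S)"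
  unfolding braid_group_def by (rule group_presented_group)

lemma braid_generator_closed:
  "s \<in> S \<Longrightarrow> braid_generator W S s \<in> carrier (braid_group W S)"
  unfolding braid_generator_def braid_group_def by (auto intro: presented_group_carrierI)

text \<open>Convolution may be computed by summing over any finite sets containing the supports.\<close>

lemma group_algebra_mult_superset:
  assumes "finite A" and "{a. f a \<noteq> 0} \<subseteq> A" and "finite B" and "{b. h b \<noteq> 0} \<subseteq> B"
  shows "(f \<otimes>\<^bsub>group_algebra G\<^esub> h) x =
    (\<Sum>a\<in>A. \<Sum>b\<in>B. if a \<otimes>\<^bsub>G\<^esub> b = x then f a * h b else 0)"
proof -
  have "(f \<otimes>\<^bsub>group_algebra G\<^esub> h) x =
      (\<Sum>a\<in>{a. f a \<noteq> 0}. \<Sum>b\<in>B. if a \<otimes>\<^bsub>G\<^esub> b = x then f a * h b else 0)"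
    unfolding group_algebra_def monoid.simps
    by (rule sum.cong[OF refl], rule sum.mono_neutral_left) (use assms in auto)
  also have "\<dots> = (\<Sum>a\<in>A. \<Sum>b\<in>B. if a \<otimes>\<^bsub>G\<^esub> b = x then f a * h b else 0)"
    using assms by (intro sum.mono_neutral_left) (auto intro!: sum.neutral split: if_splits)
  finally show ?thesis .
qed

lemma group_algebra_mult_support:
  "{x. (f \<otimes>\<^bsub>group_algebra G\<^esub> h) x \<noteq> 0} \<subseteq>
    (\<lambda>(a, b). a \<otimes>\<^bsub>G\<^esub> b) ` ({a. f a \<noteq> 0} \<times> {b. h b \<noteq> 0})"
proof
  fix x assume "x \<in> {x. (f \<otimes>\<^bsub>group_algebra G\<^esub> h) x \<noteq> 0}"
  then have "(\<Sum>a\<in>{a. f a \<noteq> 0}. \<Sum>b\<in>{b. h b \<noteq> 0}.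
      if a \<otimes>\<^bsub>G\<^esub> b = x then f a * h b else 0) \<noteq> 0"
    by (simp add: group_algebra_def)
  then obtain a where "a \<in> {a. f a \<noteq> 0}"
    "(\<Sum>b\<in>{b. h b \<noteq> 0}. if a \<otimes>\<^bsub>G\<^esub> b = x then f a * h b else 0) \<noteq> 0"
    by (rule sum.not_neutral_contains_not_neutral)
  moreover from this(2) obtain b where "b \<in> {b. h b \<noteq> 0}"
    "(if a \<otimes>\<^bsub>G\<^esub> b = x then f a * h b else 0) \<noteq> 0"
    by (rule sum.not_neutral_contains_not_neutral)
  ultimately show "x \<in> (\<lambda>(a, b). a \<otimes>\<^bsub>G\<^esub> b) ` ({a. f a \<noteq> 0} \<times> {b. h b \<noteq> 0})"
    by (auto simp: image_iff split: if_splits)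
qed

lemma group_algebra_carrier:
  "f \<in> carrier (group_algebra G) \<longleftrightarrow> finite {g. f g \<noteq> 0} \<and> {g. f g \<noteq> 0} \<subseteq> carrier G"
  by (simp add: group_algebra_def)

lemma group_algebra_ops:
  "\<one>\<^bsub>group_algebra G\<^esub> = algebra_single \<one>\<^bsub>G\<^esub> 1"
  "\<zero>\<^bsub>group_algebra G\<^esub> = (\<lambda>x. 0)"
  "f \<oplus>\<^bsub>group_algebra G\<^esub> h = (\<lambda>x. f x + h x)"
  by (simp_all add: group_algebra_def)

lemma algebra_single_closed:
  "g \<in> carrier G \<Longrightarrow> algebra_single g c \<in> carrier (group_algebra G)"
  unfolding group_algebra_carrier algebra_single_def
  by (auto intro: finite_subset[of _ "{g}"])

lemma algebra_single_mult:
  "algebra_single g c \<otimes>\<^bsub>group_algebra G\<^esub> algebra_single h d = algebra_single (g \<otimes>\<^bsub>G\<^esub> h) (c * d)"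
proof
  fix x
  have "(algebra_single g c \<otimes>\<^bsub>group_algebra G\<^esub> algebra_single h d) x =
    (\<Sum>a\<in>{g}. \<Sum>b\<in>{h}. if a \<otimes>\<^bsub>G\<^esub> b = x then algebra_single g c a * algebra_single h d b else 0)"
    by (rule group_algebra_mult_superset) (auto simp: algebra_single_def)
  then show "(algebra_single g c \<otimes>\<^bsub>group_algebra G\<^esub> algebra_single h d) x =
      algebra_single (g \<otimes>\<^bsub>G\<^esub> h) (c * d) x"
    by (auto simp: algebra_single_def)
qed

lemma group_algebra_mult_closed:
  assumes "group G" and "f \<in> carrier (group_algebra G)" and "h \<in> carrier (group_algebra G)"
  shows "f \<otimes>\<^bsub>group_algebra G\<^esub> h \<in> carrier (group_algebra G)"
proof -
  interpret group G by fact
  let ?P = "(\<lambda>(a, b). a \<otimes>\<^bsub>G\<^esub> b) ` ({a. f a \<noteq> 0} \<times> {b. h b \<noteq> 0})"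
  have "finite ?P" "?P \<subseteq> carrier G"
    using assms(2,3) by (auto simp: group_algebra_carrier)
  with group_algebra_mult_support[of G f h] show ?thesis
    unfolding group_algebra_carrier by (meson finite_subset subset_trans)
qed

lemma group_algebra_mult_assoc:
  assumes "group G" and f: "f \<in> carrier (group_algebra G)" and h: "h \<in> carrier (group_algebra G)"
    and k: "k \<in> carrier (group_algebra G)"
  shows "(f \<otimes>\<^bsub>group_algebra G\<^esub> h) \<otimes>\<^bsub>group_algebra G\<^esub> k =
    f \<otimes>\<^bsub>group_algebra G\<^esub> (h \<otimes>\<^bsub>group_algebra G\<^esub> k)"
proof
  interpret group G by fact
  fix x
  define F H K where "F = {a. f a \<noteq> 0}" and "H = {a. h a \<noteq> 0}" and "K = {a. k a \<noteq> 0}"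
  define P Q where "P = (\<lambda>(a, b). a \<otimes>\<^bsub>G\<^esub> b) ` (F \<times> H)" and "Q = (\<lambda>(a, b). a \<otimes>\<^bsub>G\<^esub> b) ` (H \<times> K)"
  have fin: "finite F" "finite H" "finite K" "finite P" "finite Q"
    and sub: "F \<subseteq> carrier G" "H \<subseteq> carrier G" "K \<subseteq> carrier G"
    using f h k by (auto simp: group_algebra_carrier F_def H_def K_def P_def Q_def)
  have fh: "(f \<otimes>\<^bsub>group_algebra G\<^esub> h) y = (\<Sum>a\<in>F. \<Sum>b\<in>H. if a \<otimes>\<^bsub>G\<^esub> b = y then f a * h b else 0)" for y
    using fin by (intro group_algebra_mult_superset) (auto simp: F_def H_def)
  have hk: "(h \<otimes>\<^bsub>group_algebra G\<^esub> k) y = (\<Sum>b\<in>H. \<Sum>c\<in>K. if b \<otimes>\<^bsub>G\<^esub> c = y then h b * k c else 0)" for y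
    using fin by (intro group_algebra_mult_superset) (auto simp: H_def K_def)
  let ?t = "\<lambda>a b c. if a \<otimes>\<^bsub>G\<^esub> b \<otimes>\<^bsub>G\<^esub> c = x then f a * h b * k c else 0"
  have "((f \<otimes>\<^bsub>group_algebra G\<^esub> h) \<otimes>\<^bsub>group_algebra G\<^esub> k) x =
      (\<Sum>p\<in>P. \<Sum>c\<in>K. if p \<otimes>\<^bsub>G\<^esub> c = x then (f \<otimes>\<^bsub>group_algebra G\<^esub> h) p * k c else 0)"
    using fin group_algebra_mult_support[of G f h]
    by (intro group_algebra_mult_superset) (auto simp: P_def F_def H_def K_def)
  also have "\<dots> = (\<Sum>p\<in>P. \<Sum>c\<in>K. \<Sum>a\<in>F. \<Sum>b\<in>H. if a \<otimes>\<^bsub>G\<^esub> b = p then ?t a b c else 0)"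
    by (intro sum.cong refl) (auto simp: fh sum_distrib_right intro!: sum.cong sum.neutral)
  also have "\<dots> = (\<Sum>c\<in>K. \<Sum>a\<in>F. \<Sum>b\<in>H. \<Sum>p\<in>P. if a \<otimes>\<^bsub>G\<^esub> b = p then ?t a b c else 0)"
    by (subst sum.swap, rule sum.cong[OF refl], subst sum.swap, rule sum.cong[OF refl], rule sum.swap)
  also have "\<dots> = (\<Sum>c\<in>K. \<Sum>a\<in>F. \<Sum>b\<in>H. ?t a b c)"
    using fin by (intro sum.cong refl) (auto simp: P_def)
  finally have 1: "((f \<otimes>\<^bsub>group_algebra G\<^esub> h) \<otimes>\<^bsub>group_algebra G\<^esub> k) x =
      (\<Sum>c\<in>K. \<Sum>a\<in>F. \<Sum>b\<in>H. ?t a b c)" .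
  have "(f \<otimes>\<^bsub>group_algebra G\<^esub> (h \<otimes>\<^bsub>group_algebra G\<^esub> k)) x =
      (\<Sum>a\<in>F. \<Sum>p\<in>Q. if a \<otimes>\<^bsub>G\<^esub> p = x then f a * (h \<otimes>\<^bsub>group_algebra G\<^esub> k) p else 0)"
    using fin group_algebra_mult_support[of G h k]
    by (intro group_algebra_mult_superset) (auto simp: Q_def F_def H_def K_def)
  also have "\<dots> = (\<Sum>a\<in>F. \<Sum>p\<in>Q. \<Sum>b\<in>H. \<Sum>c\<in>K. if b \<otimes>\<^bsub>G\<^esub> c = p then ?t a b c else 0)"
    using sub
    by (intro sum.cong refl)
      (auto simp: hk sum_distrib_left m_assoc subset_iff mult.assoc intro!: sum.cong sum.neutral)
  also have "\<dots> = (\<Sum>a\<in>F. \<Sum>b\<in>H. \<Sum>c\<in>K. \<Sum>p\<in>Q. if b \<otimes>\<^bsub>G\<^esub> c = p then ?t a b c else 0)"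
    by (rule sum.cong[OF refl], subst sum.swap, rule sum.cong[OF refl], rule sum.swap)
  also have "\<dots> = (\<Sum>a\<in>F. \<Sum>b\<in>H. \<Sum>c\<in>K. ?t a b c)"
    using fin by (intro sum.cong refl) (auto simp: Q_def)
  also have "\<dots> = (\<Sum>a\<in>F. \<Sum>c\<in>K. \<Sum>b\<in>H. ?t a b c)"
    by (rule sum.cong[OF refl], rule sum.swap)
  also have "\<dots> = (\<Sum>c\<in>K. \<Sum>a\<in>F. \<Sum>b\<in>H. ?t a b c)"
    by (rule sum.swap)
  finally show "((f \<otimes>\<^bsub>group_algebra G\<^esub> h) \<otimes>\<^bsub>group_algebra G\<^esub> k) x =
      (f \<otimes>\<^bsub>group_algebra G\<^esub> (h \<otimes>\<^bsub>group_algebra G\<^esub> k)) x"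
    using 1 by simp
qed

lemma group_algebra_mult_one:
  assumes "group G" and f: "f \<in> carrier (group_algebra G)"
  shows "\<one>\<^bsub>group_algebra G\<^esub> \<otimes>\<^bsub>group_algebra G\<^esub> f = f"
    and "f \<otimes>\<^bsub>group_algebra G\<^esub> \<one>\<^bsub>group_algebra G\<^esub> = f"
proof -
  interpret group G by fact
  define F where "F = {a. f a \<noteq> 0}"
  have fin: "finite F" and sub: "F \<subseteq> carrier G"
    using f by (auto simp: group_algebra_carrier F_def)
  show "\<one>\<^bsub>group_algebra G\<^esub> \<otimes>\<^bsub>group_algebra G\<^esub> f = f"
  proof
    fix x
    have "(\<one>\<^bsub>group_algebra G\<^esub> \<otimes>\<^bsub>group_algebra G\<^esub> f) x =
        (\<Sum>a\<in>{\<one>\<^bsub>G\<^esub>}. \<Sum>b\<in>F. if a \<otimes>\<^bsub>G\<^esub> b = x then algebra_single \<one>\<^bsub>G\<^esub> 1 a * f b else 0)"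
      unfolding group_algebra_ops using fin
      by (intro group_algebra_mult_superset) (auto simp: algebra_single_def F_def)
    also have "\<dots> = (\<Sum>b\<in>F. if b = x then f b else 0)"
      using sub by (auto simp: algebra_single_def subset_iff intro!: sum.cong)
    also have "\<dots> = f x"
      using fin by (auto simp: F_def)
    finally show "(\<one>\<^bsub>group_algebra G\<^esub> \<otimes>\<^bsub>group_algebra G\<^esub> f) x = f x" .
  qed
  show "f \<otimes>\<^bsub>group_algebra G\<^esub> \<one>\<^bsub>group_algebra G\<^esub> = f"
  proof
    fix x
    have "(f \<otimes>\<^bsub>group_algebra G\<^esub> \<one>\<^bsub>group_algebra G\<^esub>) x =
        (\<Sum>a\<in>F. \<Sum>b\<in>{\<one>\<^bsub>G\<^esub>}. if a \<otimes>\<^bsub>G\<^esub> b = x then f a * algebra_single \<one>\<^bsub>G\<^esub> 1 b else 0)"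
      unfolding group_algebra_ops using fin
      by (intro group_algebra_mult_superset) (auto simp: algebra_single_def F_def)
    also have "\<dots> = (\<Sum>b\<in>F. if b = x then f b else 0)"
      using sub by (auto simp: algebra_single_def subset_iff intro!: sum.cong)
    also have "\<dots> = f x"
      using fin by (auto simp: F_def)
    finally show "(f \<otimes>\<^bsub>group_algebra G\<^esub> \<one>\<^bsub>group_algebra G\<^esub>) x = f x" .
  qed
qed

lemma group_algebra_distrib:
  assumes f: "f \<in> carrier (group_algebra G)" and h: "h \<in> carrier (group_algebra G)"
    and k: "k \<in> carrier (group_algebra G)"
  shows "(f \<oplus>\<^bsub>group_algebra G\<^esub> h) \<otimes>\<^bsub>group_algebra G\<^esub> k =
      f \<otimes>\<^bsub>group_algebra G\<^esub> k \<oplus>\<^bsub>group_algebra G\<^esub> h \<otimes>\<^bsub>group_algebra G\<^esub> k"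
    and "k \<otimes>\<^bsub>group_algebra G\<^esub> (f \<oplus>\<^bsub>group_algebra G\<^esub> h) =
      k \<otimes>\<^bsub>group_algebra G\<^esub> f \<oplus>\<^bsub>group_algebra G\<^esub> k \<otimes>\<^bsub>group_algebra G\<^esub> h"
proof -
  define F K where "F = {a. f a \<noteq> 0} \<union> {a. h a \<noteq> 0}" and "K = {a. k a \<noteq> 0}"
  have fin: "finite F" "finite K"
    using f h k by (auto simp: group_algebra_carrier F_def K_def)
  have sub: "{a. f a \<noteq> 0} \<subseteq> F" "{a. h a \<noteq> 0} \<subseteq> F" "{a. k a \<noteq> 0} \<subseteq> K"
    "{a. (f \<oplus>\<^bsub>group_algebra G\<^esub> h) a \<noteq> 0} \<subseteq> F"
    by (auto simp: F_def K_def group_algebra_ops)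
  note left = group_algebra_mult_superset[OF fin(1) _ fin(2) sub(3)]
  note right = group_algebra_mult_superset[OF fin(2) sub(3) fin(1)]
  show "(f \<oplus>\<^bsub>group_algebra G\<^esub> h) \<otimes>\<^bsub>group_algebra G\<^esub> k =
      f \<otimes>\<^bsub>group_algebra G\<^esub> k \<oplus>\<^bsub>group_algebra G\<^esub> h \<otimes>\<^bsub>group_algebra G\<^esub> k"
    unfolding group_algebra_ops(3)[of G "f \<otimes>\<^bsub>group_algebra G\<^esub> k"]
    by (rule ext, unfold left[OF sub(4)] left[OF sub(1)] left[OF sub(2)])
      (auto simp: group_algebra_ops sum.distrib[symmetric] distrib_right intro!: sum.cong)
  show "k \<otimes>\<^bsub>group_algebra G\<^esub> (f \<oplus>\<^bsub>group_algebra G\<^esub> h) =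
      k \<otimes>\<^bsub>group_algebra G\<^esub> f \<oplus>\<^bsub>group_algebra G\<^esub> k \<otimes>\<^bsub>group_algebra G\<^esub> h"
    unfolding group_algebra_ops(3)[of G "k \<otimes>\<^bsub>group_algebra G\<^esub> f"]
    by (rule ext, unfold right[OF sub(4)] right[OF sub(1)] right[OF sub(2)])
      (auto simp: group_algebra_ops sum.distrib[symmetric] distrib_left intro!: sum.cong)
qed

lemma ring_group_algebra:
  assumes "group G"
  shows "ring (group_algebra G)"
proof (rule ringI)
  show "abelian_group (group_algebra G)"
  proof (rule abelian_groupI)
    fix f h assume "f \<in> carrier (group_algebra G)" "h \<in> carrier (group_algebra G)"
    then have supp: "finite ({g. f g \<noteq> 0} \<union> {g. h g \<noteq> 0})"
        "{g. f g \<noteq> 0} \<union> {g. h g \<noteq> 0} \<subseteq> carrier G"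
      by (auto simp: group_algebra_carrier)
    have "{g. f g + h g \<noteq> 0} \<subseteq> {g. f g \<noteq> 0} \<union> {g. h g \<noteq> 0}"
      by auto
    with supp show "f \<oplus>\<^bsub>group_algebra G\<^esub> h \<in> carrier (group_algebra G)"
      unfolding group_algebra_carrier group_algebra_ops by (meson finite_subset subset_trans)
  next
    fix f assume "f \<in> carrier (group_algebra G)"
    then show "\<exists>h\<in>carrier (group_algebra G). h \<oplus>\<^bsub>group_algebra G\<^esub> f = \<zero>\<^bsub>group_algebra G\<^esub>"
      by (intro bexI[of _ "\<lambda>x. - f x"]) (auto simp: group_algebra_carrier group_algebra_ops)
  qed (auto simp: group_algebra_carrier group_algebra_ops algebra_simps)
  show "monoid (group_algebra G)"
  proof (rule monoidI)
    show "\<one>\<^bsub>group_algebra G\<^esub> \<in> carrier (group_algebra G)"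
      unfolding group_algebra_ops
      by (intro algebra_single_closed monoid.one_closed group.is_monoid assms)
  qed (simp_all add: assms group_algebra_mult_closed group_algebra_mult_assoc group_algebra_mult_one)
qed (auto simp: group_algebra_distrib)

lemma ideal_hecke_ideal: "ideal (hecke_ideal W S q) (group_algebra (braid_group W S))"
proof -
  interpret B: group "braid_group W S" by (rule group_braid_group)
  interpret A: ring "group_algebra (braid_group W S)"
    by (rule ring_group_algebra) (rule group_braid_group)
  show ?thesis
    unfolding hecke_ideal_def Let_def
    by (rule A.genideal_ideal)
      (auto intro!: A.m_closed A.minus_closed A.a_closed algebra_single_closed
        braid_generator_closed)
qed

text \<open>A representation of the Hecke algebra is a representation of the braid group.\<close>

lemma group_representation_braid_action:
  assumes "hecke_representation W S q scale \<pi>"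
  shows "group_representation (braid_group W S) scale (braid_action W S q \<pi>)"
proof -
  let ?B = "braid_group W S" and ?A = "group_algebra (braid_group W S)"
  interpret B: group ?B by (rule group_braid_group)
  interpret A: ring ?A by (rule ring_group_algebra) (rule group_braid_group)
  interpret I: ideal "hecke_ideal W S q" ?A by (rule ideal_hecke_ideal)
  have vs: "vector_space scale"
    and hom: "\<pi> \<in> ring_hom (hecke_algebra W S q) (linear_endomorphisms scale)"
    using assms by (auto simp: hecke_representation_def)
  have cls: "hecke_class W S q f \<in> carrier (hecke_algebra W S q)" if "f \<in> carrier ?A" for f
    using that unfolding hecke_class_def hecke_algebra_def FactRing_def
    by (auto simp: A_RCOSETS_def' a_r_coset_def')
  have cls_mult: "hecke_class W S q f \<otimes>\<^bsub>hecke_algebra W S q\<^esub> hecke_class W S q h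
      = hecke_class W S q (f \<otimes>\<^bsub>?A\<^esub> h)" if "f \<in> carrier ?A" "h \<in> carrier ?A" for f h
    using I.rcoset_mult_add[OF that] unfolding hecke_class_def hecke_algebra_def FactRing_def
    by simp
  have one: "braid_action W S q \<pi> \<one>\<^bsub>?B\<^esub> = id"
  proof -
    have "hecke_class W S q (algebra_single \<one>\<^bsub>?B\<^esub> 1) = \<one>\<^bsub>hecke_algebra W S q\<^esub>"
      by (simp add: hecke_class_def hecke_algebra_def FactRing_def group_algebra_ops)
    then show ?thesis
      using ring_hom_one[OF hom] by (simp add: braid_action_def linear_endomorphisms_def fun_eq_iff)
  qed
  have mult: "braid_action W S q \<pi> (a \<otimes>\<^bsub>?B\<^esub> b) = braid_action W S q \<pi> a \<circ> braid_action W S q \<pi> b"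
    if "a \<in> carrier ?B" "b \<in> carrier ?B" for a b
  proof -
    have "hecke_class W S q (algebra_single (a \<otimes>\<^bsub>?B\<^esub> b) 1) =
        hecke_class W S q (algebra_single a 1) \<otimes>\<^bsub>hecke_algebra W S q\<^esub> hecke_class W S q (algebra_single b 1)"
      using that by (simp add: cls_mult algebra_single_closed algebra_single_mult)
    then show ?thesis
      using ring_hom_mult[OF hom cls cls] that
      by (simp add: braid_action_def linear_endomorphisms_def algebra_single_closed fun_eq_iff)
  qed
  have lin: "Vector_Spaces.linear scale scale (braid_action W S q \<pi> b)" if "b \<in> carrier ?B" for b
    using ring_hom_closed[OF hom cls[OF algebra_single_closed[OF that]]]
    by (simp add: braid_action_def linear_endomorphisms_def)
  have "bij (braid_action W S q \<pi> b)" if "b \<in> carrier ?B" for b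
    using mult[of b "inv\<^bsub>?B\<^esub> b"] mult[of "inv\<^bsub>?B\<^esub> b" b] that one
    by (intro o_bij[of "braid_action W S q \<pi> (inv\<^bsub>?B\<^esub> b)"]) auto
  with lin mult vs show ?thesis
    unfolding group_representation_def general_linear_group_def by (auto intro!: homI)
qed

end

theory Submission
  imports Defs "Jordan_Normal_Form.Char_Poly"
begin

text \<open>
  Write \<open>T w\<close> for the operator by which \<open>\<tau>(w)\<close> acts on \<open>V\<close>, and let \<open>w\<close> act on families by the
  twisted shift \<open>(act w x) w' = T w (x (w\<inverse> w'))\<close>. The sum of the subspaces \<open>i\<^sub>y(V)\<close> is then the
  image of the single operator \<open>A\<^sub>S\<close>, where \<open>A\<^sub>J\<close> is the sum of \<open>act u\<close> over the parabolic subgroup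
  \<open>W\<^sub>J\<close> (the constant \<open>symmetrizer\<close>). Let \<open>K\<^sub>J\<close> be the space cut out by the conditions for \<open>s \<in> J\<close>
  only. The theorem is the case \<open>J = S\<close> of \<open>K\<^sub>J = im A\<^sub>J\<close>, which is proved by induction on \<open>J\<close>.
  That \<open>im A\<^sub>J\<close> lies in \<open>K\<^sub>J\<close> follows by pairing \<open>u\<close> with \<open>s u\<close>.

  For the converse, each \<open>I \<subseteq> J\<close> gives a factorization \<open>A\<^sub>J = A\<^sub>J\<^sup>I A\<^sub>I\<close>, where \<open>A\<^sub>J\<^sup>I\<close> sums over
  the shortest representatives of the cosets of \<open>W\<^sub>I\<close>. The alternating sum of the \<open>A\<^sub>J\<^sup>I\<close> over all
  \<open>I\<close> collapses to \<open>act w\<^sub>J\<close>, with \<open>w\<^sub>J\<close> the longest element of \<open>W\<^sub>J\<close>, because only \<open>w\<^sub>J\<close> has every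
  element of \<open>J\<close> as a descent. An \<open>x \<in> K\<^sub>J\<close> lies in every \<open>K\<^sub>I\<close>, so \<open>x = A\<^sub>I z\<^sub>I\<close> for proper subsets
  \<open>I\<close> by induction, and \<open>A\<^sub>J\<^sup>I x = A\<^sub>J z\<^sub>I\<close>. Hence \<open>act w\<^sub>J x\<close> equals \<open>\<plusminus>x\<close> modulo \<open>im A\<^sub>J\<close>. Applying
  this twice shows that \<open>(\<pi> - 1) x \<in> im A\<^sub>J\<close>, where \<open>\<pi> = T(w\<^sub>J)\<^sup>2\<close> is the full twist, which commutes
  with \<open>T s\<close> for all \<open>s \<in> J\<close>.

  It remains to treat the part of \<open>V\<close> on which \<open>\<pi> - 1\<close> is not invertible, and here the assumption
  on \<open>q\<close> enters. If \<open>(\<pi> - 1)\<^sup>2 v = 0\<close>, then on the finite-dimensional module generated by \<open>v\<close> the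
  determinant of \<open>\<pi>\<close> is \<open>1\<close>; but it is also a power of \<open>q\<close> whose exponent counts the eigenvalues
  \<open>q\<close> of the factors \<open>T s\<close>. As \<open>q\<close> is not a root of unity, no \<open>T s\<close> has the eigenvalue \<open>q\<close>, so
  every \<open>T s\<close> acts as \<open>-1\<close> (\<open>unipotent_twist_minus_one\<close>). Since \<open>\<pi>\<close> satisfies a polynomial
  equation, every \<open>x \<in> K\<^sub>J\<close> is thus the sum of \<open>(\<pi> - 1) x'\<close> with \<open>x' \<in> K\<^sub>J\<close> and of a family in
  \<open>K\<^sub>J\<close> on whose values all \<open>T s\<close> act as \<open>-1\<close>. The first summand is in \<open>im A\<^sub>J\<close> by the previous
  paragraph, and the second is in \<open>im A\<^sub>J\<close> because \<open>A\<^sub>J\<close> multiplies it by \<open>|W\<^sub>J|\<close>.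

  All this needs the combinatorics of a Coxeter group given by its presentation: the exchange
  property, shortest coset representatives, Matsumoto's theorem (so that \<open>T\<close> is multiplicative
  when lengths add) and longest elements of parabolic subgroups. They are derived from the parity
  of the number of times a word crosses the wall of a reflection.
\<close>

section \<open>Determinants and kernels of endomorphisms\<close>

text \<open>For every \<open>k\<close>, the product of \<open>A - k\<close> and \<open>A - (a + b - k)\<close> is the scalar
  \<open>-(k - a) (k - b)\<close>, so the eigenvalues are among \<open>a\<close> and \<open>b\<close>, and \<open>i\<close> is the multiplicity of
  \<open>a\<close> in the characteristic polynomial. If it vanishes then \<open>A - a\<close> is invertible and can be
  cancelled from \<open>(A - a) (A - b) = 0\<close>.\<close>

lemma det_two_eigenvalues:
  fixes A :: "complex mat"
  assumes A: "A \<in> carrier_mat n n" and quad: "A * A = (a + b) \<cdot>\<^sub>m A - (a * b) \<cdot>\<^sub>m 1\<^sub>m n"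
  shows "\<exists>i j. det A = a ^ i * b ^ j \<and> (i = 0 \<longrightarrow> A = b \<cdot>\<^sub>m 1\<^sub>m n)"
proof -
  \<comment> \<open>\<open>char_matrix A k\<close> is \<open>A - k\<close>.\<close>
  have prod: "char_matrix A k * char_matrix A (a + b - k) = (- ((k - a) * (k - b))) \<cdot>\<^sub>m 1\<^sub>m n" for k
  proof -
    have "char_matrix A k * char_matrix A (a + b - k) =
        A * A + (- (a + b - k)) \<cdot>\<^sub>m A + ((- k) \<cdot>\<^sub>m A + (k * (a + b - k)) \<cdot>\<^sub>m 1\<^sub>m n)"
      using A unfolding char_matrix_def
      by (simp add: add_mult_distrib_mat[of _ n n] mult_add_distrib_mat[of _ n n])
         (auto simp: algebra_simps intro!: eq_matI)
    then show ?thesis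
      unfolding quad using A by (intro eq_matI) (auto simp: algebra_simps)
  qed
  have eig: "k = a \<or> k = b" if "det (char_matrix A k) = 0" for k
  proof -
    have "det (char_matrix A k * char_matrix A (a + b - k)) = 0"
      using that A by (simp add: det_mult[of _ n])
    then show ?thesis unfolding prod by auto
  qed
  obtain es where es: "char_poly A = (\<Prod>e\<leftarrow>es. [:- e, 1:])" "length es = n"
    using char_poly_factorized[OF A] by blast
  have sub: "e \<in> {a, b}" if "e \<in> set es" for e
  proof -
    have "poly (char_poly A) e = 0"
      unfolding es(1) using that by (induction es) auto
    then show ?thesis
      using eig[of e] eigenvalue_det[OF A] eigenvalue_root_char_poly[OF A] by auto
  qed
  have "(- 1) ^ n * det A = poly (char_poly A) 0"
  proof -
    have "- char_matrix A 0 = (- 1) \<cdot>\<^sub>m A" using A by (auto simp: char_matrix_def intro!: eq_matI)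
    then show ?thesis using A by (simp add: char_poly_matrix[OF A])
  qed
  also have "\<dots> = (- 1) ^ length es * prod_list es"
    unfolding es(1) by (induction es) auto
  finally have "det A = prod_list es" using es(2) by simp
  also have "prod_list es = a ^ count_list es a * b ^ (length es - count_list es a)"
    using sub by (induction es) (auto simp: Suc_diff_le count_le_length)
  finally have det: "det A = a ^ count_list es a * b ^ (length es - count_list es a)" .
  have "A = b \<cdot>\<^sub>m 1\<^sub>m n" if "count_list es a = 0"
  proof -
    have "poly (char_poly A) a \<noteq> 0"
      unfolding es(1) using that by (induction es) (auto split: if_splits)
    then have "det (char_matrix A a) \<noteq> 0"
      using eigenvalue_det[OF A] eigenvalue_root_char_poly[OF A] by auto
    then have "char_matrix A a \<in> Units (ring_mat TYPE(complex) n ())"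
      using A by (intro det_non_zero_imp_unit) auto
    then obtain X where X: "X \<in> carrier_mat n n" "X * char_matrix A a = 1\<^sub>m n"
      by (auto simp: Units_def ring_mat_def)
    have "char_matrix A b = (X * char_matrix A a) * char_matrix A b"
      using X(2) left_mult_one_mat[OF char_matrix_closed[OF A]] by simp
    also have "\<dots> = X * (char_matrix A a * char_matrix A (a + b - a))"
      using X A by (subst assoc_mult_mat[of _ n n _ n _ n]) auto
    also have "\<dots> = 0\<^sub>m n n" unfolding prod using X by (auto intro!: eq_matI)
    finally have 0: "char_matrix A b = 0\<^sub>m n n" .
    show ?thesis
    proof (rule eq_matI)
      fix i j assume "i < dim_row (b \<cdot>\<^sub>m 1\<^sub>m n)" "j < dim_col (b \<cdot>\<^sub>m 1\<^sub>m n :: complex mat)"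
      then show "A $$ (i, j) = (b \<cdot>\<^sub>m 1\<^sub>m n) $$ (i, j)"
        using arg_cong[OF 0, of "\<lambda>M. M $$ (i, j)"] A by (auto simp: char_matrix_def split: if_splits)
    qed (use A in auto)
  qed
  with det show ?thesis
    by (intro exI[of _ "count_list es a"] exI[of _ "length es - count_list es a"] conjI impI)
qed

definition stable_endo :: "('k :: field \<Rightarrow> 'v \<Rightarrow> 'v) \<Rightarrow> 'v set \<Rightarrow> ('v :: ab_group_add \<Rightarrow> 'v) \<Rightarrow> bool"
  where "stable_endo scale E f \<longleftrightarrow> Vector_Spaces.linear scale scale f \<and> f ` E \<subseteq> E"

text \<open>A determinant for the endomorphisms of a finite-dimensional subspace \<open>E\<close> of a space that may
  be infinite-dimensional: it is read off from matrices with respect to a basis of \<open>E\<close>. Only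
  multiplicativity and the value on an endomorphism with a quadratic equation are recorded, so that
  no matrices occur later.\<close>

lemma restricted_determinant:
  fixes scale :: "complex \<Rightarrow> 'v \<Rightarrow> 'v :: ab_group_add"
  assumes "vector_space scale" and A: "finite A" and E: "E = module.span scale A"
  obtains \<delta> where "\<delta> id = 1"
    "\<And>f g. stable_endo scale E f \<Longrightarrow> stable_endo scale E g \<Longrightarrow> \<delta> (f \<circ> g) = \<delta> f * \<delta> g"
    "\<And>f a b. stable_endo scale E f \<Longrightarrow>
      (\<And>v. v \<in> E \<Longrightarrow> f (f v) = scale (a + b) (f v) - scale (a * b) v) \<Longrightarrow>
      \<exists>i j. \<delta> f = a ^ i * b ^ j \<and> (i = 0 \<longrightarrow> (\<forall>v\<in>E. f v = scale b v))"
proof -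
  interpret vector_space scale by fact
  obtain B where B: "B \<subseteq> A" "independent B" "A \<subseteq> span B"
    using maximal_independent_subset by blast
  have E: "E = span B"
    unfolding E using B(1,3) by (simp add: span_eq span_superset subset_trans[OF B(1)])
  have fB: "finite B" using A B finite_subset by blast
  define n where "n = card B"
  obtain b where b: "bij_betw b {..<n} B"
    using ex_bij_betw_nat_finite[OF fB] by (auto simp: n_def atLeast0LessThan)
  have bB: "b i \<in> B" if "i < n" for i using b that by (auto simp: bij_betw_def)
  define R where "R = representation B"
  define M where "M f = mat n n (\<lambda>(i, j). R (f (b j)) (b i))" for f
  have [simp]: "M f \<in> carrier_mat n n" for f by (simp add: M_def)
  have expand: "(\<Sum>j<n. scale (R v (b j)) (b j)) = v" if "v \<in> E" for v
    using sum_representation_eq[OF B(2), of v B] that fB E sum.reindex_bij_betw[OF b, of "\<lambda>x. scale (R v x) x"]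
    by (simp add: R_def)
  have stable_E: "f (b j) \<in> E" if "stable_endo scale E f" "j < n" for f j
    using that bB[OF that(2)] span_base[of "b j" B] by (auto simp: stable_endo_def E)
  have coord: "R (f v) (b i) = (\<Sum>j<n. R (f (b j)) (b i) * R v (b j))"
    if f: "stable_endo scale E f" and v: "v \<in> E" for f v i
  proof -
    have lin: "module_hom scale scale f" using f by (simp add: stable_endo_def module_hom_iff_linear)
    have "f v = (\<Sum>j<n. scale (R v (b j)) (f (b j)))"
      by (subst expand[OF v, symmetric]) (simp add: module_hom.sum[OF lin] module_hom.scale[OF lin])
    then have "R (f v) = (\<lambda>x. \<Sum>j<n. R (scale (R v (b j)) (f (b j))) x)"
      unfolding R_def using stable_E[OF f]
      by (simp only:) (intro representation_sum[OF B(2)] span_scale, simp add: E)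
    then show ?thesis
      using stable_E[OF f] representation_scale[OF B(2)] by (simp add: E R_def mult.commute)
  qed
  have mult: "M (f \<circ> g) = M f * M g" if "stable_endo scale E f" "stable_endo scale E g" for f g
    using that stable_E[OF that(2)]
    by (intro eq_matI) (auto simp: M_def scalar_prod_def coord atLeast0LessThan)
  have one: "M id = 1\<^sub>m n"
  proof (rule eq_matI)
    fix i j assume "i < dim_row (1\<^sub>m n :: complex mat)" "j < dim_col (1\<^sub>m n :: complex mat)"
    then have "i < n" "j < n" by auto
    then have "(b i = b j) = (i = j)" using b by (auto simp: bij_betw_def inj_on_def)
    then show "M id $$ (i, j) = 1\<^sub>m n $$ (i, j)"
      using \<open>i < n\<close> \<open>j < n\<close> representation_basis[OF B(2) bB[of j]] by (simp add: M_def R_def)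
  qed (simp_all add: M_def)
  have quad: "M f * M f = (x + y) \<cdot>\<^sub>m M f - (x * y) \<cdot>\<^sub>m 1\<^sub>m n"
    if f: "stable_endo scale E f" and q: "\<And>v. v \<in> E \<Longrightarrow> f (f v) = scale (x + y) (f v) - scale (x * y) v" for f x y
  proof -
    have "M (f \<circ> f) = (x + y) \<cdot>\<^sub>m M f - (x * y) \<cdot>\<^sub>m M id"
    proof (rule eq_matI)
      fix i j
      assume "i < dim_row ((x + y) \<cdot>\<^sub>m M f - (x * y) \<cdot>\<^sub>m M id)" "j < dim_col ((x + y) \<cdot>\<^sub>m M f - (x * y) \<cdot>\<^sub>m M id)"
      then have ij: "i < n" "j < n" by (auto simp: M_def)
      have "b j \<in> E" "f (b j) \<in> E" using ij bB stable_E[OF f] E span_base by auto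
      then show "M (f \<circ> f) $$ (i, j) = ((x + y) \<cdot>\<^sub>m M f - (x * y) \<cdot>\<^sub>m M id) $$ (i, j)"
        using ij q representation_diff[OF B(2)] representation_scale[OF B(2)] span_scale
        by (simp add: M_def R_def E)
    qed (simp_all add: M_def)
    then show ?thesis using mult[OF f f] one by simp
  qed
  have scalar: "f v = scale y v" if f: "stable_endo scale E f" and M: "M f = y \<cdot>\<^sub>m 1\<^sub>m n" and v: "v \<in> E" for f y v
  proof -
    have "R (f v) (b i) = R (scale y v) (b i)" if "i < n" for i
    proof -
      have "R (f (b j)) (b i) = (if i = j then y else 0)" if "j < n" for j
        using arg_cong[OF M, of "\<lambda>N. N $$ (i, j)"] \<open>i < n\<close> that by (auto simp: M_def)
      then have "R (f v) (b i) = (\<Sum>j<n. (if i = j then y else 0) * R v (b j))"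
        by (simp add: coord[OF f v])
      also have "\<dots> = (\<Sum>j<n. if i = j then y * R v (b j) else 0)"
        by (rule sum.cong) auto
      also have "\<dots> = y * R v (b i)" using that by simp
      finally show ?thesis using representation_scale[OF B(2)] v by (simp add: E R_def)
    qed
    then have "(\<Sum>j<n. scale (R (f v) (b j)) (b j)) = (\<Sum>j<n. scale (R (scale y v) (b j)) (b j))"
      by simp
    moreover have "f v \<in> E" using f v by (auto simp: stable_endo_def)
    moreover have "scale y v \<in> E" using v span_scale by (simp add: E)
    ultimately show ?thesis using expand by simp
  qed
  show ?thesis
  proof (rule that[of "\<lambda>f. det (M f)"])
    show "det (M id) = 1" by (simp add: one)
    show "det (M (f \<circ> g)) = det (M f) * det (M g)"
      if "stable_endo scale E f" "stable_endo scale E g" for f g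
      by (simp add: mult[OF that] det_mult[of _ n])
    show "\<exists>i j. det (M f) = x ^ i * y ^ j \<and> (i = 0 \<longrightarrow> (\<forall>v\<in>E. f v = scale y v))"
      if "stable_endo scale E f" "\<And>v. v \<in> E \<Longrightarrow> f (f v) = scale (x + y) (f v) - scale (x * y) v" for f x y
      using det_two_eigenvalues[OF _ quad[OF that]] scalar[OF that(1)] by fastforce
  qed
qed

lemma vector_space_fun:
  assumes "vector_space scale"
  shows "vector_space (\<lambda>c (x :: 'b \<Rightarrow> 'v :: ab_group_add) w. scale c (x w))"
proof -
  interpret vector_space scale by fact
  show ?thesis
    by unfold_locales (auto simp: fun_eq_iff scale_right_distrib scale_left_distrib)
qed

text \<open>Either two members of the sequence agree, or \<open>g\<close> takes more values on \<open>{..card A}\<close> than an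
  independent subset of the span of \<open>A\<close> can have.\<close>

lemma linear_relation:
  fixes g :: "nat \<Rightarrow> 'v :: ab_group_add"
  assumes "vector_space scale" and A: "finite A" and g: "\<And>i. g i \<in> module.span scale A"
  shows "\<exists>n c. (\<exists>i\<le>n. c i \<noteq> 0) \<and> (\<Sum>i\<le>n. scale (c i) (g i)) = 0"
proof -
  interpret vector_space scale by fact
  define n where "n = card A"
  show ?thesis
  proof (cases "inj_on g {..n}")
    case True
    then have "card (g ` {..n}) = Suc n" by (simp add: card_image)
    then have "dependent (g ` {..n})"
      using independent_span_bound[OF A, of "g ` {..n}"] g by (fastforce simp: n_def)
    then obtain u where u: "\<exists>v\<in>g ` {..n}. u v \<noteq> 0" "(\<Sum>v\<in>g ` {..n}. scale (u v) v) = 0"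
      using dependent_finite[of "g ` {..n}"] by auto
    then show ?thesis
      using sum.reindex[OF True, of "\<lambda>v. scale (u v) v"] by (intro exI[of _ n] exI[of _ "\<lambda>i. u (g i)"]) auto
  next
    case False
    then obtain i j where ij: "i \<le> n" "j \<le> n" "i \<noteq> j" "g i = g j" by (auto simp: inj_on_def)
    define c :: "nat \<Rightarrow> 'a" where "c k = (if k = i then 1 else if k = j then - 1 else 0)" for k
    have "(\<Sum>k\<le>n. scale (c k) (g k)) = (\<Sum>k\<in>{i, j}. scale (c k) (g k))"
      using ij by (intro sum.mono_neutral_right) (auto simp: c_def)
    also have "\<dots> = 0" using ij by (simp add: c_def)
    finally show ?thesis using ij by (intro exI[of _ n] exI[of _ c]) (auto simp: c_def)
  qed
qed

text \<open>A form of Fitting's decomposition that is explicit enough to be applied to families: the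
  component of \<open>v\<close> in the image of \<open>f\<close> is \<open>f\<close> of a fixed polynomial in \<open>f\<close> applied to \<open>v\<close>. To
  obtain it, factor out of the relation the largest possible power of \<open>f\<close>, replace that power by
  \<open>f\<close> itself by means of \<open>ker\<close>, and divide by the lowest remaining coefficient.\<close>

lemma kernel_splitting:
  fixes scale :: "'k :: field \<Rightarrow> 'v \<Rightarrow> 'v :: ab_group_add"
  assumes f: "Vector_Spaces.linear scale scale f"
    and rel: "\<And>v. (\<Sum>i\<le>n. scale (c i) ((f ^^ i) v)) = 0" and "k \<le> n" "c k \<noteq> 0"
    and ker: "\<And>v. f (f v) = 0 \<Longrightarrow> f v = 0"
  shows "\<exists>m d. \<forall>v. f (v - f (\<Sum>i<m. scale (d i) ((f ^^ i) v))) = 0"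
proof -
  interpret Vector_Spaces.linear scale scale f by fact
  \<comment> \<open>\<open>f ^^ m\<close> is the power that can be factored out.\<close>
  define m where "m = (LEAST k. c k \<noteq> 0)"
  have m: "c m \<noteq> 0" "m \<le> n" "\<And>i. i < m \<Longrightarrow> c i = 0"
    using assms(3,4) LeastI[of "\<lambda>k. c k \<noteq> 0" k] Least_le[of "\<lambda>k. c k \<noteq> 0" k] not_less_Least
    unfolding m_def by fastforce+
  have pow_sum: "(f ^^ m) (\<Sum>i\<in>I. scale (a i) (x i)) = (\<Sum>i\<in>I. scale (a i) ((f ^^ m) (x i)))" for m and I :: "nat set" and a x
    by (induction m) (simp_all add: sum scale)
  have pow_ker: "f u = 0" if "(f ^^ m) u = 0" for m u
    using that
  proof (induction m)
    case (Suc m)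
    then show ?case using ker by (cases m) auto
  qed (simp add: zero)
  define d where "d j = - (inverse (c m) * c (Suc (m + j)))" for j
  have "f (v - f (\<Sum>j<n-m. scale (d j) ((f ^^ j) v))) = 0" for v
  proof -
    let ?u = "\<Sum>j\<le>n-m. scale (c (m + j)) ((f ^^ j) v)"
    have "(f ^^ m) ?u = (\<Sum>j\<le>n-m. scale (c (m + j)) ((f ^^ (m + j)) v))"
      by (simp add: pow_sum funpow_add)
    also have "\<dots> = (\<Sum>i=m..n. scale (c i) ((f ^^ i) v))"
      using m(2) sum.shift_bounds_cl_nat_ivl[of "\<lambda>i. scale (c i) ((f ^^ i) v)" 0 m "n - m"]
      by (simp add: atLeast0AtMost add.commute)
    also have "\<dots> = (\<Sum>i\<le>n. scale (c i) ((f ^^ i) v))"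
      using m(3) by (intro sum.mono_neutral_left) auto
    finally have "f ?u = 0" using rel pow_ker by simp
    moreover have "scale (inverse (c m)) ?u = v - f (\<Sum>j<n-m. scale (d j) ((f ^^ j) v))"
    proof -
      have "?u = scale (c m) v + (\<Sum>j<n-m. scale (c (Suc (m + j))) (f ((f ^^ j) v)))"
        unfolding lessThan_Suc_atMost[symmetric] sum.lessThan_Suc_shift by simp
      moreover have "f (\<Sum>j<n-m. scale (d j) ((f ^^ j) v)) = - (\<Sum>j<n-m. scale (- d j) (f ((f ^^ j) v)))"
        by (simp add: sum scale sum_negf)
      ultimately show ?thesis
        using m(1) by (simp add: vs1.scale_right_distrib vs1.scale_sum_right d_def)
    qed
    ultimately show ?thesis using scale[of "inverse (c m)" ?u] by simp
  qed
  then show ?thesis by blast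
qed

section \<open>Words and the reflections they cross\<close>

lemma word_prod_simps [simp]:
  "word_prod G [] = \<one>\<^bsub>G\<^esub>" "word_prod G (a # u) = a \<otimes>\<^bsub>G\<^esub> word_prod G u"
  by (simp_all add: word_prod_def)

locale coxeter_group = group W for W :: "('w, 'm) monoid_scheme" (structure) +
  fixes S :: "'w set"
  assumes coxeter_system: "coxeter_system W S"
begin

abbreviation prd :: "'w list \<Rightarrow> 'w" where "prd \<equiv> word_prod W"

lemma generators_closed: "S \<subseteq> carrier W"
  and generator_neq_one: "s \<in> S \<Longrightarrow> s \<noteq> \<one>"
  and generator_square: "s \<in> S \<Longrightarrow> s \<otimes> s = \<one>"
  and presentation: "has_presentation W S (coxeter_relations W S)"
  using coxeter_system by (auto simp: coxeter_system_def)

lemma generator_closed [simp]: "s \<in> S \<Longrightarrow> s \<in> carrier W"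
  using generators_closed by auto

lemma generator_inv: "s \<in> S \<Longrightarrow> inv s = s"
  by (simp add: generator_square inv_equality)

lemma generator_cancel [simp]:
  "s \<in> S \<Longrightarrow> x \<in> carrier W \<Longrightarrow> s \<otimes> (s \<otimes> x) = x"
  by (simp add: generator_square flip: m_assoc)

lemma inv_cancel [simp]:
  "a \<in> carrier W \<Longrightarrow> x \<in> carrier W \<Longrightarrow> inv a \<otimes> (a \<otimes> x) = x"
  "a \<in> carrier W \<Longrightarrow> x \<in> carrier W \<Longrightarrow> a \<otimes> (inv a \<otimes> x) = x"
  by (simp_all flip: m_assoc)

lemma mult_generator_eq_one [simp]:
  "s \<in> S \<Longrightarrow> x \<in> carrier W \<Longrightarrow> x \<otimes> s = \<one> \<longleftrightarrow> x = s"
  using inv_equality[of x s] generator_inv generator_square by auto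

lemma prd_closed [simp]: "u \<in> lists S \<Longrightarrow> prd u \<in> carrier W"
  by (induction u) auto

lemma prd_append: "u \<in> lists S \<Longrightarrow> v \<in> lists S \<Longrightarrow> prd (u @ v) = prd u \<otimes> prd v"
  by (induction u) (auto simp: m_assoc)

lemma rev_words [simp]: "u \<in> lists A \<Longrightarrow> rev u \<in> lists A"
  by (simp add: in_lists_conv_set)

lemma prd_rev: "u \<in> lists S \<Longrightarrow> prd (rev u) = inv (prd u)"
proof (induction u)
  case (Cons a u)
  then show ?case
    using prd_append[of "rev u" "[a]"] by (simp add: inv_mult_group generator_inv)
qed simp

lemma signed_prod_eq: "u \<in> signed_words S \<Longrightarrow> signed_prod W u = prd (map fst u)"
proof -
  assume "u \<in> signed_words S"
  then have "map (\<lambda>(a, e). if e then a else inv a) u = map fst u"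
    by (auto simp: signed_words_def generator_inv)
  then show ?thesis unfolding signed_prod_def by (rule arg_cong)
qed

lemma map_fst_words: "u \<in> signed_words S \<Longrightarrow> map fst u \<in> lists S"
  by (fastforce simp: signed_words_def in_lists_conv_set)

lemma positive_word_words [simp]: "positive_word u \<in> signed_words S \<longleftrightarrow> u \<in> lists S"
  by (auto simp: signed_words_def positive_word_def)

lemma map_fst_positive_word [simp]: "map fst (positive_word u) = u"
  by (simp add: positive_word_def comp_def)

lemma words_generate: "w \<in> carrier W \<Longrightarrow> \<exists>u\<in>lists S. prd u = w"
  using presentation signed_prod_eq map_fst_words unfolding has_presentation_def
  by (metis imageE)

lemma prd_eq_word_eq:
  "u \<in> lists S \<Longrightarrow> v \<in> lists S \<Longrightarrow> prd u = prd v \<Longrightarrow>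
    word_eq S (coxeter_relations W S) (positive_word u) (positive_word v)"
  using presentation signed_prod_eq unfolding has_presentation_def
  by (metis map_fst_positive_word positive_word_words)

text \<open>The word \<open>s\<^sub>1 \<dots> s\<^sub>n\<close> crosses the walls of the reflections
  \<open>s\<^sub>1 \<dots> s\<^sub>i\<^sub>-\<^sub>1 s\<^sub>i s\<^sub>i\<^sub>-\<^sub>1 \<dots> s\<^sub>1\<close>. The parity of the number of crossings of \<open>t\<close> turns out to depend
  only on the product of the word, and it decides whether \<open>t\<close> shortens that product.\<close>

primrec odd_crossing :: "'w list \<Rightarrow> 'w \<Rightarrow> bool" where
  "odd_crossing [] t = False"
| "odd_crossing (s # u) t = ((t = s) \<noteq> odd_crossing u (s \<otimes> t \<otimes> s))"

lemma odd_crossing_append: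
  "u \<in> lists S \<Longrightarrow> v \<in> lists S \<Longrightarrow> t \<in> carrier W \<Longrightarrow>
    odd_crossing (u @ v) t = (odd_crossing u t \<noteq> odd_crossing v (inv (prd u) \<otimes> t \<otimes> prd u))"
  by (induction u arbitrary: t) (auto simp: inv_mult_group generator_inv m_assoc)

text \<open>In the dihedral case the reflection crossed at position \<open>i\<close> is \<open>(s t)\<^sup>i s\<close>.\<close>

lemma odd_crossing_dihedral:
  assumes "s \<in> S" "t \<in> S" "r \<in> carrier W"
  shows "odd_crossing (concat (replicate n [s, t])) r =
    odd (\<Sum>i<2*n. of_bool (r = (s \<otimes> t) [^] i \<otimes> s) :: nat)"
  using assms(3)
proof (induction n arbitrary: r)
  case (Suc n)
  have "(s \<otimes> r \<otimes> s = t) = (r = s \<otimes> t \<otimes> s)"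
    using assms Suc.prems by (auto simp: m_assoc generator_square)
  moreover have "(t \<otimes> (s \<otimes> r \<otimes> s) \<otimes> t = (s \<otimes> t) [^] i \<otimes> s) = (r = (s \<otimes> t) [^] Suc (Suc i) \<otimes> s)"
    for i :: nat
  proof -
    define p where "p = (s \<otimes> t) [^] i"
    have p: "p \<in> carrier W" "(s \<otimes> t) [^] Suc (Suc i) = (s \<otimes> t) \<otimes> p \<otimes> (s \<otimes> t)"
      using assms nat_pow_Suc2[of "s \<otimes> t" i] unfolding p_def by simp_all
    show ?thesis
      unfolding p_def[symmetric] p(2)
    proof
      assume "t \<otimes> (s \<otimes> r \<otimes> s) \<otimes> t = p \<otimes> s"
      then have "s \<otimes> (t \<otimes> (t \<otimes> (s \<otimes> r \<otimes> s) \<otimes> t) \<otimes> t) \<otimes> s = s \<otimes> (t \<otimes> (p \<otimes> s) \<otimes> t) \<otimes> s" by simp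
      then show "r = (s \<otimes> t) \<otimes> p \<otimes> (s \<otimes> t) \<otimes> s"
        using assms p(1) Suc.prems by (simp add: m_assoc generator_square)
    next
      assume "r = (s \<otimes> t) \<otimes> p \<otimes> (s \<otimes> t) \<otimes> s"
      then show "t \<otimes> (s \<otimes> r \<otimes> s) \<otimes> t = p \<otimes> s"
        using assms p(1) by (simp add: m_assoc generator_square)
    qed
  qed
  moreover have "2 * Suc n = Suc (Suc (2 * n))" by simp
  ultimately show ?case
    using assms Suc.prems Suc.IH[of "t \<otimes> (s \<otimes> r \<otimes> s) \<otimes> t"]
    by (simp add: sum.lessThan_Suc_shift del: sum.lessThan_Suc nat_pow_Suc sum_of_bool_eq mult_Suc_right)
qed simp

lemma prd_concat_replicate:
  "s \<in> S \<Longrightarrow> t \<in> S \<Longrightarrow> prd (concat (replicate n [s, t])) = (s \<otimes> t) [^] n"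
proof (induction n)
  case (Suc n)
  then show ?case using nat_pow_Suc2[of "s \<otimes> t" n] by (simp add: m_assoc)
qed simp

lemma concat_replicate_words: "s \<in> S \<Longrightarrow> t \<in> S \<Longrightarrow> concat (replicate n [s, t]) \<in> lists S"
  by (induction n) auto

text \<open>Along the relator \<open>(s t)\<^sup>n\<close>, of length \<open>2 n\<close>, the crossed reflections \<open>(s t)\<^sup>i s\<close> repeat with
  period \<open>n\<close>, so that each is crossed an even number of times.\<close>

lemma odd_crossing_relator:
  assumes "s \<in> S" "t \<in> S" "r \<in> carrier W" "(s \<otimes> t) [^] n = \<one>"
  shows "\<not> odd_crossing (concat (replicate n [s, t])) r"
proof -
  define g :: "nat \<Rightarrow> nat" where "g i = of_bool (r = (s \<otimes> t) [^] i \<otimes> s)" for i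
  have "g (i + n) = g i" for i
    using assms by (simp add: g_def flip: nat_pow_mult)
  then have "sum g {n..<n + n} = sum g {0..<n}"
    using sum.shift_bounds_nat_ivl[of g 0 n n] by simp
  then have "sum g {..<2 * n} = 2 * sum g {0..<n}"
    using sum.atLeastLessThan_concat[of 0 n "n + n" g] by (simp add: atLeast0LessThan flip: mult_2)
  then show ?thesis
    using odd_crossing_dihedral[OF assms(1-3), of n] by (simp add: g_def del: sum_of_bool_eq)
qed

text \<open>Inserting a word that has product \<open>1\<close> and crosses every wall an even number of times changes
  no parity. By the previous lemma this applies to the relators.\<close>

lemma odd_crossing_word_eq:
  assumes "word_eq S (coxeter_relations W S) u v" "t \<in> carrier W"
  shows "odd_crossing (map fst u) t = odd_crossing (map fst v) t"
  using assms
proof (induction arbitrary: t rule: word_eq.induct)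
  case (cancel a u v e)
  then have "odd_crossing ([a, a] @ map fst v) r = odd_crossing (map fst v) r" if "r \<in> carrier W" for r
    using that by (auto simp: m_assoc generator_square)
  then show ?case
    using cancel odd_crossing_append[of "map fst u" "[a, a] @ map fst v" t] odd_crossing_append[of "map fst u" "map fst v" t]
    by (simp add: map_fst_words del: odd_crossing.simps)
next
  case (relation r r' u v)
  then obtain a b n where r: "r' = []" "r = positive_word (concat (replicate n [a, b]))" "a \<in> S" "b \<in> S"
      "n = ord (a \<otimes> b)"
    by (auto simp: coxeter_relations_def)
  have one: "(a \<otimes> b) [^] n = \<one>" using r by simp
  let ?c = "concat (replicate n [a, b])"
  have "odd_crossing (?c @ map fst v) x = odd_crossing (map fst v) x" if "x \<in> carrier W" for x
    using that relation.hyps r one odd_crossing_relator[of a b x n]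
    by (subst odd_crossing_append) (auto simp: map_fst_words concat_replicate_words prd_concat_replicate)
  then show ?case
    using relation r concat_replicate_words[of a b n]
     odd_crossing_append[of "map fst u" "?c @ map fst v" t] odd_crossing_append[of "map fst u" "map fst v" t]
    by (simp add: map_fst_words)
qed auto

text \<open>The quantifier selects some word of \<open>w\<close>; by \<open>odd_crossing_word_eq\<close> all words of \<open>w\<close> agree.\<close>

definition inversion :: "'w \<Rightarrow> 'w \<Rightarrow> bool" where
  "inversion w t \<longleftrightarrow> (\<exists>u\<in>lists S. prd u = w \<and> odd_crossing u t)"

lemma inversion_prd: "u \<in> lists S \<Longrightarrow> t \<in> carrier W \<Longrightarrow> inversion (prd u) t \<longleftrightarrow> odd_crossing u t"
  unfolding inversion_def by (metis odd_crossing_word_eq[OF prd_eq_word_eq] map_fst_positive_word)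

lemma inversion_mult:
  assumes "a \<in> carrier W" "b \<in> carrier W" "t \<in> carrier W"
  shows "inversion (a \<otimes> b) t = (inversion a t \<noteq> inversion b (inv a \<otimes> t \<otimes> a))"
proof -
  obtain u v where uv: "u \<in> lists S" "prd u = a" "v \<in> lists S" "prd v = b"
    using assms words_generate by metis
  then have "inversion (prd (u @ v)) t = odd_crossing (u @ v) t"
    by (intro inversion_prd) (auto simp: assms)
  then show ?thesis
    using uv assms inversion_prd[of u t] inversion_prd[of v "inv a \<otimes> t \<otimes> a"] prd_append[of u v] odd_crossing_append[of u v t]
    by simp
qed

lemma inversion_one: "t \<in> carrier W \<Longrightarrow> \<not> inversion \<one> t"
  using inversion_prd[of "[]" t] by simp

lemma inversion_generator: "s \<in> S \<Longrightarrow> t \<in> carrier W \<Longrightarrow> inversion s t \<longleftrightarrow> t = s"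
  using inversion_prd[of "[s]" t] by simp

text \<open>A reflection crosses its own wall an odd number of times: in the palindromic word of
  \<open>a s a\<inverse>\<close> the crossings in \<open>a\<close> and in \<open>a\<inverse>\<close> cancel, and the middle letter remains.\<close>

lemma inversion_reflection:
  assumes "a \<in> carrier W" "s \<in> S"
  shows "inversion (a \<otimes> s \<otimes> inv a) (a \<otimes> s \<otimes> inv a)"
proof -
  let ?t = "a \<otimes> s \<otimes> inv a"
  have 1: "inv a \<otimes> ?t \<otimes> a = s" "inv (a \<otimes> s) \<otimes> ?t \<otimes> (a \<otimes> s) = s"
    using assms by (simp_all add: inv_mult_group generator_inv m_assoc generator_square)
  have "inversion (a \<otimes> inv a) ?t = (inversion a ?t \<noteq> inversion (inv a) s)"
    using assms 1 by (subst inversion_mult) auto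
  then have "inversion a ?t = inversion (inv a) s"
    using assms inversion_one[of ?t] by simp
  moreover have "inversion (a \<otimes> s) ?t = (inversion a ?t \<noteq> True)"
    using assms 1 inversion_generator[of s s] by (subst inversion_mult) auto
  moreover have "inversion ?t ?t = (inversion (a \<otimes> s) ?t \<noteq> inversion (inv a) s)"
    using assms 1 inversion_mult[of "a \<otimes> s" "inv a" ?t] by auto
  ultimately show ?thesis by simp
qed

section \<open>Length and exchange\<close>

definition len :: "'w \<Rightarrow> nat" where
  "len w = (LEAST n. \<exists>u\<in>lists S. prd u = w \<and> length u = n)"

lemma len_le: "u \<in> lists S \<Longrightarrow> len (prd u) \<le> length u"
  unfolding len_def by (rule Least_le) auto

lemma reduced_word:
  assumes "w \<in> carrier W"
  obtains u where "u \<in> lists S" "prd u = w" "length u = len w"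
proof -
  have "\<exists>n. \<exists>u\<in>lists S. prd u = w \<and> length u = n"
    using words_generate[OF assms] by blast
  then have "\<exists>u\<in>lists S. prd u = w \<and> length u = len w"
    unfolding len_def by (rule LeastI_ex)
  then show ?thesis using that by blast
qed

lemma len_mult: "a \<in> carrier W \<Longrightarrow> b \<in> carrier W \<Longrightarrow> len (a \<otimes> b) \<le> len a + len b"
proof -
  assume "a \<in> carrier W" "b \<in> carrier W"
  then obtain u v where "u \<in> lists S" "prd u = a" "length u = len a"
    "v \<in> lists S" "prd v = b" "length v = len b"
    by (metis reduced_word)
  then show ?thesis using len_le[of "u @ v"] by (simp add: prd_append)
qed

lemma len_inv_le: "a \<in> carrier W \<Longrightarrow> len (inv a) \<le> len a"
proof -
  assume "a \<in> carrier W"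
  then obtain u where "u \<in> lists S" "prd u = a" "length u = len a"
    by (metis reduced_word)
  then show ?thesis using len_le[of "rev u"] by (simp add: prd_rev)
qed

lemma len_inv: "a \<in> carrier W \<Longrightarrow> len (inv a) = len a"
  using len_inv_le[of a] len_inv_le[of "inv a"] by simp

lemma len_one [simp]: "len \<one> = 0"
  using len_le[of "[]"] by simp

lemma len_eq_0: "a \<in> carrier W \<Longrightarrow> len a = 0 \<longleftrightarrow> a = \<one>"
  by (metis len_one length_0_conv reduced_word word_prod_simps(1))

lemma len_generator: "s \<in> S \<Longrightarrow> len s = 1"
  using len_le[of "[s]"] len_eq_0[of s] generator_neq_one[of s] by (cases "len s") auto

text \<open>The strong exchange property: if \<open>t\<close> is crossed at position \<open>i\<close>, then multiplying by \<open>t\<close> from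
  the left deletes the letter at \<open>i\<close>.\<close>

lemma odd_crossing_exchange:
  assumes "u \<in> lists S" "t \<in> carrier W" "odd_crossing u t"
  shows "\<exists>v. set v \<subseteq> set u \<and> length u = Suc (length v) \<and> prd v = t \<otimes> prd u"
  using assms
proof (induction u arbitrary: t)
  case (Cons s u)
  show ?case
  proof (cases "t = s")
    case True
    then show ?thesis using Cons.hyps by (intro exI[of _ u]) auto
  next
    case False
    then have "odd_crossing u (s \<otimes> t \<otimes> s)" using Cons.prems by simp
    then obtain v where "set v \<subseteq> set u" "length u = Suc (length v)" "prd v = s \<otimes> t \<otimes> s \<otimes> prd u"
      using Cons.IH[of "s \<otimes> t \<otimes> s"] Cons.hyps Cons.prems(1) by auto
    then show ?thesis
      using Cons.hyps Cons.prems(1) by (intro exI[of _ "s # v"]) (auto simp: m_assoc)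
  qed
qed simp

lemma inversion_len_less:
  assumes "w \<in> carrier W" "t \<in> carrier W" "inversion w t"
  shows "len (t \<otimes> w) < len w"
proof -
  obtain u where u: "u \<in> lists S" "prd u = w" "length u = len w"
    using assms reduced_word by metis
  moreover have "odd_crossing u t" using inversion_prd[of u t] u assms by auto
  ultimately obtain v where v: "set v \<subseteq> set u" "length u = Suc (length v)" "prd v = t \<otimes> w"
    using assms odd_crossing_exchange by metis
  then have "len (prd v) \<le> length v" using u by (intro len_le) auto
  then show ?thesis using u v by simp
qed

text \<open>If \<open>t\<close> is not an inversion of \<open>w\<close>, then it is one of \<open>t w\<close>, since \<open>t\<close> crosses its own wall
  once more; so \<open>t\<close> shortens \<open>t w\<close>.\<close>

lemma not_inversion_len_less:
  assumes "w \<in> carrier W" "a \<in> carrier W" "s \<in> S" "t = a \<otimes> s \<otimes> inv a" "\<not> inversion w t"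
  shows "len w < len (t \<otimes> w)"
proof -
  have t: "t \<in> carrier W" "t \<otimes> t = \<one>" "inv t = t"
    using assms(2-4) by (simp_all add: inv_mult_group generator_inv m_assoc)
  have "inversion t t" unfolding assms(4) by (rule inversion_reflection) (use assms in auto)
  then have "inversion (t \<otimes> w) t"
    using inversion_mult[of t w t] assms t by simp
  then have "len (t \<otimes> (t \<otimes> w)) < len (t \<otimes> w)"
    using assms t by (intro inversion_len_less) auto
  then show ?thesis using assms t by (simp flip: m_assoc)
qed

lemma not_inversion_len_generator:
  assumes "w \<in> carrier W" "s \<in> S" "\<not> inversion w s"
  shows "len (s \<otimes> w) = Suc (len w)"
  using not_inversion_len_less[of w \<one> s s] len_mult[of s w] len_generator[of s] assms by auto

lemma inversion_len_generator:
  assumes "w \<in> carrier W" "s \<in> S" "inversion w s"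
  shows "len w = Suc (len (s \<otimes> w))"
  using inversion_len_less[of w s] len_mult[of s "s \<otimes> w"] len_generator[of s] assms by auto

section \<open>Parabolic subgroups and coset representatives\<close>

definition parabolic :: "'w set \<Rightarrow> 'w set" where "parabolic J = prd ` lists J"

lemma lists_subset: "J \<subseteq> S \<Longrightarrow> u \<in> lists J \<Longrightarrow> u \<in> lists S"
  using lists_mono by blast

lemma parabolic_carrier: "J \<subseteq> S \<Longrightarrow> a \<in> parabolic J \<Longrightarrow> a \<in> carrier W"
  unfolding parabolic_def by (elim imageE) (simp only: prd_closed lists_subset)

lemma parabolicE:
  assumes "J \<subseteq> S" "a \<in> parabolic J"
  obtains x where "x \<in> lists J" "x \<in> lists S" "prd x = a"
  using assms lists_subset unfolding parabolic_def by blast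

lemma parabolicI: "x \<in> lists J \<Longrightarrow> prd x = a \<Longrightarrow> a \<in> parabolic J"
  unfolding parabolic_def by blast

lemma parabolic_one: "\<one> \<in> parabolic J"
  by (auto simp: parabolic_def image_iff intro!: bexI[of _ "[]"])

lemma parabolic_generator: "J \<subseteq> S \<Longrightarrow> s \<in> J \<Longrightarrow> s \<in> parabolic J"
  by (auto simp: parabolic_def image_iff intro!: bexI[of _ "[s]"])

lemma parabolic_mult: "J \<subseteq> S \<Longrightarrow> a \<in> parabolic J \<Longrightarrow> b \<in> parabolic J \<Longrightarrow> a \<otimes> b \<in> parabolic J"
proof -
  assume J: "J \<subseteq> S" and "a \<in> parabolic J" "b \<in> parabolic J"
  then obtain x y where "x \<in> lists J" "x \<in> lists S" "prd x = a" "y \<in> lists J" "y \<in> lists S" "prd y = b"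
    by (elim parabolicE[OF J])
  then show ?thesis by (intro parabolicI[of "x @ y"]) (auto simp: prd_append)
qed

lemma parabolic_inv: "J \<subseteq> S \<Longrightarrow> a \<in> parabolic J \<Longrightarrow> inv a \<in> parabolic J"
proof -
  assume J: "J \<subseteq> S" and "a \<in> parabolic J"
  then obtain x where "x \<in> lists J" "x \<in> lists S" "prd x = a"
    by (elim parabolicE[OF J])
  then show ?thesis by (intro parabolicI[of "rev x"]) (auto simp: prd_rev)
qed

lemma parabolic_mono: "J \<subseteq> J' \<Longrightarrow> parabolic J \<subseteq> parabolic J'"
  unfolding parabolic_def by (intro image_mono lists_mono)

lemma parabolic_S: "parabolic S = carrier W"
  using words_generate prd_closed unfolding parabolic_def by blast

definition left_minimal :: "'w set \<Rightarrow> 'w \<Rightarrow> bool" where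
  "left_minimal J b \<longleftrightarrow> b \<in> carrier W \<and> (\<forall>a\<in>parabolic J. len b \<le> len (a \<otimes> b))"

lemma left_minimal_not_inversion:
  assumes "J \<subseteq> S" "left_minimal J b" "a \<in> parabolic J"
  shows "\<not> inversion b a"
proof
  assume "inversion b a"
  then have "len (a \<otimes> b) < len b"
    using assms parabolic_carrier by (intro inversion_len_less) (auto simp: left_minimal_def)
  then show False using assms by (auto simp: left_minimal_def)
qed

text \<open>If prepending \<open>s\<close> shortened the product, exchange would delete a letter of \<open>x\<close> or a letter of
  a word for \<open>b\<close>. The former contradicts the minimality of the word \<open>s x\<close> among words in \<open>J\<close>, the
  latter means that a reflection of the parabolic subgroup shortens \<open>b\<close>.\<close>

lemma parabolic_word_len:
  assumes "J \<subseteq> S" "left_minimal J b" "x \<in> lists J" "\<forall>x'\<in>lists J. prd x' = prd x \<longrightarrow> length x \<le> length x'"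
  shows "len (prd x \<otimes> b) = length x + len b"
  using assms(3,4)
proof (induction x)
  case Nil
  then show ?case using assms(2) by (simp add: left_minimal_def)
next
  case (Cons s x)
  have b: "b \<in> carrier W" using assms(2) by (simp add: left_minimal_def)
  have sx: "s \<in> S" "x \<in> lists S" using Cons.hyps assms(1) lists_subset by auto
  have "length x \<le> length x'" if "x' \<in> lists J" "prd x' = prd x" for x'
    using Cons.prems[rule_format, of "s # x'"] Cons.hyps that by simp
  then have IH: "len (prd x \<otimes> b) = length x + len b"
    using Cons.IH by blast
  have "\<not> inversion (prd x \<otimes> b) s"
  proof
    assume inversion: "inversion (prd x \<otimes> b) s"
    have "inv (prd x) \<otimes> s \<otimes> prd x \<in> parabolic J"
      using Cons.hyps parabolic_mult[OF assms(1)] parabolic_inv[OF assms(1)] parabolic_generator[OF assms(1)]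
      by (auto simp: parabolic_def)
    then have "inversion (prd x) s"
      using inversion inversion_mult[of "prd x" b s] left_minimal_not_inversion[OF assms(1,2)] sx b by auto
    then have "odd_crossing x s" using inversion_prd sx by auto
    then obtain v where v: "set v \<subseteq> set x" "length x = Suc (length v)" "prd v = s \<otimes> prd x"
      using odd_crossing_exchange[of x s] sx by auto
    then have "v \<in> lists J" using Cons.hyps(2) by (auto simp: in_lists_conv_set)
    then show False using Cons.prems[rule_format, of v] v by simp
  qed
  then show ?case
    using not_inversion_len_generator[of "prd x \<otimes> b" s] IH sx b by (simp add: m_assoc)
qed

lemma parabolic_shortest_word:
  assumes "a \<in> parabolic J"
  obtains x where "x \<in> lists J" "prd x = a" "\<forall>x'\<in>lists J. prd x' = a \<longrightarrow> length x \<le> length x'"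
proof -
  obtain x where "x \<in> lists J" "prd x = a" using assms by (auto simp: parabolic_def)
  then show ?thesis
    using ex_has_least_nat[of "\<lambda>x. x \<in> lists J \<and> prd x = a" x length] that by blast
qed

lemma left_minimal_one: "J \<subseteq> S \<Longrightarrow> left_minimal J \<one>"
  by (auto simp: left_minimal_def)

lemma parabolic_reduced_word:
  assumes "J \<subseteq> S" "a \<in> parabolic J"
  obtains x where "x \<in> lists J" "prd x = a" "length x = len a"
proof -
  obtain x where x: "x \<in> lists J" "prd x = a" "\<forall>x'\<in>lists J. prd x' = a \<longrightarrow> length x \<le> length x'"
    by (rule parabolic_shortest_word[OF assms(2)])
  then have "length x = len a"
    using parabolic_word_len[OF assms(1) left_minimal_one[OF assms(1)], of x] parabolic_carrier[OF assms] by auto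
  then show ?thesis using x that by blast
qed

lemma parabolic_len_add:
  assumes "J \<subseteq> S" "a \<in> parabolic J" "left_minimal J b"
  shows "len (a \<otimes> b) = len a + len b"
proof -
  obtain x where x: "x \<in> lists J" "prd x = a" "\<forall>x'\<in>lists J. prd x' = a \<longrightarrow> length x \<le> length x'"
    by (rule parabolic_shortest_word[OF assms(2)])
  then show ?thesis
    using parabolic_word_len[OF assms(1) left_minimal_one[OF assms(1)], of x]
      parabolic_word_len[OF assms(1,3), of x] parabolic_carrier[OF assms(1,2)] by auto
qed

text \<open>The representative \<open>b\<close> is an element of minimal length of the coset.\<close>

lemma coset_decomposition:
  assumes "J \<subseteq> S" "w \<in> carrier W"
  obtains a b where "a \<in> parabolic J" "left_minimal J b" "w = a \<otimes> b"
proof -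
  obtain c where c: "c \<in> parabolic J" "\<forall>c'. c' \<in> parabolic J \<longrightarrow> len (c \<otimes> w) \<le> len (c' \<otimes> w)"
    using ex_has_least_nat[of "\<lambda>c. c \<in> parabolic J" \<one> "\<lambda>c. len (c \<otimes> w)"] parabolic_one by blast
  have cc: "c \<in> carrier W" using c assms parabolic_carrier by blast
  have "len (c \<otimes> w) \<le> len (a \<otimes> (c \<otimes> w))" if "a \<in> parabolic J" for a
    using c(2)[rule_format, OF parabolic_mult[OF assms(1) that c(1)]] cc assms that parabolic_carrier
    by (simp add: m_assoc)
  then have "left_minimal J (c \<otimes> w)" using cc assms by (auto simp: left_minimal_def)
  moreover have "w = inv c \<otimes> (c \<otimes> w)" using cc assms by simp
  ultimately show ?thesis using that parabolic_inv[OF assms(1) c(1)] by blast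
qed

text \<open>If \<open>b\<close> is not minimal in its coset, write \<open>b = a c\<close> with \<open>c\<close> minimal and \<open>a \<noteq> 1\<close>. As the
  lengths add, the first letter of a word of \<open>a\<close> in \<open>J\<close> shortens \<open>b\<close>.\<close>

lemma left_minimal_iff:
  assumes "J \<subseteq> S" "b \<in> carrier W"
  shows "left_minimal J b \<longleftrightarrow> (\<forall>s\<in>J. \<not> inversion b s)"
proof
  assume "left_minimal J b"
  then show "\<forall>s\<in>J. \<not> inversion b s" using left_minimal_not_inversion parabolic_generator assms by blast
next
  assume *: "\<forall>s\<in>J. \<not> inversion b s"
  obtain a c where ac: "a \<in> parabolic J" "left_minimal J c" "b = a \<otimes> c"
    using coset_decomposition[OF assms] by blast
  obtain x where x: "x \<in> lists J" "prd x = a" "length x = len a"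
    using parabolic_reduced_word[OF assms(1) ac(1)] by blast
  have c: "c \<in> carrier W" using ac by (simp add: left_minimal_def)
  show "left_minimal J b"
  proof (cases x)
    case Nil
    then have "a = \<one>" using x by simp
    then show ?thesis using ac c by simp
  next
    case (Cons s y)
    then have sy: "s \<in> J" "s \<in> S" "y \<in> lists S" using x assms lists_subset by auto
    have "prd y \<in> carrier W" using sy by (simp only: prd_closed)
    then have "s \<otimes> b = prd y \<otimes> c"
      using ac(3) c x(2) Cons sy by (simp add: m_assoc flip: x(2))
    then have "len (s \<otimes> b) \<le> length y + len c"
      using len_mult[of "prd y" c] len_le[of y] sy c by auto
    moreover have "len b = Suc (length y) + len c"
      using parabolic_len_add[OF assms(1) ac(1,2)] ac x Cons by simp
    moreover have "len (s \<otimes> b) = Suc (len b)"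
      using * sy assms not_inversion_len_generator by blast
    ultimately show ?thesis by simp
  qed
qed

section \<open>Matsumoto's theorem and the canonical section\<close>

lemma alternating_words: "s \<in> J \<Longrightarrow> t \<in> J \<Longrightarrow> alternating n s t \<in> lists J"
  by (induction n arbitrary: s t) auto

lemma length_alternating [simp]: "length (alternating n s t) = n"
  by (induction n arbitrary: s t) auto

lemma dihedral_conj:
  assumes "s \<in> S" "t \<in> S"
  shows "(s \<otimes> t) [^] (n::nat) \<otimes> s \<otimes> (s \<otimes> t) [^] n = s"
proof (induction n)
  case (Suc n)
  define p where "p = (s \<otimes> t) [^] n"
  have p: "p \<in> carrier W" "(s \<otimes> t) [^] Suc n = s \<otimes> t \<otimes> p" "(s \<otimes> t) [^] Suc n = p \<otimes> (s \<otimes> t)"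
    using assms nat_pow_Suc2[of "s \<otimes> t" n] by (simp_all add: p_def)
  have "(s \<otimes> t) [^] Suc n \<otimes> s \<otimes> (s \<otimes> t) [^] Suc n = (s \<otimes> t \<otimes> p) \<otimes> s \<otimes> (p \<otimes> (s \<otimes> t))"
    by (metis p(2,3))
  also have "\<dots> = s \<otimes> t \<otimes> (p \<otimes> s \<otimes> p) \<otimes> (s \<otimes> t)"
    using assms p(1) by (simp add: m_assoc)
  also have "\<dots> = s"
    unfolding Suc.IH[folded p_def] using assms by (simp add: m_assoc generator_square)
  finally show ?case .
qed (use assms in simp)

text \<open>For \<open>n\<close> the order of \<open>s t\<close> this is the braid relation in \<open>W\<close>; the form with an arbitrary
  \<open>n\<close> allows induction.\<close>

lemma prd_alternating_swap:
  assumes "s \<in> S" "t \<in> S"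
  shows "prd (alternating n s t) = (s \<otimes> t) [^] n \<otimes> prd (alternating n t s)"
proof (induction n)
  case (Suc n)
  define p where "p = (s \<otimes> t) [^] n"
  have p: "p \<in> carrier W" "(s \<otimes> t) [^] Suc n = p \<otimes> (s \<otimes> t)"
    using assms by (simp_all add: p_def)
  have q: "prd (alternating n t s) \<in> carrier W" 
    using assms alternating_words[of t S s n] by (simp only: prd_closed)
  have "(s \<otimes> t) [^] Suc n \<otimes> prd (alternating (Suc n) t s) = p \<otimes> s \<otimes> (p \<otimes> prd (alternating n t s))"
    unfolding p(2) using assms p(1) q by (simp add: m_assoc Suc.IH flip: p_def)
  also have "\<dots> = (p \<otimes> s \<otimes> p) \<otimes> prd (alternating n t s)"
    using assms p(1) q by (simp add: m_assoc)
  finally show ?case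
    using dihedral_conj[OF assms, of n] by (simp add: p_def)
qed simp

lemma odd_crossing_alternating:
  assumes "s \<in> S" "t \<in> S" "r \<in> carrier W" "odd_crossing (alternating k s t) r"
  shows "\<exists>i<k. r = (s \<otimes> t) [^] i \<otimes> s"
  using assms
proof (induction k arbitrary: s t r)
  case (Suc k)
  show ?case
  proof (cases "r = s")
    case True
    then show ?thesis using Suc.prems by (intro exI[of _ 0]) auto
  next
    case False
    then obtain i where i: "i < k" "s \<otimes> r \<otimes> s = (t \<otimes> s) [^] i \<otimes> t"
      using Suc.IH[of t s "s \<otimes> r \<otimes> s"] Suc.prems by auto
    have shift: "(s \<otimes> t) [^] j \<otimes> s = s \<otimes> (t \<otimes> s) [^] j" for j :: nat
    proof (induction j)
      case (Suc j)
      have "(s \<otimes> t) [^] Suc j \<otimes> s = ((s \<otimes> t) [^] j \<otimes> s) \<otimes> (t \<otimes> s)"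
        using Suc.prems \<open>s \<in> S\<close> \<open>t \<in> S\<close> by (simp add: m_assoc)
      then show ?case
        unfolding Suc.IH using \<open>s \<in> S\<close> \<open>t \<in> S\<close> by (simp add: m_assoc)
    qed (use Suc.prems in simp)
    have "r = s \<otimes> (s \<otimes> r \<otimes> s) \<otimes> s"
      using Suc.prems by (simp add: m_assoc generator_square)
    also have "\<dots> = (s \<otimes> (t \<otimes> s) [^] i) \<otimes> (t \<otimes> s)"
      unfolding i(2) using Suc.prems by (simp add: m_assoc)
    also have "\<dots> = (s \<otimes> t) [^] Suc i \<otimes> s"
      unfolding shift[symmetric] using Suc.prems by (simp add: m_assoc)
    finally show ?thesis using i(1) by (intro exI[of _ "Suc i"]) simp
  qed
qed simp

definition reduced :: "'w list \<Rightarrow> bool" where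
  "reduced u \<longleftrightarrow> u \<in> lists S \<and> length u = len (prd u)"

lemma reduced_Cons: "reduced (s # u) \<Longrightarrow> s \<in> S \<and> reduced u"
  using len_le[of u] len_mult[of s "prd u"] len_generator[of s] by (auto simp: reduced_def)

lemma reduced_Cons_inversion: "reduced (s # u) \<Longrightarrow> inversion (prd (s # u)) s"
  using not_inversion_len_generator[of "prd (s # u)" s] reduced_Cons[of s u]
  by (auto simp: reduced_def)

lemma reduced_dihedral:
  assumes "reduced x" "x \<in> lists {s, t}" "x \<noteq> []"
  shows "x = alternating (length x) s t \<or> x = alternating (length x) t s"
  using assms
proof (induction x)
  case (Cons a x)
  have x: "reduced x" "a \<in> S" using reduced_Cons Cons.prems by auto
  show ?case
  proof (cases x)
    case Nil
    then show ?thesis using Cons.prems by auto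
  next
    case (Cons b y)
    then have "a \<noteq> b"
      using Cons.prems(1) len_le[of y] generator_cancel[of a "prd y"] unfolding Cons
      by (auto simp: reduced_def simp del: generator_cancel)
    then show ?thesis using Cons.IH x Cons.prems Cons by auto
  qed
qed simp

lemma alternating_add: "\<exists>r\<in>lists {s, t}. alternating (m + j) s t = alternating m s t @ r"
proof (induction m arbitrary: s t)
  case 0
  then show ?case using alternating_words[of s "{s, t}" t j] by simp
next
  case (Suc m)
  from Suc.IH[of t s] show ?case by (auto simp: insert_commute)
qed

abbreviation braid_eq :: "'w list \<Rightarrow> 'w list \<Rightarrow> bool" where
  "braid_eq u v \<equiv> word_eq S (braid_relations W S) (positive_word u) (positive_word v)"

lemma positive_word_append: "positive_word (u @ v) = positive_word u @ positive_word v"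
  by (simp add: positive_word_def)

lemma braid_eq_append:
  "braid_eq u u' \<Longrightarrow> braid_eq v v' \<Longrightarrow> braid_eq (u @ v) (u' @ v')"
  unfolding positive_word_append by (rule word_eq_append)

lemma braid_eq_refl: "u \<in> lists S \<Longrightarrow> braid_eq u u"
  by (intro word_eq.word_refl) simp

lemma braid_eq_Cons: "s \<in> S \<Longrightarrow> braid_eq u v \<Longrightarrow> braid_eq (s # u) (s # v)"
  using braid_eq_append[OF braid_eq_refl[of "[s]"], of u v] by simp

text \<open>Two reduced words of the same element with different first letters \<open>s\<close> and \<open>t\<close>. The element
  has a reduced word that starts with \<open>k\<close> letters alternating between \<open>s\<close> and \<open>t\<close>. Because \<open>t\<close> is
  an inversion of that alternating part, \<open>t = (s t)\<^sup>i s\<close> for some \<open>i < k\<close>; therefore the order \<open>m\<close>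
  of \<open>s t\<close> divides \<open>i + 1\<close>, and the braid relation of length \<open>m \<le> k\<close> can be applied. The induction
  hypothesis, used after stripping the first letter, connects the two given words to the two sides
  of this braid move.\<close>

lemma matsumoto_step:
  assumes IH: "\<And>u v. reduced u \<Longrightarrow> reduced v \<Longrightarrow> prd u = prd v \<Longrightarrow> length u = n \<Longrightarrow> braid_eq u v"
    and "s \<noteq> t" "reduced (s # u)" "reduced (t # v)" "prd (s # u) = prd (t # v)" "length u = n"
    and x: "reduced (alternating k s t)" "left_minimal {s, t} b" "prd (s # u) = prd (alternating k s t) \<otimes> b"
    and inversion: "inversion (prd (alternating k s t)) t"
  shows "braid_eq (s # u) (t # v)"
proof -
  have S: "s \<in> S" "t \<in> S" "reduced u" "reduced v" using assms reduced_Cons by auto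
  have lv: "length v = n" using assms(3-6) by (simp add: reduced_def)
  define m where "m = ord (s \<otimes> t)"
  obtain i where i: "i < k" "t = (s \<otimes> t) [^] i \<otimes> s"
    using inversion inversion_prd[of "alternating k s t" t] alternating_words[of s S t k] odd_crossing_alternating[of s t t k] S generator_closed
    by blast
  have "(s \<otimes> t) [^] Suc i = ((s \<otimes> t) [^] i \<otimes> s) \<otimes> t"
    using S by (simp add: m_assoc)
  also have "\<dots> = \<one>" using S generator_square by (simp flip: i(2))
  finally have "m dvd Suc i" using S pow_eq_id[of "s \<otimes> t" "Suc i"] by (simp add: m_def)
  then have m: "0 < m" "m \<le> k" using i(1) by (auto dest: dvd_imp_le intro: Nat.gr0I)
  then obtain m' where m': "m = Suc m'" by (cases m) auto
  obtain r where r: "r \<in> lists {s, t}" "alternating k s t = alternating m s t @ r"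
    using alternating_add[of s t m "k - m"] m(2) by auto
  have b: "b \<in> carrier W" using x by (simp add: left_minimal_def)
  then obtain y where y: "y \<in> lists S" "prd y = b" "length y = len b" using reduced_word by blast
  have rS: "r \<in> lists S" using r(1) S lists_subset[of "{s,t}"] by auto
  note alt = alternating_words[of s S t m] alternating_words[of t S s m]
  define z where "z = r @ y"
  have z: "z \<in> lists S" using rS y by (simp add: z_def)
  have pz: "prd (alternating m s t @ z) = prd (s # u)"
    using x(3) r(2) alt S y(1,2) rS b by (simp add: z_def prd_append m_assoc)
  have "prd (alternating m s t) = prd (alternating m t s)"
    using prd_alternating_swap[of s t m] S alt by (simp add: m_def)
  then have pz': "prd (alternating m t s @ z) = prd (s # u)"
    unfolding pz[symmetric] using alt S z by (simp add: prd_append)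
  have "len (prd (s # u)) = k + len b"
    unfolding x(3) using x(1) S
    using parabolic_len_add[of "{s, t}", OF _ parabolicI[OF alternating_words refl] x(2)] x(1) S
    by (auto simp: reduced_def)
  moreover have "k = m + length r" using arg_cong[OF r(2), of length] by simp
  ultimately have lz: "m + length z = len (prd (s # u))" using y by (simp add: z_def)
  have red: "reduced (alternating m s t @ z)" "reduced (alternating m t s @ z)"
    using lz pz pz' alt S z by (auto simp: reduced_def)
  have 1: "braid_eq (s # u) (alternating m s t @ z)"
    unfolding m' alternating.simps append_Cons
    using red(1) pz reduced_Cons[of s "alternating m' t s @ z"] S assms(6)
    by (intro braid_eq_Cons IH) (auto simp: m' reduced_def)
  have 2: "braid_eq (t # v) (alternating m t s @ z)"
    unfolding m' alternating.simps append_Cons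
    using red(2) pz' reduced_Cons[of t "alternating m' s t @ z"] S assms(5) lv
    by (intro braid_eq_Cons IH) (auto simp: m' reduced_def)
  have "(positive_word (alternating m s t), positive_word (alternating m t s)) \<in> braid_relations W S"
    using S m(1) assms(2) by (auto simp: braid_relations_def m_def)
  then have "braid_eq (alternating m s t) (alternating m t s)"
    using word_eq.relation[of _ _ "braid_relations W S" S "[]" "[]"] alt S by simp
  then have "braid_eq (alternating m s t @ z) (alternating m t s @ z)"
    using braid_eq_append braid_eq_refl[OF z] by blast
  then show ?thesis using 1 2 word_eq.word_trans word_eq.word_sym by blast
qed

text \<open>When the first letters \<open>s\<close> and \<open>t\<close> differ, both are inversions of the product, and then of its
  factor \<open>a\<close> in the parabolic subgroup of \<open>{s, t}\<close>, because the minimal representative \<open>b\<close> has no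
  inversions there. A reduced word of \<open>a\<close> alternates between \<open>s\<close> and \<open>t\<close>, and the previous lemma
  applies, with the roles of \<open>s\<close> and \<open>t\<close> according to its first letter.\<close>

theorem matsumoto:
  "reduced u \<Longrightarrow> reduced v \<Longrightarrow> prd u = prd v \<Longrightarrow> braid_eq u v"
proof (induction "length u" arbitrary: u v)
  case 0
  then have "u = []" by simp
  moreover from this 0 have "v = []" by (simp add: reduced_def flip: 0(4))
  ultimately show ?case by (simp add: braid_eq_refl)
next
  case (Suc n)
  have IH: "braid_eq u v" if "reduced u" "reduced v" "prd u = prd v" "length u = n" for u v
    using Suc that by simp
  obtain s u' where u: "u = s # u'" "length u' = n" using Suc by (cases u) auto
  have "length v = Suc n" using Suc by (simp add: reduced_def)
  then obtain t v' where v: "v = t # v'" "length v' = n" by (cases v) auto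
  have S: "s \<in> S" "t \<in> S" "reduced u'" "reduced v'" using Suc.prems u v reduced_Cons by auto
  show ?case
  proof (cases "s = t")
    case True
    then have "prd u' = prd v'" using Suc.prems(3) S u v by (auto simp: reduced_def)
    then show ?thesis using True IH S u v braid_eq_Cons by simp
  next
    case False
    have st: "{s, t} \<subseteq> S" using S by auto
    obtain a b where ab: "a \<in> parabolic {s, t}" "left_minimal {s, t} b" "prd u = a \<otimes> b"
      using coset_decomposition[OF st, of "prd u"] Suc.prems by (auto simp: reduced_def)
    obtain x where x: "x \<in> lists {s, t}" "prd x = a" "length x = len a"
      using parabolic_reduced_word[OF st ab(1)] by blast
    have ac: "a \<in> carrier W" "b \<in> carrier W"
      using parabolic_carrier[OF st ab(1)] ab(2) by (auto simp: left_minimal_def)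
    have inversion: "inversion a r" if "r \<in> {s, t}" "inversion (prd u) r" for r
    proof -
      have "inv a \<otimes> r \<otimes> a \<in> parabolic {s, t}"
        using that ab parabolic_mult[OF st] parabolic_inv[OF st] parabolic_generator[OF st] by auto
      then show ?thesis
        using that ab(2,3) inversion_mult[of a b r] left_minimal_not_inversion[OF st] ac S by auto
    qed
    have Ns: "inversion a s" using inversion[of s] reduced_Cons_inversion[of s u'] Suc.prems(1) u by simp
    have Nt: "inversion a t" using inversion[of t] reduced_Cons_inversion[of t v'] Suc.prems(2,3) v by simp
    have uv: "reduced (s # u')" "reduced (t # v')" "prd (s # u') = prd (t # v')" "prd (s # u') = a \<otimes> b"
      using Suc.prems ab(3) by (simp_all only: u(1) v(1))
    have ne: "x \<noteq> []" using Ns x inversion_one S by auto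
    have red: "reduced x" using x lists_subset[OF st] by (auto simp: reduced_def)
    obtain k where "x = alternating k s t \<or> x = alternating k t s"
      using reduced_dihedral[OF red x(1) ne] by blast
    then consider "x = alternating k s t" | "x = alternating k t s" by blast
    then show ?thesis
    proof cases
      case 1
      show ?thesis
        unfolding u(1) v(1)
        by (rule matsumoto_step[OF _ False uv(1-3) u(2) red[unfolded 1] ab(2)], rule IH, assumption+)
          (use uv(4) Nt x(2) 1 in auto)
    next
      case 2
      have "braid_eq (t # v') (s # u')"
        by (rule matsumoto_step[OF _ False[symmetric] uv(2,1) uv(3)[symmetric] v(2) red[unfolded 2]
              ab(2)[unfolded insert_commute[of s t]]], rule IH, assumption+)
          (use uv(3,4) Ns x(2) 2 in auto)
      then show ?thesis unfolding u(1) v(1) by (rule word_eq.word_sym)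
    qed
  qed
qed

lemma reduced_decomposition_iff:
  "reduced_decomposition W S w u \<longleftrightarrow> reduced u \<and> prd u = w"
proof
  assume u: "reduced_decomposition W S w u"
  then have "u \<in> lists S" by (simp add: reduced_decomposition_def)
  then have "prd u \<in> carrier W" by (rule prd_closed)
  then obtain v where "v \<in> lists S" "prd v = prd u" "length v = len (prd u)"
    using reduced_word by blast
  then show "reduced u \<and> prd u = w"
    using u len_le[of u] unfolding reduced_decomposition_def reduced_def by force
next
  assume "reduced u \<and> prd u = w"
  then show "reduced_decomposition W S w u"
    unfolding reduced_decomposition_def reduced_def by (metis len_le)
qed

lemma word_prod_braid_generators:
  assumes "u \<in> lists S"
  shows "word_prod (braid_group W S) (map (braid_generator W S) u) =
    word_rel S (braid_relations W S) `` {positive_word u}"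
  using assms
proof (induction u)
  case Nil
  then show ?case by (simp add: braid_group_def presented_group_one positive_word_def)
next
  case (Cons a u)
  have "positive_word u \<in> signed_words S" using Cons.hyps by simp
  then show ?case
    using Cons presented_group_mult[of "[(a, True)]" S "positive_word u" "braid_relations W S"]
    by (simp add: braid_group_def braid_generator_def positive_word_def)
qed

lemma canonical_section_reduced:
  assumes "reduced u"
  shows "canonical_section W S (prd u) = word_rel S (braid_relations W S) `` {positive_word u}"
proof -
  define v where "v = (SOME v. reduced_decomposition W S (prd u) v)"
  have "reduced v \<and> prd v = prd u"
    unfolding v_def reduced_decomposition_iff by (rule someI[of _ u]) (use assms in simp)
  then have "braid_eq v u" "v \<in> lists S" using assms matsumoto by (auto simp: reduced_def)
  then show ?thesis
    unfolding canonical_section_def v_def[symmetric]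
    by (simp add: word_prod_braid_generators word_rel_class_eq)
qed

lemma canonical_section_mult:
  assumes "a \<in> carrier W" "b \<in> carrier W" "len (a \<otimes> b) = len a + len b"
  shows "canonical_section W S (a \<otimes> b) =
    canonical_section W S a \<otimes>\<^bsub>braid_group W S\<^esub> canonical_section W S b"
proof -
  obtain u v where u: "u \<in> lists S" "prd u = a" "length u = len a"
    and v: "v \<in> lists S" "prd v = b" "length v = len b"
    using assms reduced_word by metis
  then have "reduced u" "reduced v" "reduced (u @ v)" "prd (u @ v) = a \<otimes> b"
    using assms by (auto simp: reduced_def prd_append)
  then show ?thesis
    using canonical_section_reduced[of "u @ v"] canonical_section_reduced[of u]
      canonical_section_reduced[of v] u v
      presented_group_mult[of "positive_word u" S "positive_word v" "braid_relations W S"]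
    by (simp add: braid_group_def positive_word_append)
qed

lemma canonical_section_closed:
  assumes "w \<in> carrier W"
  shows "canonical_section W S w \<in> carrier (braid_group W S)"
proof -
  obtain u where "u \<in> lists S" "prd u = w" "length u = len w"
    using assms reduced_word by blast
  then show ?thesis
    using canonical_section_reduced[of u] presented_group_carrierI[of "positive_word u" S]
    by (simp add: reduced_def braid_group_def)
qed

lemma canonical_section_one: "canonical_section W S \<one> = \<one>\<^bsub>braid_group W S\<^esub>"
  using canonical_section_reduced[of "[]"]
  by (simp add: reduced_def braid_group_def presented_group_one positive_word_def)

lemma canonical_section_generator: "s \<in> S \<Longrightarrow> canonical_section W S s = braid_generator W S s"
  using canonical_section_reduced[of "[s]"]
  by (simp add: reduced_def braid_generator_def positive_word_def len_generator)

section \<open>Longest elements of parabolic subgroups\<close>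

text \<open>Every element of the parabolic subgroup is an initial factor of a longest element \<open>w\<close>. When
  \<open>u = p s\<close> is longer than \<open>p\<close>, the reflection \<open>t = p s p\<inverse>\<close> is an inversion of \<open>w\<close>, by
  maximality, but not of \<open>p\<close>. Hence \<open>s\<close> is an inversion of \<open>p\<inverse> w\<close> and can be split off from it.\<close>

lemma longest_factor:
  assumes "J \<subseteq> S" "w \<in> parabolic J" "\<forall>u\<in>parabolic J. len u \<le> len w" "u \<in> parabolic J"
  shows "len w = len u + len (inv u \<otimes> w)"
proof -
  have w: "w \<in> carrier W" using assms parabolic_carrier by blast
  obtain x where x: "x \<in> lists J" "prd x = u" "length x = len u"
    using parabolic_reduced_word assms by blast
  have "reduced x" using x lists_subset assms by (auto simp: reduced_def)
  then have "x \<in> lists J \<longrightarrow> len w = length x + len (inv (prd x) \<otimes> w)"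
  proof (induction x rule: rev_induct)
    case Nil
    then show ?case using w by simp
  next
    case (snoc s x)
    show ?case
    proof
      assume xs: "x @ [s] \<in> lists J"
      then have sJ: "s \<in> J" "x \<in> lists J" and sS: "s \<in> S" "x \<in> lists S"
        using assms(1) lists_subset by auto
      have "len (prd (x @ [s])) \<le> len (prd x) + 1"
        using sS len_mult[of "prd x" s] len_generator by (simp add: prd_append)
      then have red: "reduced x" and len: "len (prd x \<otimes> s) = Suc (len (prd x))"
        using snoc.prems sS len_le[of x] by (auto simp: reduced_def prd_append)
      define p where "p = prd x"
      have p: "p \<in> carrier W" "p \<in> parabolic J" using sS sJ parabolicI by (auto simp: p_def)
      define t where "t = p \<otimes> s \<otimes> inv p"
      have t: "t \<in> parabolic J" "t \<in> carrier W"
        unfolding t_def using assms(1) p(2) sJ parabolic_mult parabolic_inv parabolic_generator parabolic_carrier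
        by metis+
      have "inversion w t"
      proof (rule ccontr)
        assume "\<not> inversion w t"
        then have "len w < len (t \<otimes> w)"
          using not_inversion_len_less[of w p s t] w p sS t_def by simp
        then show False
          using assms(3)[rule_format, OF parabolic_mult[OF assms(1) t(1) assms(2)]] by simp
      qed
      moreover have "inv p \<otimes> t \<otimes> p = s" "w = p \<otimes> (inv p \<otimes> w)" "t \<otimes> p = p \<otimes> s"
        unfolding t_def using p w sS by (simp_all add: m_assoc)
      moreover have "\<not> inversion p t"
        using inversion_len_less[of p t] t p len calculation(4) by (auto simp: p_def)
      ultimately have "inversion (inv p \<otimes> w) s"
        using inversion_mult[of p "inv p \<otimes> w" t] p t w by simp
      then have "len (inv p \<otimes> w) = Suc (len (s \<otimes> (inv p \<otimes> w)))"
        using inversion_len_generator p w sS by simp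
      moreover have "inv (prd (x @ [s])) \<otimes> w = s \<otimes> (inv p \<otimes> w)"
        using sS p w by (simp add: prd_append inv_mult_group generator_inv m_assoc flip: p_def)
      ultimately show "len w = length (x @ [s]) + len (inv (prd (x @ [s])) \<otimes> w)"
        using snoc.IH red sJ by (simp add: p_def)
    qed
  qed
  then show ?thesis using x by simp
qed

text \<open>If all \<open>s \<in> J\<close> shorten \<open>v\<close>, write a longest element as \<open>z\<inverse> v\<close> with lengths adding; a last
  letter of \<open>z\<inverse>\<close> would lengthen \<open>v\<close> instead of shortening it, so \<open>z = 1\<close>. The other properties follow from uniqueness.\<close>

lemma longest_element:
  assumes "finite (carrier W)" "J \<subseteq> S"
  obtains w where "w \<in> parabolic J" "w \<otimes> w = \<one>"
    "\<And>v. v \<in> parabolic J \<Longrightarrow> (\<forall>s\<in>J. inversion v s) \<longleftrightarrow> v = w"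
    "\<And>s. s \<in> J \<Longrightarrow> w \<otimes> s \<otimes> w \<in> J"
proof -
  have "finite (parabolic J)" using assms parabolic_carrier finite_subset by (metis subsetI)
  then have fin: "finite (len ` parabolic J)" "len ` parabolic J \<noteq> {}" using parabolic_one by auto
  obtain w where w: "w \<in> parabolic J" "len w = Max (len ` parabolic J)"
    using Max_in[OF fin] by auto
  then have w: "w \<in> parabolic J" "\<forall>u\<in>parabolic J. len u \<le> len w"
    using Max_ge[OF fin(1)] by auto
  have wc: "w \<in> carrier W" using w parabolic_carrier assms by blast
  have w': "inv w \<in> parabolic J" "\<forall>u\<in>parabolic J. len u \<le> len (inv w)"
    using w wc assms parabolic_inv len_inv by auto
  have max_N: "inversion v s" if v: "v \<in> parabolic J" "\<forall>u\<in>parabolic J. len u \<le> len v" and s: "s \<in> J" for v s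
  proof (rule ccontr)
    assume "\<not> inversion v s"
    then have "len (s \<otimes> v) = Suc (len v)"
      using v s assms parabolic_carrier by (intro not_inversion_len_generator) auto
    moreover have "s \<otimes> v \<in> parabolic J" using v s assms parabolic_mult parabolic_generator by auto
    ultimately show False using v(2) by force
  qed
  have uniq: "v = w" if v: "v \<in> parabolic J" "\<forall>s\<in>J. inversion v s" for v
  proof -
    have vc: "v \<in> carrier W" using v parabolic_carrier assms by blast
    define z where "z = v \<otimes> inv w"
    have z: "z \<in> carrier W" "z \<in> parabolic J" "w = inv z \<otimes> v"
      using vc wc v w' assms parabolic_mult by (auto simp: z_def inv_mult_group m_assoc)
    have len_z: "len w = len v + len z"
      using longest_factor[OF assms(2) w' parabolic_inv[OF assms(2) v(1)]] vc wc
      by (simp add: len_inv z_def)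
    obtain x where x: "x \<in> lists J" "prd x = z" "length x = len z"
      using parabolic_reduced_word[OF assms(2) z(2)] by blast
    show ?thesis
    proof (cases x)
      case Nil
      then show ?thesis using x z vc by auto
    next
      case (Cons s y)
      have sy: "s \<in> J" "s \<in> S" "y \<in> lists S" using Cons x assms lists_subset by auto
      have yc: "prd y \<in> carrier W" using sy by simp
      have "w = inv (prd y) \<otimes> (s \<otimes> v)"
        unfolding z(3) x(2)[symmetric] Cons using sy vc yc
        by (simp add: inv_mult_group generator_inv m_assoc)
      then have "len w \<le> len (prd y) + len (s \<otimes> v)"
        using len_mult[of "inv (prd y)" "s \<otimes> v"] len_inv[of "prd y"] sy vc yc by simp
      moreover have "len v = Suc (len (s \<otimes> v))"
        using v sy vc inversion_len_generator by blast
      ultimately show ?thesis using len_z len_le[of y] sy x Cons by simp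
    qed
  qed
  have inv_w: "inv w = w" using uniq[OF w'(1)] max_N[OF w'] by blast
  have "w \<otimes> s \<otimes> w \<in> J" if s: "s \<in> J" for s
  proof -
    have sS: "s \<in> S" using s assms by auto
    have sw: "s \<otimes> w \<in> parabolic J" using s w assms parabolic_mult parabolic_generator by auto
    have "inv (s \<otimes> w) \<otimes> w = w \<otimes> s \<otimes> w"
      using sS wc by (simp add: inv_mult_group generator_inv inv_w)
    moreover have "len w = Suc (len (s \<otimes> w))"
      using max_N[OF w s] sS wc inversion_len_generator by blast
    ultimately have "len (w \<otimes> s \<otimes> w) = 1"
      using longest_factor[OF assms(2) w sw] by simp
    moreover have "w \<otimes> s \<otimes> w \<in> parabolic J" using s w assms parabolic_mult parabolic_generator by simp
    then obtain x where "x \<in> lists J" "prd x = w \<otimes> s \<otimes> w" "length x = len (w \<otimes> s \<otimes> w)"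
      using parabolic_reduced_word[OF assms(2)] by blast
    ultimately obtain r where "r \<in> J" "prd [r] = w \<otimes> s \<otimes> w"
      by (cases x) auto
    then show ?thesis using assms(2) by auto
  qed
  moreover have "w \<otimes> w = \<one>" using inv_w wc l_inv by metis
  ultimately show ?thesis using that[OF w(1)] uniq max_N[OF w] by blast
qed

end

section \<open>The symmetrizers of a Hecke module\<close>

lemma sum_fun_apply: "(\<Sum>a\<in>A. f a) w = (\<Sum>a\<in>A. f a w)"
  for f :: "'a \<Rightarrow> 'b \<Rightarrow> 'c :: comm_monoid_add"
  by (induction A rule: infinite_finite_induct) auto

text \<open>The operators \<open>T w\<close> are those of the canonical section; the quadratic relation is
  \<open>(T s - q) (T s + 1) = 0\<close>.\<close>

locale hecke_module = coxeter_group W S + vector_space scale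
  for W :: "('w, 'm) monoid_scheme" (structure) and S :: "'w set"
    and scale :: "complex \<Rightarrow> 'v \<Rightarrow> 'v :: ab_group_add" +
  fixes q :: complex and T :: "'w \<Rightarrow> 'v \<Rightarrow> 'v"
  assumes finite_W: "finite (carrier W)"
    and not_root_of_unity: "\<And>n::nat. n > 0 \<Longrightarrow> q ^ n \<noteq> 1"
    and T_linear: "w \<in> carrier W \<Longrightarrow> Vector_Spaces.linear scale scale (T w)"
    and T_one: "T \<one> v = v"
    and T_mult: "a \<in> carrier W \<Longrightarrow> b \<in> carrier W \<Longrightarrow> len (a \<otimes> b) = len a + len b \<Longrightarrow>
      T (a \<otimes> b) v = T a (T b v)"
    and T_quadratic: "s \<in> S \<Longrightarrow> T s (T s v) = scale (q - 1) (T s v) + scale q v"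
begin

lemma finite_parabolic: "J \<subseteq> S \<Longrightarrow> finite (parabolic J)"
  using parabolic_carrier finite_W by (meson finite_subset subsetI)

lemma finite_J: "J \<subseteq> S \<Longrightarrow> finite J"
  using generators_closed finite_W finite_subset by metis

lemma T_hom: "w \<in> carrier W \<Longrightarrow> module_hom scale scale (T w)"
  using T_linear by (simp add: module_hom_iff_linear)

lemma endomorphismI:
  "(\<And>x y. f (x + y) = f x + f y) \<Longrightarrow> (\<And>c x. f (scale c x) = scale c (f x)) \<Longrightarrow> module_hom scale scale f"
  by (intro module_hom.intro module_hom_axioms.intro module_axioms)

lemmas T_add = module_hom.add[OF T_hom]
  and T_diff = module_hom.diff[OF T_hom]
  and T_sum = module_hom.sum[OF T_hom]
  and T_scale = module_hom.scale[OF T_hom]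
  and T_zero = module_hom.zero[OF T_hom]
  and T_neg = module_hom.neg[OF T_hom]

definition families :: "('w \<Rightarrow> 'v) set" where
  "families = {x. \<forall>w. w \<notin> carrier W \<longrightarrow> x w = 0}"

text \<open>On \<open>V\<^sup>W\<close>, viewed as the tensor product of \<open>V\<close> with the group algebra of \<open>W\<close>, this is
  \<open>T u \<otimes> u\<close>.\<close>

definition act :: "'w \<Rightarrow> ('w \<Rightarrow> 'v) \<Rightarrow> 'w \<Rightarrow> 'v" where
  "act u x w = (if w \<in> carrier W then T u (x (inv u \<otimes> w)) else 0)"

definition symmetrizer :: "'w set \<Rightarrow> ('w \<Rightarrow> 'v) \<Rightarrow> 'w \<Rightarrow> 'v" where
  "symmetrizer J z = (\<Sum>u\<in>parabolic J. act u z)"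

text \<open>The conditions of \<open>K_space\<close> for \<open>s \<in> J\<close> only, but for families on all of \<open>W\<close>. So the
  induction on \<open>J\<close> stays within one group and one space of families.\<close>

definition K_parabolic :: "'w set \<Rightarrow> ('w \<Rightarrow> 'v) set" where
  "K_parabolic J = {x \<in> families. \<forall>s\<in>J. \<forall>w\<in>carrier W. \<exists>v. x (s \<otimes> w) - T s (x w) = T s (T s v) - v}"

lemma families_add: "x \<in> families \<Longrightarrow> y \<in> families \<Longrightarrow> x + y \<in> families"
  by (auto simp: families_def)

lemma symmetrizer_apply: "symmetrizer J z w = (if w \<in> carrier W then \<Sum>u\<in>parabolic J. T u (z (inv u \<otimes> w)) else 0)"
  by (simp add: symmetrizer_def sum_fun_apply act_def)

lemma symmetrizer_families: "symmetrizer J z \<in> families"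
  by (simp add: symmetrizer_apply families_def)

lemma act_add: "u \<in> carrier W \<Longrightarrow> act u (x + y) = act u x + act u y"
  and act_neg: "u \<in> carrier W \<Longrightarrow> act u (- x) = - act u x"
  and act_zero: "u \<in> carrier W \<Longrightarrow> act u 0 = 0"
  by (auto simp: act_def fun_eq_iff T_add T_neg T_zero)

lemma act_sum: "u \<in> carrier W \<Longrightarrow> act u (\<Sum>i\<in>I. x i) = (\<Sum>i\<in>I. act u (x i))"
  by (induction I rule: infinite_finite_induct) (auto simp: act_add act_zero)

lemma symmetrizer_add: "J \<subseteq> S \<Longrightarrow> symmetrizer J (x + y) = symmetrizer J x + symmetrizer J y"
  and symmetrizer_neg: "J \<subseteq> S \<Longrightarrow> symmetrizer J (- x) = - symmetrizer J x"
  and symmetrizer_zero: "J \<subseteq> S \<Longrightarrow> symmetrizer J 0 = 0"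
  unfolding symmetrizer_def using parabolic_carrier
  by (simp_all add: act_add act_neg act_zero sum.distrib sum_negf cong: sum.cong)

lemma act_mult:
  assumes "a \<in> carrier W" "b \<in> carrier W" "len (a \<otimes> b) = len a + len b"
  shows "act (a \<otimes> b) x = act a (act b x)"
  using assms by (auto simp: act_def fun_eq_iff T_mult inv_mult_group m_assoc)

lemma inversion_generator_iff:
  assumes "s \<in> S" "w \<in> carrier W"
  shows "inversion (s \<otimes> w) s \<longleftrightarrow> \<not> inversion w s"
  using inversion_mult[of s w s] inversion_generator[of s s] assms by (simp add: generator_inv generator_square)

lemma parabolic_pairing:
  fixes g :: "'w \<Rightarrow> 'a :: comm_monoid_add"
  assumes "J \<subseteq> S" "s \<in> J"
  defines "P \<equiv> {u \<in> parabolic J. \<not> inversion u s}"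
  shows "(\<Sum>u\<in>parabolic J. g u) = (\<Sum>u\<in>P. g u + g (s \<otimes> u))"
proof -
  have s: "s \<in> S" "s \<in> parabolic J" using assms parabolic_generator by auto
  have fin: "finite (parabolic J)" using assms finite_parabolic by simp
  have 1: "(\<Sum>u\<in>parabolic J. g u) = (\<Sum>u\<in>P. g u) + (\<Sum>u\<in>{u \<in> parabolic J. inversion u s}. g u)"
    unfolding P_def using fin by (subst sum.union_disjoint[symmetric]) (auto intro!: sum.cong)
  have "(\<Sum>u\<in>{u \<in> parabolic J. inversion u s}. g u) = (\<Sum>u\<in>P. g (s \<otimes> u))"
    using s assms(1) parabolic_carrier parabolic_mult[OF assms(1) s(2)] inversion_generator_iff[OF s(1)]
    by (intro sum.reindex_bij_witness[of _ "\<lambda>u. s \<otimes> u" "\<lambda>u. s \<otimes> u"]) (auto simp: P_def)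
  with 1 show ?thesis by (simp add: sum.distrib)
qed

lemma T_mult_generator:
  assumes "s \<in> S" "u \<in> carrier W" "\<not> inversion u s"
  shows "T (s \<otimes> u) v = T s (T u v)"
  using assms not_inversion_len_generator len_generator by (intro T_mult) auto

text \<open>Summing over the pairs \<open>u\<close>, \<open>s u\<close> with \<open>s u\<close> longer than \<open>u\<close>, the value of \<open>A\<^sub>J z\<close> at \<open>w\<close> is
  \<open>v' + s v\<close> and that at \<open>s w\<close> is \<open>v + s v'\<close>, with \<open>v\<close> and \<open>v'\<close> the contributions of the shorter
  elements \<open>u\<close>. Their defect is \<open>v - s\<^sup>2 v\<close>.\<close>

lemma symmetrizer_in_K:
  assumes J: "J \<subseteq> S"
  shows "symmetrizer J z \<in> K_parabolic J"
proof -
  have "\<exists>v. symmetrizer J z (s \<otimes> w) - T s (symmetrizer J z w) = T s (T s v) - v" if s: "s \<in> J" and w: "w \<in> carrier W" for s w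
  proof -
    define P where "P = {u \<in> parabolic J. \<not> inversion u s}"
    have sS: "s \<in> S" using s J by auto
    have P: "u \<in> carrier W" "\<not> inversion u s" if "u \<in> P" for u
      using that parabolic_carrier J by (auto simp: P_def)
    have pair: "symmetrizer J z x = (\<Sum>u\<in>P. T u (z (inv u \<otimes> x)) + T s (T u (z (inv u \<otimes> (s \<otimes> x)))))"
      if "x \<in> carrier W" for x
      using that sS P
      by (simp add: symmetrizer_apply parabolic_pairing[OF J s] flip: P_def)
        (intro sum.cong, auto simp: T_mult_generator inv_mult_group generator_inv m_assoc)
    define v where "v = (\<Sum>u\<in>P. T u (z (inv u \<otimes> (s \<otimes> w))))"
    define v' where "v' = (\<Sum>u\<in>P. T u (z (inv u \<otimes> w)))"
    have "symmetrizer J z (s \<otimes> w) = v + T s v'" "symmetrizer J z w = v' + T s v"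
      using pair sS w by (simp_all add: sum.distrib v_def v'_def T_sum)
    then have "symmetrizer J z (s \<otimes> w) - T s (symmetrizer J z w) = T s (T s (- v)) - (- v)"
      using sS by (simp add: T_add T_neg)
    then show ?thesis by blast
  qed
  then show ?thesis by (simp add: K_parabolic_def symmetrizer_families)
qed

lemma K_add:
  assumes J: "J \<subseteq> S" and "x \<in> K_parabolic J" "y \<in> K_parabolic J"
  shows "x + y \<in> K_parabolic J"
proof -
  have "\<exists>v. (x + y) (s \<otimes> w) - T s ((x + y) w) = T s (T s v) - v" if s: "s \<in> J" and w: "w \<in> carrier W" for s w
  proof -
    obtain a b where "x (s \<otimes> w) - T s (x w) = T s (T s a) - a" "y (s \<otimes> w) - T s (y w) = T s (T s b) - b"
      using assms s w unfolding K_parabolic_def by blast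
    moreover have sc: "s \<in> carrier W" using J s by auto
    ultimately have "(x (s \<otimes> w) - T s (x w)) + (y (s \<otimes> w) - T s (y w)) = T s (T s (a + b)) - (a + b)"
      by (simp add: T_add)
    moreover have "(x + y) (s \<otimes> w) - T s ((x + y) w) = (x (s \<otimes> w) - T s (x w)) + (y (s \<otimes> w) - T s (y w))"
      using sc by (simp add: T_add)
    ultimately have "(x + y) (s \<otimes> w) - T s ((x + y) w) = T s (T s (a + b)) - (a + b)" by metis
    then show ?thesis by blast
  qed
  then show ?thesis using assms families_add by (simp add: K_parabolic_def)
qed

lemma K_endo:
  assumes J: "J \<subseteq> S" and x: "x \<in> K_parabolic J" and f: "module_hom scale scale f"
    and comm: "\<And>s v. s \<in> J \<Longrightarrow> f (T s v) = T s (f v)"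
  shows "(\<lambda>w. f (x w)) \<in> K_parabolic J"
proof -
  have "\<exists>v. f (x (s \<otimes> w)) - T s (f (x w)) = T s (T s v) - v" if s: "s \<in> J" and w: "w \<in> carrier W" for s w
  proof -
    obtain a where "x (s \<otimes> w) - T s (x w) = T s (T s a) - a"
      using assms s w unfolding K_parabolic_def by blast
    from arg_cong[OF this, of f] show ?thesis
      using comm[OF s] by (auto simp: module_hom.diff[OF f])
  qed
  then show ?thesis using x module_hom.zero[OF f] by (simp add: K_parabolic_def families_def)
qed

definition coset_reps :: "'w set \<Rightarrow> 'w set \<Rightarrow> 'w set" where
  "coset_reps J I = {u \<in> parabolic J. \<forall>s\<in>I. \<not> inversion (inv u) s}"

text \<open>Every element of \<open>W\<^sub>J\<close> is uniquely \<open>u v\<close> with \<open>u\<close> a shortest representative of its coset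
  \<open>u W\<^sub>I\<close> and \<open>v \<in> W\<^sub>I\<close>, and the lengths add. Coset decompositions were made for right cosets,
  whence the inverses.\<close>

lemma symmetrizer_factor:
  assumes J: "J \<subseteq> S" and I: "I \<subseteq> J"
  shows "symmetrizer J z = (\<Sum>u\<in>coset_reps J I. act u (symmetrizer I z))"
proof -
  have IS: "I \<subseteq> S" using I J by auto
  have sub: "parabolic I \<subseteq> parabolic J" using parabolic_mono I by blast
  have rc: "u \<in> carrier W" "left_minimal I (inv u)" if "u \<in> coset_reps J I" for u
    using that parabolic_carrier[OF J] left_minimal_iff[OF IS] by (auto simp: coset_reps_def)
  have len: "len (u \<otimes> v) = len u + len v" if "u \<in> coset_reps J I" "v \<in> parabolic I" for u v
  proof -
    have c: "u \<in> carrier W" "v \<in> carrier W" using rc that parabolic_carrier[OF IS] by auto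
    have "len (inv v \<otimes> inv u) = len (inv v) + len (inv u)"
      by (rule parabolic_len_add[OF IS parabolic_inv[OF IS that(2)] rc(2)[OF that(1)]])
    then show ?thesis using c len_inv[of "u \<otimes> v"] len_inv[of u] len_inv[of v]
      by (simp add: inv_mult_group)
  qed
  have unique: "u = u' \<and> v = v'"
    if h: "u \<in> coset_reps J I" "v \<in> parabolic I" "u' \<in> coset_reps J I" "v' \<in> parabolic I" "u \<otimes> v = u' \<otimes> v'" for u v u' v'
  proof -
    have c: "u \<in> carrier W" "v \<in> carrier W" "u' \<in> carrier W" "v' \<in> carrier W"
      using h rc parabolic_carrier[OF IS] by auto
    define d where "d = v' \<otimes> inv v"
    have d: "d \<in> parabolic I" "inv d \<in> parabolic I" "d \<in> carrier W"
      using h parabolic_mult[OF IS] parabolic_inv[OF IS] c by (auto simp: d_def)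
    have "u = (u \<otimes> v) \<otimes> inv v" using c by (simp add: m_assoc)
    then have u: "u = u' \<otimes> d" unfolding h(5) using c by (simp add: m_assoc d_def)
    then have u': "u' = u \<otimes> inv d" using c d by (simp add: m_assoc)
    have "len u = len u' + len d" "len u' = len u + len (inv d)"
      using len[OF h(3) d(1)] len[OF h(1) d(2)] unfolding u[symmetric] u'[symmetric] by simp_all
    then have "d = \<one>" using len_eq_0[OF d(3)] by simp
    then show "u = u' \<and> v = v'" using u c h(5) by simp
  qed
  then have inj: "inj_on (\<lambda>(u, v). u \<otimes> v) (coset_reps J I \<times> parabolic I)"
    unfolding inj_on_def by auto
  have img: "(\<lambda>(u, v). u \<otimes> v) ` (coset_reps J I \<times> parabolic I) = parabolic J"
  proof (intro equalityI subsetI)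
    fix w assume "w \<in> (\<lambda>(u, v). u \<otimes> v) ` (coset_reps J I \<times> parabolic I)"
    then show "w \<in> parabolic J" using parabolic_mult[OF J] sub by (auto simp: coset_reps_def)
  next
    fix w assume w: "w \<in> parabolic J"
    have wc: "w \<in> carrier W" using w parabolic_carrier[OF J] by simp
    obtain a b where ab: "a \<in> parabolic I" "left_minimal I b" "inv w = a \<otimes> b"
      using coset_decomposition[OF IS, of "inv w"] wc by auto
    have c: "a \<in> carrier W" "b \<in> carrier W" using ab parabolic_carrier[OF IS] by (auto simp: left_minimal_def)
    have "w = inv b \<otimes> inv a" using arg_cong[OF ab(3), of "m_inv W"] wc c by (simp add: inv_mult_group)
    moreover have "inv a \<in> parabolic I" using parabolic_inv[OF IS ab(1)] .
    moreover have "b = inv a \<otimes> inv w" using ab(3) c by simp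
    then have "b \<in> parabolic J" using parabolic_mult[OF J] parabolic_inv[OF J] w ab(1) sub by auto
    then have "inv b \<in> coset_reps J I"
      using parabolic_inv[OF J] left_minimal_iff[OF IS c(2)] ab(2) c by (auto simp: coset_reps_def)
    ultimately show "w \<in> (\<lambda>(u, v). u \<otimes> v) ` (coset_reps J I \<times> parabolic I)" by auto
  qed
  have "symmetrizer J z = (\<Sum>(u, v)\<in>coset_reps J I \<times> parabolic I. act (u \<otimes> v) z)"
    unfolding symmetrizer_def img[symmetric] by (subst sum.reindex[OF inj]) (simp add: case_prod_beta comp_def)
  also have "\<dots> = (\<Sum>u\<in>coset_reps J I. \<Sum>v\<in>parabolic I. act u (act v z))"
    unfolding sum.cartesian_product[symmetric]
    using len rc parabolic_carrier[OF IS] by (intro sum.cong refl) (simp add: act_mult)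
  also have "\<dots> = (\<Sum>u\<in>coset_reps J I. act u (symmetrizer I z))"
    unfolding symmetrizer_def using rc by (intro sum.cong refl) (simp add: act_sum)
  finally show ?thesis .
qed

section \<open>The alternating sum over parabolic subgroups\<close>

definition signed :: "'a set \<Rightarrow> 'b :: ab_group_add \<Rightarrow> 'b" where
  "signed I X = (if even (card I) then X else - X)"

lemma sum_signed_Pow:
  assumes "finite F"
  shows "(\<Sum>I\<in>Pow F. signed I X) = (if F = {} then X else 0)"
proof (cases "F = {}")
  case False
  then obtain a F' where F: "F = insert a F'" "a \<notin> F'" by (metis Set.set_insert ex_in_conv)
  have fin: "finite F'" using F assms by simp
  have "(\<Sum>I\<in>Pow F. signed I X) = (\<Sum>I\<in>Pow F'. signed I X) + (\<Sum>I\<in>insert a ` Pow F'. signed I X)"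
    unfolding F(1) Pow_insert using F fin by (intro sum.union_disjoint) auto
  also have "(\<Sum>I\<in>insert a ` Pow F'. signed I X) = (\<Sum>I\<in>Pow F'. signed (insert a I) X)"
    using F by (subst sum.reindex) (auto simp: inj_on_def)
  also have "\<dots> = (\<Sum>I\<in>Pow F'. - signed I X)"
  proof (intro sum.cong refl)
    fix I assume "I \<in> Pow F'"
    then have "finite I" "a \<notin> I" using F fin finite_subset by auto
    then show "signed (insert a I) X = - signed I X" by (simp add: signed_def)
  qed
  finally show ?thesis using False by (simp add: sum_negf)
qed (simp add: signed_def)

text \<open>An element \<open>u\<close> is a representative for \<open>I\<close> exactly when \<open>I\<close> lies in the set \<open>F u\<close> of those
  \<open>s \<in> J\<close> that do not shorten \<open>u\<close> from the right. So after exchanging the sums the coefficient of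
  \<open>act u x\<close> is the alternating sum over the subsets of \<open>F u\<close>. It vanishes unless \<open>F u\<close> is empty,
  that is, unless \<open>u\<close> is the longest element.\<close>

lemma alternating_sum_coset_reps:
  assumes J: "J \<subseteq> S" and w: "w \<in> parabolic J" "w \<otimes> w = \<one>"
    and uniq: "\<And>v. v \<in> parabolic J \<Longrightarrow> (\<forall>s\<in>J. inversion v s) \<longleftrightarrow> v = w"
  shows "(\<Sum>I\<in>Pow J. signed I (\<Sum>u\<in>coset_reps J I. act u x)) = act w x"
proof -
  define F where "F u = {s \<in> J. \<not> inversion (inv u) s}" for u
  have fin: "finite (parabolic J)" "finite (Pow J)" "finite (F u)" for u
    using finite_parabolic[OF J] finite_J[OF J] by (auto simp: F_def)
  have coset_reps: "coset_reps J I = {u \<in> parabolic J. I \<subseteq> F u}" if "I \<in> Pow J" for I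
    using that by (auto simp: coset_reps_def F_def)
  have neg_sum: "signed I (sum g B) = (\<Sum>b\<in>B. signed I (g b))" for I :: "'w set" and g :: "'w \<Rightarrow> 'w \<Rightarrow> 'v" and B
    by (simp add: signed_def sum_negf)
  have wc: "w \<in> carrier W" using w parabolic_carrier[OF J] by simp
  have inv_w: "inv w = w" using w wc by (simp add: inv_equality)
  have F_empty: "F u = {} \<longleftrightarrow> u = w" if "u \<in> parabolic J" for u
  proof -
    have "F u = {} \<longleftrightarrow> inv u = w"
      using uniq[OF parabolic_inv[OF J that]] by (auto simp: F_def)
    also have "\<dots> \<longleftrightarrow> u = w"
      using inv_w parabolic_carrier[OF J that] wc by (metis inv_inv)
    finally show ?thesis .
  qed
  have "(\<Sum>I\<in>Pow J. signed I (\<Sum>u\<in>coset_reps J I. act u x)) =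
      (\<Sum>I\<in>Pow J. \<Sum>u\<in>parabolic J. if I \<subseteq> F u then signed I (act u x) else 0)"
    by (intro sum.cong refl) (simp only: coset_reps neg_sum sum.inter_filter[OF fin(1), symmetric])
  also have "\<dots> = (\<Sum>u\<in>parabolic J. \<Sum>I\<in>Pow J. if I \<subseteq> F u then signed I (act u x) else 0)"
    by (rule sum.swap)
  also have "\<dots> = (\<Sum>u\<in>parabolic J. \<Sum>I\<in>Pow (F u). signed I (act u x))"
  proof (rule sum.cong[OF refl])
    fix u
    have "{I \<in> Pow J. I \<subseteq> F u} = Pow (F u)" by (auto simp: F_def)
    then show "(\<Sum>I\<in>Pow J. if I \<subseteq> F u then signed I (act u x) else 0) =
        (\<Sum>I\<in>Pow (F u). signed I (act u x))"
      by (simp only: sum.inter_filter[OF fin(2), symmetric])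
  qed
  also have "\<dots> = (\<Sum>u\<in>parabolic J. if u = w then act u x else 0)"
    using fin(3) F_empty by (intro sum.cong refl) (simp add: sum_signed_Pow)
  also have "\<dots> = act w x" using fin(1) w(1) by simp
  finally show ?thesis .
qed

text \<open>Induction along a reduced word, in which every step increases the length, so that \<open>T\<close> is
  multiplicative along it.\<close>

lemma parabolic_induct [consumes 2, case_names one step]:
  assumes J: "J \<subseteq> S" and u: "u \<in> parabolic J" and one: "P \<one>"
    and step: "\<And>s u. s \<in> J \<Longrightarrow> u \<in> parabolic J \<Longrightarrow> \<not> inversion u s \<Longrightarrow> P u \<Longrightarrow> P (s \<otimes> u)"
  shows "P u"
proof -
  obtain x where x: "x \<in> lists J" "prd x = u" "length x = len u"
    using parabolic_reduced_word[OF J u] by blast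
  have "P (prd x)" if "reduced x" using x(1) that
  proof (induction x)
    case (Cons s x)
    have sx: "s \<in> S" "reduced x" "x \<in> lists S" using reduced_Cons[OF Cons.prems] by (auto simp: reduced_def)
    have "inversion (s \<otimes> prd x) s" using reduced_Cons_inversion[OF Cons.prems] by simp
    then have "\<not> inversion (prd x) s" using inversion_generator_iff[of s "prd x"] sx by simp
    then show ?case using step[of s "prd x"] Cons sx parabolicI by simp
  qed (simp add: one)
  moreover have "reduced x" using x lists_subset[OF J] by (simp add: reduced_def)
  ultimately show ?thesis using x by simp
qed

text \<open>The span of the \<open>T u\<close> with \<open>u \<in> W\<^sub>J\<close> is stable under left multiplication by \<open>T s\<close>. This yields
  at once finite-dimensional submodules of \<open>V\<close> and a polynomial equation for the full twist.\<close>

lemma T_generator_T: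
  assumes J: "J \<subseteq> S" and s: "s \<in> J" and u: "u \<in> parabolic J"
  obtains c d where "\<And>v. T s (T u v) = scale c (T u v) + scale d (T (s \<otimes> u) v)"
proof (cases "inversion u s")
  case False
  then show ?thesis
    using that[of 0 1] T_mult_generator[of s u] s J parabolic_carrier[OF J u] by auto
next
  case True
  have c: "s \<in> S" "u \<in> carrier W" using s J parabolic_carrier[OF J u] by auto
  have "\<not> inversion (s \<otimes> u) s" using True inversion_generator_iff c by simp
  then have "T u v = T s (T (s \<otimes> u) v)" for v
    using T_mult_generator[of s "s \<otimes> u" v] c by simp
  then show ?thesis using that[of "q - 1" q] T_quadratic c by simp
qed

lemma minus_one_action:
  assumes J: "J \<subseteq> S" and u: "u \<in> parabolic J" and v: "\<And>s. s \<in> J \<Longrightarrow> T s v = - v"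
  shows "\<exists>c. c * c = 1 \<and> T u v = scale c v"
  using J u
proof (induction rule: parabolic_induct)
  case one
  then show ?case by (intro exI[of _ 1]) (simp add: T_one)
next
  case (step s u)
  then obtain c where c: "c * c = 1" "T u v = scale c v" by blast
  have "s \<in> S" "u \<in> carrier W" using step J parabolic_carrier by auto
  then have "T (s \<otimes> u) v = scale (- c) v"
    using c v[OF step(1)] step by (simp add: T_mult_generator T_scale)
  then show ?case using c(1) by (intro exI[of _ "- c"]) simp
qed

lemma K_mono: "I \<subseteq> J \<Longrightarrow> K_parabolic J \<subseteq> K_parabolic I"
  by (auto simp: K_parabolic_def)

end

section \<open>The full twist\<close>

text \<open>The hypotheses on \<open>w\<^sub>J\<close> are the conclusions of \<open>longest_element\<close>.\<close>

locale longest = hecke_module W S scale q T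
  for W :: "('w, 'm) monoid_scheme" (structure) and S :: "'w set"
    and scale :: "complex \<Rightarrow> 'v \<Rightarrow> 'v :: ab_group_add" and q T +
  fixes J :: "'w set" and w\<^sub>J :: 'w
  assumes J: "J \<subseteq> S" and w: "w\<^sub>J \<in> parabolic J" and w_square: "w\<^sub>J \<otimes> w\<^sub>J = \<one>"
    and w_unique: "\<And>v. v \<in> parabolic J \<Longrightarrow> (\<forall>s\<in>J. inversion v s) \<longleftrightarrow> v = w\<^sub>J"
    and w_conj: "\<And>s. s \<in> J \<Longrightarrow> w\<^sub>J \<otimes> s \<otimes> w\<^sub>J \<in> J"
begin

lemma w_closed [simp]: "w\<^sub>J \<in> carrier W"
  using w parabolic_carrier[OF J] by simp

lemma J_S: "s \<in> J \<Longrightarrow> s \<in> S"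
  using J by auto

lemma inversion_w: "s \<in> J \<Longrightarrow> inversion w\<^sub>J s"
  using w_unique[OF w] by simp

lemma w_w_cancel: "x \<in> carrier W \<Longrightarrow> w\<^sub>J \<otimes> (w\<^sub>J \<otimes> x) = x"
  using w_square by (simp flip: m_assoc)

lemma T_w_factor:
  assumes "s \<in> J"
  shows "T w\<^sub>J v = T s (T (s \<otimes> w\<^sub>J) v)" "T w\<^sub>J v = T (w\<^sub>J \<otimes> s) (T s v)"
proof -
  have s: "s \<in> S" using assms J_S by simp
  have "len w\<^sub>J = Suc (len (s \<otimes> w\<^sub>J))" using inversion_w[OF assms] s inversion_len_generator by simp
  then show "T w\<^sub>J v = T s (T (s \<otimes> w\<^sub>J) v)"
    using T_mult[of s "s \<otimes> w\<^sub>J" v] s len_generator by simp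
  have inv_w: "inv w\<^sub>J = w\<^sub>J" using w_square by (simp add: inv_equality)
  have "len (w\<^sub>J \<otimes> s) = len (s \<otimes> w\<^sub>J)"
    using len_inv[of "s \<otimes> w\<^sub>J"] s by (simp add: inv_mult_group generator_inv inv_w)
  with \<open>len w\<^sub>J = Suc _\<close> show "T w\<^sub>J v = T (w\<^sub>J \<otimes> s) (T s v)"
    using T_mult[of "w\<^sub>J \<otimes> s" s v] s len_generator by (simp add: m_assoc generator_square)
qed

text \<open>With \<open>s' = w\<^sub>J s w\<^sub>J\<close>, the operator \<open>T w\<^sub>J\<close> factors as \<open>T s' T(s' w\<^sub>J)\<close> and as
  \<open>T(w\<^sub>J s) T s\<close>, and \<open>s' w\<^sub>J = w\<^sub>J s\<close>.\<close>

lemma T_w_T: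
  assumes "s \<in> J"
  shows "T w\<^sub>J (T s v) = T (w\<^sub>J \<otimes> s \<otimes> w\<^sub>J) (T w\<^sub>J v)"
proof -
  have s: "s \<in> S" using assms J_S by simp
  have "(w\<^sub>J \<otimes> s \<otimes> w\<^sub>J) \<otimes> w\<^sub>J = w\<^sub>J \<otimes> s"
    using s w_square by (simp add: m_assoc)
  then show ?thesis
    using T_w_factor(1)[OF w_conj[OF assms], of "T s v"] T_w_factor(2)[OF assms, of v] by simp
qed

definition full_twist :: "'v \<Rightarrow> 'v" where "full_twist v = T w\<^sub>J (T w\<^sub>J v)"

definition twist_defect :: "'v \<Rightarrow> 'v" where "twist_defect v = full_twist v - v"

lemma full_twist_hom: "module_hom scale scale full_twist"
  using module_hom_compose[OF T_hom T_hom, of w\<^sub>J w\<^sub>J] by (simp add: full_twist_def[abs_def] comp_def)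

lemma twist_defect_hom: "module_hom scale scale twist_defect"
  by (intro endomorphismI)
    (simp_all add: twist_defect_def module_hom.add[OF full_twist_hom] module_hom.scale[OF full_twist_hom]
      scale_right_diff_distrib)

lemma full_twist_T_generator:
  assumes "s \<in> J"
  shows "full_twist (T s v) = T s (full_twist v)"
proof -
  have "w\<^sub>J \<otimes> (w\<^sub>J \<otimes> s \<otimes> w\<^sub>J) \<otimes> w\<^sub>J = s"
    using J_S[OF assms] w_square by (simp add: m_assoc w_w_cancel)
  then show ?thesis
    using T_w_T[OF assms] T_w_T[OF w_conj[OF assms]] by (simp add: full_twist_def)
qed

lemma twist_defect_T_generator:
  "s \<in> J \<Longrightarrow> twist_defect (T s v) = T s (twist_defect v)"
  using J_S by (simp add: twist_defect_def full_twist_T_generator T_diff)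

lemma twist_defect_T:
  assumes "u \<in> parabolic J"
  shows "twist_defect (T u v) = T u (twist_defect v)"
  using J assms
proof (induction rule: parabolic_induct)
  case one
  then show ?case by (simp add: T_one)
next
  case (step s u)
  then show ?case using J_S parabolic_carrier[OF J] by (simp add: T_mult_generator twist_defect_T_generator)
qed

text \<open>This is where \<open>q\<close> must not be a root of unity. On the finite-dimensional module \<open>E\<close> generated
  by \<open>v\<close> the full twist is unipotent and has determinant \<open>1\<close>. The determinant of each \<open>T r\<close> is
  \<open>\<plusminus>q\<^sup>i\<close>, where \<open>i = 0\<close> forces \<open>T r = -1\<close>. As \<open>w\<^sub>J\<close> has a reduced word that starts with the given
  \<open>s\<close>, the determinant of the full twist is \<open>q\<close> to twice a sum of exponents that include the one
  of \<open>T s\<close>; all of them must vanish.\<close>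

lemma unipotent_twist_minus_one:
  assumes "twist_defect (twist_defect v) = 0" "s \<in> J"
  shows "T s v = - v"
proof -
  define A where "A = (\<lambda>u. T u v) ` parabolic J"
  define E where "E = span A"
  have fA: "finite A" using finite_parabolic[OF J] by (simp add: A_def)
  have genE: "T u v \<in> E" if "u \<in> parabolic J" for u
    using that span_base by (auto simp: E_def A_def)
  have subspE: "subspace E" by (simp add: E_def subspace_span)
  have stable_gen: "stable_endo scale E (T r)" if r: "r \<in> J" for r
  proof -
    have rc: "r \<in> carrier W" "r \<in> parabolic J" using J_S r parabolic_generator[OF J] by auto
    have "T r ` A \<subseteq> E"
    proof (clarsimp simp: A_def)
      fix u assume u: "u \<in> parabolic J"
      obtain c d where "T r (T u v) = scale c (T u v) + scale d (T (r \<otimes> u) v)"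
        using T_generator_T[OF J r u] by metis
      then show "T r (T u v) \<in> E"
        using genE u parabolic_mult[OF J rc(2) u] subspE by (simp add: subspace_add subspace_scale)
    qed
    then have "T r ` E \<subseteq> E"
      unfolding E_def using module_hom.span_image[OF T_hom[OF rc(1)], of A] span_minimal[OF _ subspace_span] by metis
    then show ?thesis using T_linear rc by (simp add: stable_endo_def)
  qed
  have T_step: "T (r \<otimes> u) = T r \<circ> T u" if "r \<in> J" "u \<in> parabolic J" "\<not> inversion u r" for r u
    using that J_S parabolic_carrier[OF J] by (auto simp: T_mult_generator)
  have stable: "stable_endo scale E (T u)" if "u \<in> parabolic J" for u
    using J that
  proof (induction rule: parabolic_induct)
    case one
    have "T \<one> = (\<lambda>v. v)" by (auto simp: T_one)
    then show ?case using T_linear[of \<one>] by (simp add: stable_endo_def)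
  next
    case (step r u)
    have ru: "r \<in> S" "u \<in> carrier W" using step J_S parabolic_carrier[OF J] by auto
    then have "T (r \<otimes> u) ` E \<subseteq> E"
      using step stable_gen[of r] by (auto simp: stable_endo_def T_mult_generator image_subset_iff)
    then show ?case using T_linear[of "r \<otimes> u"] ru by (simp add: stable_endo_def)
  qed
  obtain \<delta> where \<delta>: "\<delta> id = 1"
    "\<And>f g. stable_endo scale E f \<Longrightarrow> stable_endo scale E g \<Longrightarrow> \<delta> (f \<circ> g) = \<delta> f * \<delta> g"
    "\<And>f a b. stable_endo scale E f \<Longrightarrow>
      (\<And>v. v \<in> E \<Longrightarrow> f (f v) = scale (a + b) (f v) - scale (a * b) v) \<Longrightarrow>
      \<exists>i j. \<delta> f = a ^ i * b ^ j \<and> (i = 0 \<longrightarrow> (\<forall>v\<in>E. f v = scale b v))"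
    using restricted_determinant[OF vector_space_axioms fA E_def] by blast
  have \<delta>_gen: "\<exists>i j. \<delta> (T r) = q ^ i * (- 1) ^ j \<and> (i = 0 \<longrightarrow> (\<forall>v\<in>E. T r v = scale (- 1) v))" if "r \<in> J" for r
    using that J_S T_quadratic by (intro \<delta>(3)[OF stable_gen]) auto
  have \<delta>_T: "\<exists>e k. \<delta> (T u) = (- 1) ^ e * q ^ k" if "u \<in> parabolic J" for u
    using J that
  proof (induction rule: parabolic_induct)
    case one
    have "T \<one> = id" by (auto simp: T_one)
    then show ?case using \<delta>(1) by (metis mult_1 power_0)
  next
    case (step r u)
    obtain e k where 1: "\<delta> (T u) = (- 1) ^ e * q ^ k" using step by blast
    obtain i j where 2: "\<delta> (T r) = q ^ i * (- 1) ^ j" using \<delta>_gen step by blast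
    have "\<delta> (T (r \<otimes> u)) = (- 1) ^ (j + e) * q ^ (i + k)"
      using \<delta>(2)[OF stable_gen stable, of r u] step T_step 1 2 by (simp add: power_add)
    then show ?case by blast
  qed
  have twist: "full_twist = T w\<^sub>J \<circ> T w\<^sub>J" by (auto simp: full_twist_def)
  have stable_twist: "stable_endo scale E full_twist"
    using stable[OF w] full_twist_hom by (auto simp: stable_endo_def twist module_hom_iff_linear)
  have defect_E: "twist_defect (twist_defect x) = 0" if "x \<in> E" for x
  proof -
    have "subspace {x. twist_defect (twist_defect x) = 0}"
      by (rule subspaceI) (simp_all add: module_hom.add[OF twist_defect_hom] module_hom.scale[OF twist_defect_hom] module_hom.zero[OF twist_defect_hom])
    moreover have "A \<subseteq> {x. twist_defect (twist_defect x) = 0}"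
      using assms(1) parabolic_carrier[OF J] by (auto simp: A_def twist_defect_T T_zero)
    ultimately show ?thesis using that span_minimal unfolding E_def by blast
  qed
  have "\<delta> full_twist = 1"
  proof -
    have "full_twist (full_twist x) = scale (1 + 1) (full_twist x) - scale (1 * 1) x" if "x \<in> E" for x
      using defect_E[OF that]
      unfolding scale_left_distrib mult_1 scale_one
      by (simp add: twist_defect_def module_hom.diff[OF full_twist_hom] algebra_simps)
    from \<delta>(3)[OF stable_twist this] show ?thesis by auto
  qed
  then have one: "\<delta> (T w\<^sub>J) * \<delta> (T w\<^sub>J) = 1" using \<delta>(2)[OF stable[OF w] stable[OF w]] twist by simp
  have s: "s \<in> S" "s \<in> parabolic J" using J_S assms(2) parabolic_generator[OF J] by auto
  have sw: "s \<otimes> w\<^sub>J \<in> parabolic J" using parabolic_mult[OF J s(2) w] .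
  have "T w\<^sub>J = T s \<circ> T (s \<otimes> w\<^sub>J)" using T_w_factor(1)[OF assms(2)] by auto
  then have prod: "\<delta> (T w\<^sub>J) = \<delta> (T s) * \<delta> (T (s \<otimes> w\<^sub>J))"
    using \<delta>(2)[OF stable_gen[OF assms(2)] stable[OF sw]] by simp
  obtain i j where ij: "\<delta> (T s) = q ^ i * (- 1) ^ j" "i = 0 \<longrightarrow> (\<forall>v\<in>E. T s v = scale (- 1) v)"
    using \<delta>_gen[OF assms(2)] by blast
  obtain e k where ek: "\<delta> (T (s \<otimes> w\<^sub>J)) = (- 1) ^ e * q ^ k" using \<delta>_T[OF sw] by blast
  have "\<delta> (T w\<^sub>J) * \<delta> (T w\<^sub>J) = ((- 1) ^ j * (- 1) ^ j) * ((- 1) ^ e * (- 1) ^ e) * q ^ ((i + k) + (i + k))"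
    unfolding prod ij(1) ek by (simp add: power_add ac_simps)
  also have "\<dots> = q ^ ((i + k) + (i + k))"
    by (simp only: power_mult_distrib[symmetric]) simp
  finally have "q ^ ((i + k) + (i + k)) = 1" using one by simp
  then have "i = 0" using not_root_of_unity[of "(i + k) + (i + k)"] by (cases "i = 0") auto
  moreover have "v \<in> E" using genE[OF parabolic_one] by (simp add: T_one)
  ultimately show ?thesis using ij(2) by simp
qed

lemma coset_reps_self: "coset_reps J J = {\<one>}"
proof -
  have "u = \<one>" if "u \<in> coset_reps J J" for u
  proof -
    have u: "u \<in> parabolic J" "u \<in> carrier W" "left_minimal J (inv u)"
      using that parabolic_carrier[OF J] left_minimal_iff[OF J] by (auto simp: coset_reps_def)
    then have "len \<one> = len u + len (inv u)"
      using parabolic_len_add[OF J u(1,3)] by simp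
    then show ?thesis using len_eq_0[OF u(2)] by simp
  qed
  moreover have "\<one> \<in> coset_reps J J"
    using parabolic_one J_S inversion_one by (auto simp: coset_reps_def)
  ultimately show ?thesis by blast
qed

lemma signed_symmetrizer: "signed I (symmetrizer J z) = symmetrizer J (signed I z)"
  by (simp add: signed_def symmetrizer_neg[OF J])

lemma symmetrizer_sum: "symmetrizer J (\<Sum>i\<in>I. z i) = (\<Sum>i\<in>I. symmetrizer J (z i))"
  by (induction I rule: infinite_finite_induct)
    (simp_all only: sum.infinite sum.empty sum.insert symmetrizer_add[OF J] symmetrizer_zero[OF J] not_False_eq_True)

section \<open>The induction over parabolic subgroups\<close>

text \<open>In the alternating sum the terms for proper subsets \<open>I\<close> lie in \<open>im A\<^sub>J\<close>, by the hypothesis on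
  \<open>I\<close> and the factorization of \<open>A\<^sub>J\<close>. The term for \<open>J\<close> itself is \<open>\<plusminus>x\<close>, because \<open>1\<close> is the only
  representative.\<close>

lemma act_longest:
  assumes IH: "\<And>I. I \<subset> J \<Longrightarrow> K_parabolic I \<subseteq> range (symmetrizer I)" and x: "x \<in> K_parabolic J"
  shows "\<exists>z. act w\<^sub>J x = signed J x + symmetrizer J z"
proof -
  have "\<exists>z. x = symmetrizer I z" if "I \<subset> J" for I
    using IH[OF that] K_mono[of I J] x that by blast
  then obtain z where z: "\<And>I. I \<subset> J \<Longrightarrow> x = symmetrizer I (z I)" by metis
  have part: "(\<Sum>u\<in>coset_reps J I. act u x) = symmetrizer J (z I)" if "I \<subset> J" for I
    unfolding symmetrizer_factor[OF J, of I "z I", OF psubset_imp_subset[OF that]]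
    by (rule sum.cong[OF refl]) (subst (1) z[OF that], rule refl)
  have one: "act \<one> x = x"
    using x by (auto simp: act_def fun_eq_iff T_one K_parabolic_def families_def)
  have "act w\<^sub>J x = (\<Sum>I\<in>Pow J. signed I (\<Sum>u\<in>coset_reps J I. act u x))"
    using alternating_sum_coset_reps[OF J w w_square w_unique] by simp
  also have "\<dots> = signed J (\<Sum>u\<in>coset_reps J J. act u x) + (\<Sum>I\<in>Pow J - {J}. signed I (\<Sum>u\<in>coset_reps J I. act u x))"
    using finite_J[OF J] by (intro sum.remove) auto
  also have "(\<Sum>I\<in>Pow J - {J}. signed I (\<Sum>u\<in>coset_reps J I. act u x)) = (\<Sum>I\<in>Pow J - {J}. signed I (symmetrizer J (z I)))"
    by (intro sum.cong refl) (simp add: part psubset_eq)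
  also have "\<dots> = symmetrizer J (\<Sum>I\<in>Pow J - {J}. signed I (z I))"
    by (simp add: symmetrizer_sum signed_symmetrizer)
  finally show ?thesis
    unfolding coset_reps_self by (intro exI[of _ "\<Sum>I\<in>Pow J - {J}. signed I (z I)"]) (simp only: sum.insert finite.emptyI empty_iff not_False_eq_True sum.empty one add_0_right)
qed

text \<open>Since \<open>w\<^sub>J\<close> is an involution, applying \<open>act w\<^sub>J\<close> twice applies the full twist to every value
  of the family. The previous lemma can be used twice because \<open>act w\<^sub>J x\<close> is again in \<open>K\<^sub>J\<close>, and
  the signs cancel.\<close>

lemma twist_defect_K:
  assumes IH: "\<And>I. I \<subset> J \<Longrightarrow> K_parabolic I \<subseteq> range (symmetrizer I)" and x: "x \<in> K_parabolic J"
  shows "\<exists>z. (\<lambda>w. twist_defect (x w)) = symmetrizer J z"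
proof -
  obtain z where z: "act w\<^sub>J x = signed J x + symmetrizer J z" using act_longest[OF IH x] by blast
  have "- x = (\<lambda>w. - x w)" by auto
  then have "- x \<in> K_parabolic J"
    using K_endo[OF J x endomorphismI[of uminus]] J_S by (simp add: T_neg)
  then have "act w\<^sub>J x \<in> K_parabolic J"
    unfolding z using x by (intro K_add[OF J] symmetrizer_in_K[OF J]) (simp add: signed_def)
  then obtain z' where z': "act w\<^sub>J (act w\<^sub>J x) = signed J (act w\<^sub>J x) + symmetrizer J z'"
    using act_longest[OF IH] by blast
  have inv_w: "inv w\<^sub>J = w\<^sub>J" using w_square by (simp add: inv_equality)
  have "(\<lambda>w. twist_defect (x w)) = act w\<^sub>J (act w\<^sub>J x) - x"
    using x by (auto simp: fun_eq_iff act_def twist_defect_def full_twist_def inv_w w_w_cancel K_parabolic_def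
      families_def T_zero)
  also have "\<dots> = symmetrizer J (signed J z + z')"
    unfolding z' unfolding z by (simp add: signed_def symmetrizer_add[OF J] symmetrizer_neg[OF J])
  finally show ?thesis by blast
qed

text \<open>When all \<open>T s\<close> act as \<open>-1\<close> on the values of \<open>y\<close>, the defect \<open>b = y (s w) + y w\<close> is in the
  eigenspace of \<open>T s\<close> for \<open>q\<close> as well as in that for \<open>-1\<close>, hence zero since \<open>q \<noteq> -1\<close>. So both
  \<open>y\<close> and \<open>T\<close> change sign with every letter, every \<open>act u\<close> with \<open>u \<in> W\<^sub>J\<close> fixes \<open>y\<close>, and
  \<open>A\<^sub>J y = |W\<^sub>J| y\<close>.\<close>

lemma fixed_families_symmetrizer:
  assumes y: "y \<in> K_parabolic J" and minus: "\<And>s w. s \<in> J \<Longrightarrow> T s (y w) = - y w"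
  shows "\<exists>z. y = symmetrizer J z"
proof -
  have alt: "y (s \<otimes> w) = - y w" if s: "s \<in> J" and w: "w \<in> carrier W" for s w
  proof -
    have sc: "s \<in> S" "s \<in> carrier W" using J_S s by auto
    obtain a where a: "y (s \<otimes> w) - T s (y w) = T s (T s a) - a"
      using y s w unfolding K_parabolic_def by blast
    define b where "b = T s (T s a) - a"
    have b: "b = scale (q - 1) (T s a + a)"
      using T_quadratic[OF sc(1)] by (simp add: b_def scale_right_distrib scale_left_diff_distrib)
    have "T s (T s a + a) = scale q (T s a + a)"
      using T_quadratic[OF sc(1), of a] sc
      by (simp add: T_add scale_right_distrib scale_left_diff_distrib)
    then have "T s b = scale q b"
      using sc unfolding b by (simp add: T_scale mult.commute)
    moreover have "T s b = - b"
      using minus[OF s] sc unfolding b_def a[symmetric] by (simp add: T_add)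
    ultimately have "scale q b + b = 0" by (metis add.left_inverse)
    then have "scale (q + 1) b = 0" by (simp add: scale_left_distrib)
    moreover have "q + 1 \<noteq> 0"
    proof
      assume "q + 1 = 0"
      then have "q = - 1" by (simp add: eq_neg_iff_add_eq_0)
      then show False using not_root_of_unity[of 2] by simp
    qed
    ultimately have "b = 0" by simp
    then show ?thesis using a minus[OF s] by (simp add: b_def eq_neg_iff_add_eq_0)
  qed
  have act_fixed: "T u (y (inv u \<otimes> w)) = y w" if u: "u \<in> parabolic J" and w: "w \<in> carrier W" for u w
  proof -
    have "\<exists>c. \<forall>w\<in>carrier W. y (u \<otimes> w) = scale c (y w) \<and> T u (y w) = scale c (y w)"
      using J u
    proof (induction rule: parabolic_induct)
      case one
      then show ?case by (intro exI[of _ 1]) (simp add: T_one)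
    next
      case (step s u)
      then obtain c where c: "\<forall>w\<in>carrier W. y (u \<otimes> w) = scale c (y w) \<and> T u (y w) = scale c (y w)"
        by blast
      have "s \<in> S" "u \<in> carrier W" using step J_S parabolic_carrier[OF J] by auto
      then have "\<forall>w\<in>carrier W. y (s \<otimes> u \<otimes> w) = scale (- c) (y w) \<and> T (s \<otimes> u) (y w) = scale (- c) (y w)"
        using c step alt minus by (simp add: T_mult_generator T_scale m_assoc)
      then show ?case by blast
    qed
    then obtain c where c: "\<And>w. w \<in> carrier W \<Longrightarrow> y (u \<otimes> w) = scale c (y w) \<and> T u (y w) = scale c (y w)"
      by blast
    have "u \<in> carrier W" using parabolic_carrier[OF J u] .
    then show ?thesis using c[of "inv u \<otimes> w"] w by simp
  qed
  define n where "n = of_nat (card (parabolic J)) * (1 :: complex)"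
  have n: "n \<noteq> 0" using finite_parabolic[OF J] parabolic_one by (auto simp: n_def)
  define z where "z w = scale (inverse n) (y w)" for w
  have "T u (z (inv u \<otimes> w)) = scale (inverse n) (y w)" if "u \<in> parabolic J" "w \<in> carrier W" for u w
    using act_fixed[OF that] parabolic_carrier[OF J that(1)] by (simp add: z_def T_scale)
  then have "symmetrizer J z w = y w" if "w \<in> carrier W" for w
    using that n by (simp add: symmetrizer_apply sum_constant_scale n_def)
  then have "y = symmetrizer J z"
    using y by (auto simp: fun_eq_iff symmetrizer_apply K_parabolic_def families_def)
  then show ?thesis by blast
qed

text \<open>All powers lie in one finite-dimensional space of endomorphisms, so they satisfy a linear
  relation that is valid on all of \<open>V\<close>, even when \<open>V\<close> is infinite-dimensional.\<close>

lemma twist_defect_power_span: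
  "(twist_defect ^^ i) \<in> module.span (\<lambda>c (F :: 'v \<Rightarrow> 'v) v. scale c (F v)) (T ` parabolic J)"
proof -
  let ?sc = "\<lambda>c (F :: 'v \<Rightarrow> 'v) v. scale c (F v)"
  interpret F: vector_space ?sc by (rule vector_space_fun) (rule vector_space_axioms)
  let ?H = "F.span (T ` parabolic J)"
  have gen: "(\<lambda>v. T s (G v)) \<in> ?H" if s: "s \<in> J" and G: "G \<in> ?H" for s G
    using G
  proof (induction rule: F.span_induct)
    case base
    have "T s 0 = 0" using J_S[OF s] by (simp add: T_zero)
    show ?case using J_S[OF s]
      by (intro F.subspaceI)
        (auto simp: T_add T_scale T_zero plus_fun_def zero_fun_def
          intro: F.span_add[unfolded plus_fun_def] F.span_scale F.span_zero[unfolded zero_fun_def])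
  next
    case (step G)
    then obtain u where u: "u \<in> parabolic J" "G = T u" by auto
    obtain c d where "\<And>v. T s (T u v) = scale c (T u v) + scale d (T (s \<otimes> u) v)"
      using T_generator_T[OF J s u(1)] by metis
    then have "(\<lambda>v. T s (G v)) = ?sc c (T u) + ?sc d (T (s \<otimes> u))"
      using u by (simp add: fun_eq_iff)
    moreover have "s \<otimes> u \<in> parabolic J" using parabolic_mult[OF J parabolic_generator[OF J s] u(1)] .
    ultimately show ?case
      using u(1) by (simp only:) (intro F.span_add F.span_scale F.span_base imageI)
  qed
  have odd_crossing: "(\<lambda>v. T u (G v)) \<in> ?H" if "u \<in> parabolic J" "G \<in> ?H" for u G
    using J that(1)
  proof (induction rule: parabolic_induct)
    case one
    then show ?case using that(2) by (simp add: T_one)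
  next
    case (step s u)
    then show ?case using gen[OF step(1,4)] J_S parabolic_carrier[OF J] by (simp add: T_mult_generator)
  qed
  show ?thesis
  proof (induction i)
    case 0
    have "twist_defect ^^ 0 = T \<one>" by (auto simp: T_one)
    then show ?case using F.span_base[OF imageI[OF parabolic_one]] by metis
  next
    case (Suc i)
    have "(twist_defect ^^ Suc i) = (\<lambda>v. T w\<^sub>J (T w\<^sub>J ((twist_defect ^^ i) v))) - (twist_defect ^^ i)"
      by (simp add: fun_eq_iff twist_defect_def full_twist_def)
    then show ?case using odd_crossing[OF w odd_crossing[OF w Suc]] Suc F.span_diff by metis
  qed
qed

text \<open>Split \<open>x = y + (\<pi> - 1) h(x)\<close> as in \<open>kernel_splitting\<close>, where \<open>h\<close> is a polynomial in the full
  twist \<open>\<pi>\<close> acting on the values. Because \<open>h\<close> commutes with all \<open>T s\<close>, both \<open>h(x)\<close> and \<open>y\<close> remain in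
  \<open>K\<^sub>J\<close>; the former is dealt with by \<open>twist_defect_K\<close>, the latter by
  \<open>fixed_families_symmetrizer\<close>.\<close>

lemma K_subset_symmetrizer:
  assumes IH: "\<And>I. I \<subset> J \<Longrightarrow> K_parabolic I \<subseteq> range (symmetrizer I)"
  shows "K_parabolic J \<subseteq> range (symmetrizer J)"
proof
  fix x assume x: "x \<in> K_parabolic J"
  let ?sc = "\<lambda>c (F :: 'v \<Rightarrow> 'v) v. scale c (F v)"
  have "vector_space ?sc" by (rule vector_space_fun) (rule vector_space_axioms)
  then obtain n c k where rel: "k \<le> n" "c k \<noteq> 0" "(\<Sum>i\<le>n. ?sc (c i) (twist_defect ^^ i)) = 0"
    using linear_relation[of ?sc "T ` parabolic J" "\<lambda>i. twist_defect ^^ i"]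
      finite_parabolic[OF J] twist_defect_power_span by blast
  have rel': "(\<Sum>i\<le>n. scale (c i) ((twist_defect ^^ i) v)) = 0" for v
    using fun_cong[OF rel(3), of v] by (simp add: sum_fun_apply)
  have ker: "twist_defect v = 0" if "twist_defect (twist_defect v) = 0" for v
  proof -
    have minus: "T s v = - v" if "s \<in> J" for s
      using unipotent_twist_minus_one[OF \<open>twist_defect (twist_defect v) = 0\<close> that] .
    obtain c where "c * c = 1" "T w\<^sub>J v = scale c v"
      using minus_one_action[OF J w minus] by blast
    then show ?thesis by (simp add: twist_defect_def full_twist_def T_scale)
  qed
  obtain m d where split: "\<And>v. twist_defect (v - twist_defect (\<Sum>i<m. scale (d i) ((twist_defect ^^ i) v))) = 0"
    using kernel_splitting[OF twist_defect_hom[unfolded module_hom_iff_linear] rel' rel(1,2) ker] by blast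
  define h where "h v = (\<Sum>i<m. scale (d i) ((twist_defect ^^ i) v))" for v
  have pow: "module_hom scale scale (twist_defect ^^ i)" for i
  proof (induction i)
    case (Suc i)
    then show ?case using module_hom_compose[OF Suc twist_defect_hom] by (simp add: comp_def)
  qed (simp add: endomorphismI)
  have pow_T: "(twist_defect ^^ i) (T s v) = T s ((twist_defect ^^ i) v)" if "s \<in> J" for i s v
    using that by (induction i) (simp_all add: twist_defect_T_generator)
  have h: "module_hom scale scale h"
    by (rule endomorphismI)
      (simp_all add: h_def module_hom.add[OF pow] module_hom.scale[OF pow] scale_right_distrib sum.distrib
        scale_sum_right mult.commute)
  have h_T: "h (T s v) = T s (h v)" if "s \<in> J" for s v
    using J_S[OF that] by (simp add: h_def pow_T[OF that] T_sum T_scale)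
  obtain z where z: "(\<lambda>w. twist_defect (h (x w))) = symmetrizer J z"
    using twist_defect_K[OF IH K_endo[OF J x h h_T]] by blast
  define y where "y w = x w - twist_defect (h (x w))" for w
  have "(\<lambda>w. x w - twist_defect (h (x w))) \<in> K_parabolic J"
  proof (rule K_endo[OF J x, of "\<lambda>v. v - twist_defect (h v)"])
    show "module_hom scale scale (\<lambda>v. v - twist_defect (h v))"
      by (rule endomorphismI)
        (simp_all add: module_hom.add[OF h] module_hom.scale[OF h] module_hom.add[OF twist_defect_hom]
          module_hom.scale[OF twist_defect_hom] scale_right_diff_distrib)
    show "T s v - twist_defect (h (T s v)) = T s (v - twist_defect (h v))" if "s \<in> J" for s v
      using J_S[OF that] by (simp add: h_T[OF that] twist_defect_T_generator[OF that] T_diff)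
  qed
  then have y: "y \<in> K_parabolic J" by (simp add: y_def[abs_def])
  have "twist_defect (y w) = 0" for w
    using split[of "x w"] by (simp add: y_def h_def)
  then have "twist_defect (twist_defect (y w)) = 0" for w
    by (simp add: module_hom.zero[OF twist_defect_hom])
  then have "T s (y w) = - y w" if "s \<in> J" for s w
    using unipotent_twist_minus_one that by blast
  then obtain z' where z': "y = symmetrizer J z'"
    using fixed_families_symmetrizer[OF y] by blast
  have "x = y + (\<lambda>w. twist_defect (h (x w)))" by (simp add: fun_eq_iff y_def)
  also have "\<dots> = symmetrizer J (z' + z)" by (simp only: z z' symmetrizer_add[OF J])
  finally show "x \<in> range (symmetrizer J)" by blast
qed

end

context hecke_module
begin

theorem K_eq_range_symmetrizer:
  assumes "J \<subseteq> S"
  shows "K_parabolic J = range (symmetrizer J)"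
proof -
  have "K_parabolic J \<subseteq> range (symmetrizer J)"
    using finite_J[OF assms] assms
  proof (induction J rule: finite_psubset_induct)
    case (psubset J)
    obtain w where w: "w \<in> parabolic J" "w \<otimes> w = \<one>"
      "\<And>v. v \<in> parabolic J \<Longrightarrow> (\<forall>s\<in>J. inversion v s) \<longleftrightarrow> v = w"
      "\<And>s. s \<in> J \<Longrightarrow> w \<otimes> s \<otimes> w \<in> J"
      by (rule longest_element[OF finite_W psubset.prems]) (assumption | blast)+
    interpret longest W S scale q T J w
      by unfold_locales (fact psubset.prems w)+
    show ?case using psubset by (intro K_subset_symmetrizer) auto
  qed
  then show ?thesis using symmetrizer_in_K[OF assms] by auto
qed

end

section \<open>Representations of the Hecke algebra\<close>

text \<open>The class of \<open>(s - q) (s + 1)\<close> in the quotient is zero, and \<open>\<pi>\<close> turns it into the corresponding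
  expression in endomorphisms; the scalar \<open>q\<close> needs the compatibility of \<open>\<pi>\<close> with the scalars of
  the group algebra.\<close>

lemma hecke_generator_quadratic:
  assumes rep: "hecke_representation W S q scale \<pi>" and s: "s \<in> S"
  defines "\<sigma> \<equiv> braid_action W S q \<pi> (braid_generator W S s)"
  shows "\<sigma> (\<sigma> v) = scale (q - 1) (\<sigma> v) + scale q v"
proof -
  let ?B = "braid_group W S" and ?A = "group_algebra (braid_group W S)" and ?H = "hecke_algebra W S q"
  interpret B: group ?B by (rule group_braid_group)
  interpret A: ring ?A by (rule ring_group_algebra) (rule group_braid_group)
  interpret I: ideal "hecke_ideal W S q" ?A by (rule ideal_hecke_ideal)
  interpret V: vector_space scale using rep by (simp add: hecke_representation_def)
  let ?cl = "hecke_class W S q"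
  have hom: "\<pi> \<in> Ring.ring_hom ?H (linear_endomorphisms scale)"
    and scalar: "\<And>c f v. f \<in> carrier ?A \<Longrightarrow> \<pi> (?cl (\<lambda>b. c * f b)) v = scale c (\<pi> (?cl f) v)"
    using rep by (auto simp: hecke_representation_def)
  have cls: "?cl f \<in> carrier ?H" if "f \<in> carrier ?A" for f
    using that unfolding hecke_class_def hecke_algebra_def FactRing_def
    by (auto simp: A_RCOSETS_def' a_r_coset_def')
  have mult: "\<pi> (?cl (f \<otimes>\<^bsub>?A\<^esub> h)) v = \<pi> (?cl f) (\<pi> (?cl h) v)" if "f \<in> carrier ?A" "h \<in> carrier ?A" for f h v
  proof -
    have "?cl f \<otimes>\<^bsub>?H\<^esub> ?cl h = ?cl (f \<otimes>\<^bsub>?A\<^esub> h)"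
      using I.rcoset_mult_add[OF that] by (simp add: hecke_class_def hecke_algebra_def FactRing_def)
    then show ?thesis using ring_hom_mult[OF hom cls[OF that(1)] cls[OF that(2)]]
      by (simp add: linear_endomorphisms_def)
  qed
  have add: "\<pi> (?cl (f \<oplus>\<^bsub>?A\<^esub> h)) v = \<pi> (?cl f) v + \<pi> (?cl h) v" if "f \<in> carrier ?A" "h \<in> carrier ?A" for f h v
  proof -
    have "?cl f \<oplus>\<^bsub>?H\<^esub> ?cl h = ?cl (f \<oplus>\<^bsub>?A\<^esub> h)"
      using I.a_rcos_sum[OF that] by (simp add: hecke_class_def hecke_algebra_def FactRing_def)
    then show ?thesis using ring_hom_add[OF hom cls[OF that(1)] cls[OF that(2)]]
      by (simp add: linear_endomorphisms_def)
  qed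
  define g where "g = braid_generator W S s"
  have g: "g \<in> carrier ?B" using s by (simp add: g_def braid_generator_closed)
  define a where "a = algebra_single g 1"
  define e where "e = algebra_single \<one>\<^bsub>?B\<^esub> q"
  have a: "a \<in> carrier ?A" and e: "e \<in> carrier ?A"
    using g by (auto simp: a_def e_def intro!: algebra_single_closed)
  have \<sigma>: "\<sigma> = \<pi> (?cl a)" by (simp add: \<sigma>_def braid_action_def a_def g_def)
  have one: "\<pi> (?cl \<one>\<^bsub>?A\<^esub>) v = v" for v
  proof -
    have "?cl \<one>\<^bsub>?A\<^esub> = \<one>\<^bsub>?H\<^esub>"
      by (simp add: hecke_class_def hecke_algebra_def FactRing_def)
    then show ?thesis using ring_hom_one[OF hom] by (simp add: linear_endomorphisms_def)
  qed
  have "e = (\<lambda>b. q * \<one>\<^bsub>?A\<^esub> b)" by (auto simp: e_def group_algebra_ops algebra_single_def)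
  then have pe: "\<pi> (?cl e) v = scale q v" for v using scalar[of "\<one>\<^bsub>?A\<^esub>" q v] one by simp
  have "(a \<ominus>\<^bsub>?A\<^esub> e) \<oplus>\<^bsub>?A\<^esub> e = a"
    using a e by (simp add: A.minus_eq A.a_assoc A.l_neg)
  then have pd: "\<pi> (?cl (a \<ominus>\<^bsub>?A\<^esub> e)) v = \<sigma> v - scale q v" for v
    using add[of "a \<ominus>\<^bsub>?A\<^esub> e" e v] a e pe by (simp add: \<sigma> eq_diff_eq)
  have ps: "\<pi> (?cl (a \<oplus>\<^bsub>?A\<^esub> \<one>\<^bsub>?A\<^esub>)) v = \<sigma> v + v" for v
    using add[OF a A.one_closed] one by (simp add: \<sigma>)
  let ?r = "(a \<ominus>\<^bsub>?A\<^esub> e) \<otimes>\<^bsub>?A\<^esub> (a \<oplus>\<^bsub>?A\<^esub> \<one>\<^bsub>?A\<^esub>)"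
  have r: "?r \<in> carrier ?A" using a e by simp
  have "?r \<in> hecke_ideal W S q"
  proof -
    let ?R = "{(algebra_single (braid_generator W S s) 1 \<ominus>\<^bsub>?A\<^esub> algebra_single \<one>\<^bsub>?B\<^esub> q) \<otimes>\<^bsub>?A\<^esub>
             (algebra_single (braid_generator W S s) 1 \<oplus>\<^bsub>?A\<^esub> \<one>\<^bsub>?A\<^esub>) | s. s \<in> S}"
    have "?R \<subseteq> carrier ?A"
      by (auto intro!: A.m_closed A.minus_closed A.a_closed algebra_single_closed braid_generator_closed)
    moreover have "?r \<in> ?R" using s by (auto simp: a_def e_def g_def)
    ultimately show ?thesis
      unfolding hecke_ideal_def Let_def using A.genideal_self by blast
  qed
  then have "?cl ?r = ?cl \<zero>\<^bsub>?A\<^esub>"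
    using I.a_rcos_const[of ?r] I.a_rcos_const[of "\<zero>\<^bsub>?A\<^esub>"] I.zero_closed by (simp add: hecke_class_def)
  moreover have "\<pi> (?cl \<zero>\<^bsub>?A\<^esub>) v = 0" for v
    using add[OF A.zero_closed A.zero_closed, of v] by simp
  ultimately have "\<pi> (?cl (a \<ominus>\<^bsub>?A\<^esub> e)) (\<pi> (?cl (a \<oplus>\<^bsub>?A\<^esub> \<one>\<^bsub>?A\<^esub>)) v) = 0"
    using mult[of "a \<ominus>\<^bsub>?A\<^esub> e" "a \<oplus>\<^bsub>?A\<^esub> \<one>\<^bsub>?A\<^esub>" v] a e by simp
  moreover have "\<sigma> (x + y) = \<sigma> x + \<sigma> y" for x y
  proof -
    have "Vector_Spaces.linear scale scale \<sigma>"
      using ring_hom_closed[OF hom cls[OF a]] by (simp add: \<sigma> linear_endomorphisms_def)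
    then show ?thesis by (simp add: module_hom.add flip: module_hom_iff_linear)
  qed
  ultimately show ?thesis
    by (simp add: pd ps V.scale_left_diff_distrib V.scale_right_distrib algebra_simps)
qed

theorem theorem11p5p1:
  fixes W :: "'w monoid" and S :: "'w set" and q :: complex
    and scale :: "complex \<Rightarrow> 'v \<Rightarrow> 'v :: ab_group_add"
    and \<pi> :: "('w word set \<Rightarrow> complex) set \<Rightarrow> 'v \<Rightarrow> 'v"
  assumes "coxeter_system W S" and "finite (carrier W)"
    and "\<forall>n::nat. n > 0 \<longrightarrow> q ^ n \<noteq> 1"
    and "hecke_representation W S q scale \<pi>"
  shows "good_representation W S scale (braid_action W S q \<pi>)"
proof -
  define \<rho> where "\<rho> = braid_action W S q \<pi>"
  define T where "T w = \<rho> (canonical_section W S w)" for w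
  interpret group W using assms(1) by (simp add: coxeter_system_def)
  interpret coxeter_group W S by unfold_locales (rule assms(1))
  have rep: "group_representation (braid_group W S) scale \<rho>"
    unfolding \<rho>_def by (rule group_representation_braid_action) (rule assms(4))
  interpret vector_space scale using rep by (simp add: group_representation_def)
  have hom: "\<rho> \<in> hom (braid_group W S) (general_linear_group scale)"
    using rep by (simp add: group_representation_def)
  have \<rho>_mult: "\<rho> (a \<otimes>\<^bsub>braid_group W S\<^esub> b) v = \<rho> a (\<rho> b v)"
    if "a \<in> carrier (braid_group W S)" "b \<in> carrier (braid_group W S)" for a b v
    using hom_mult[OF hom that] by (simp add: general_linear_group_def)
  have T_generator: "T s = \<rho> (braid_generator W S s)" if "s \<in> S" for s
    using that by (simp add: T_def canonical_section_generator)
  interpret hecke_module W S scale q T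
  proof (intro hecke_module.intro hecke_module_axioms.intro coxeter_group_axioms vector_space_axioms)
    show "finite (carrier W)" by fact
    show "q ^ n \<noteq> 1" if "n > 0" for n using assms(3) that by simp
    show "Vector_Spaces.linear scale scale (T w)" if "w \<in> carrier W" for w
      using hom_in_carrier[OF hom canonical_section_closed[OF that]]
      by (simp add: T_def general_linear_group_def)
    show "T \<one>\<^bsub>W\<^esub> v = v" for v
    proof -
      interpret B: group "braid_group W S" by (rule group_braid_group)
      have "bij (\<rho> \<one>\<^bsub>braid_group W S\<^esub>)"
        using hom_in_carrier[OF hom B.one_closed] by (simp add: general_linear_group_def)
      moreover have "\<rho> \<one>\<^bsub>braid_group W S\<^esub> (\<rho> \<one>\<^bsub>braid_group W S\<^esub> v) = \<rho> \<one>\<^bsub>braid_group W S\<^esub> v"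
        using \<rho>_mult[OF B.one_closed B.one_closed, of v] by simp
      ultimately show ?thesis
        by (simp add: T_def canonical_section_one bij_def inj_eq)
    qed
    show "T (a \<otimes>\<^bsub>W\<^esub> b) v = T a (T b v)"
      if "a \<in> carrier W" "b \<in> carrier W" "len (a \<otimes>\<^bsub>W\<^esub> b) = len a + len b" for a b v
      using that by (simp add: T_def canonical_section_mult \<rho>_mult canonical_section_closed)
    show "T s (T s v) = scale (q - 1) (T s v) + scale q v" if "s \<in> S" for s v
      using hecke_generator_quadratic[OF assms(4) that] T_generator[OF that] by (simp add: \<rho>_def)
  qed
  interpret F: vector_space "\<lambda>c (x :: 'w \<Rightarrow> 'v) w. scale c (x w)"
    by (rule vector_space_fun) (rule vector_space_axioms)
  have K_parabolic: "K_space W S \<rho> = K_parabolic S"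
  proof -
    have "V_sub W S \<rho> s = {T s (T s v) - v | v. True}" if "s \<in> S" for s
      using that by (auto simp: V_sub_def \<rho>_mult braid_generator_closed T_generator)
    then show ?thesis
      by (auto simp: K_space_def K_parabolic_def families_def T_generator)
  qed
  have embed: "K_embedding W S \<rho> y v = symmetrizer S (\<lambda>w. if w = y then v else 0)" if y: "y \<in> carrier W" for y v
  proof
    fix w
    show "K_embedding W S \<rho> y v w = symmetrizer S (\<lambda>w. if w = y then v else 0) w"
    proof (cases "w \<in> carrier W")
      case True
      have "(\<Sum>u\<in>carrier W. T u (if inv\<^bsub>W\<^esub> u \<otimes>\<^bsub>W\<^esub> w = y then v else 0)) =
          (\<Sum>u\<in>carrier W. if u = w \<otimes>\<^bsub>W\<^esub> inv\<^bsub>W\<^esub> y then T u v else 0)"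
      proof (rule sum.cong[OF refl])
        fix u assume u: "u \<in> carrier W"
        have "(inv\<^bsub>W\<^esub> u \<otimes>\<^bsub>W\<^esub> w = y) = (u = w \<otimes>\<^bsub>W\<^esub> inv\<^bsub>W\<^esub> y)"
          using u y True by (metis inv_solve_left inv_solve_right m_closed)
        then show "T u (if inv\<^bsub>W\<^esub> u \<otimes>\<^bsub>W\<^esub> w = y then v else 0) = (if u = w \<otimes>\<^bsub>W\<^esub> inv\<^bsub>W\<^esub> y then T u v else 0)"
          using u by (simp add: T_zero)
      qed
      then show ?thesis
        using True y finite_W by (simp add: K_embedding_def symmetrizer_apply parabolic_S T_def)
    qed (simp add: K_embedding_def symmetrizer_apply)
  qed
  let ?U = "\<Union>y\<in>carrier W. range (K_embedding W S \<rho> y)"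
  have K_range: "K_parabolic S = range (symmetrizer S)" by (rule K_eq_range_symmetrizer) simp
  have "F.span ?U = K_parabolic S"
  proof
    have "F.subspace (K_parabolic S)"
      unfolding K_range
    proof (rule F.subspaceI)
      show "0 \<in> range (symmetrizer S)" using symmetrizer_zero[OF order_refl] by (metis rangeI)
      show "x + y \<in> range (symmetrizer S)" if "x \<in> range (symmetrizer S)" "y \<in> range (symmetrizer S)" for x y
      proof -
        obtain a b where "x = symmetrizer S a" "y = symmetrizer S b" using \<open>x \<in> _\<close> \<open>y \<in> _\<close> by (elim rangeE)
        then have "x + y = symmetrizer S (a + b)" by (simp only: symmetrizer_add[OF order_refl])
        then show ?thesis by blast
      qed
      show "(\<lambda>w. scale c (x w)) \<in> range (symmetrizer S)" if "x \<in> range (symmetrizer S)" for c x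
      proof -
        obtain z where "x = symmetrizer S z" using \<open>x \<in> _\<close> by (elim rangeE)
        then have "(\<lambda>w. scale c (x w)) = symmetrizer S (\<lambda>w. scale c (z w))"
          by (auto simp: fun_eq_iff symmetrizer_apply scale_sum_right T_scale parabolic_S)
        then show ?thesis by blast
      qed
    qed
    moreover have "?U \<subseteq> K_parabolic S" using embed unfolding K_range by auto
    ultimately show "F.span ?U \<subseteq> K_parabolic S" by (rule F.span_minimal[rotated])
  next
    show "K_parabolic S \<subseteq> F.span ?U"
    proof
      fix x assume "x \<in> K_parabolic S"
      then obtain z where z: "x = symmetrizer S z" unfolding K_range by blast
      \<comment> \<open>Split \<open>z\<close> into families supported at one element.\<close>
      define e where "e y = (\<lambda>w. if w = y then z y else 0)" for y
      have "symmetrizer S z = symmetrizer S (\<Sum>y\<in>carrier W. e y)"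
        using finite_W by (auto simp: fun_eq_iff symmetrizer_apply sum_fun_apply e_def parabolic_S intro!: sum.cong)
      also have "\<dots> = (\<Sum>y\<in>carrier W. symmetrizer S (e y))"
        by (induction rule: finite_induct[OF finite_W]) (simp_all only: sum.empty sum.insert symmetrizer_add[OF order_refl] symmetrizer_zero[OF order_refl] not_False_eq_True)
      also have "\<dots> = (\<Sum>y\<in>carrier W. K_embedding W S \<rho> y (z y))"
        by (intro sum.cong refl) (simp add: embed e_def)
      finally have x: "x = (\<Sum>y\<in>carrier W. K_embedding W S \<rho> y (z y))" by (simp only: z)
      show "x \<in> F.span ?U"
        unfolding x by (intro F.span_sum F.span_base) blast
    qed
  qed
  then show ?thesis
    by (simp add: good_representation_def K_parabolic \<rho>_def[symmetric])
qed

end
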